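(* Let $\mathbf{k}$ be a field with $\mathrm{char}(\mathbf{k})\neq 2$ and let $n\ge 3$. Then the following birational maps of $\mathbb{P}^n_{\mathbf{k}}$ are elements of $G_n(\mathbf{k})$: $$\mu\colon [x_0:\dots:x_n]\dashrightarrow \left[x_0:x_1 :x_2\left(\tfrac{x_1}{x_0}\right)^2:x_3:\dots:x_n\right],$$ $$\nu \colon [x_0:\dots:x_n]\dashrightarrow \left[x_0:x_1 :x_2\tfrac{x_1}{x_0}:x_3\tfrac{x_1}{x_0}:x_4:\dots:x_n\right].$$ Moreover, the birational map $$\xi_n \colon [x_0:\dots:x_n]\dashrightarrow \left[x_0:x_1 :x_2\tfrac{x_1}{x_0}:x_3:\dots:x_n\right]$$ belongs to $G_n(\mathbf{k})$ if and only if $n$ is even.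
   Context: The standard involution is $\sigma_n\colon [x_0:\dots:x_n]\dashrightarrow [\frac{1}{x_0}:\dots:\frac{1}{x_n}]$, and $G_n(\mathbf{k})=\langle \sigma_n,\mathrm{Aut}(\mathbb{P}^n_{\mathbf{k}})\rangle$ is a subgroup of the group $\mathrm{Bir}(\mathbb{P}^n_{\mathbf{k}})$ of birational transformations of $\mathbb{P}^n_{\mathbf{k}}$. *)

theory Defs
  imports
    "HOL-Library.Poly_Mapping"
    "HOL-Computational_Algebra.Polynomial_Factorial"
    "HOL-Algebra.Generated_Groups"
    "HOL-Algebra.Ideal"
begin

section \<open>Polynomials in the homogeneous coordinates\<close>

text \<open>
  Polynomials over \<open>'k\<close> in the variables \<open>x\<^sub>0, x\<^sub>1, \<dots>\<close>; the exponent vector of a monomial is a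
  finitely supported function \<^typ>\<open>nat \<Rightarrow>\<^sub>0 nat\<close>. The dimension \<open>n\<close> of the projective space is an
  ordinary natural number, and the ring \<open>k[x\<^sub>0, \<dots>, x\<^sub>n]\<close> is a carrier set inside this type.
\<close>

type_synonym 'k mpoly = "(nat \<Rightarrow>\<^sub>0 nat) \<Rightarrow>\<^sub>0 'k"

definition var :: "nat \<Rightarrow> 'k::field mpoly" where
  "var i = Poly_Mapping.single (Poly_Mapping.single i 1) 1"

definition mdeg :: "(nat \<Rightarrow>\<^sub>0 nat) \<Rightarrow> nat" where
  "mdeg m = (\<Sum>i\<in>Poly_Mapping.keys m. Poly_Mapping.lookup m i)"

definition polys :: "nat \<Rightarrow> 'k::field mpoly set" where
  "polys n = {p. \<forall>m\<in>Poly_Mapping.keys p. Poly_Mapping.keys m \<subseteq> {..n}}"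

definition hom_polys :: "nat \<Rightarrow> nat \<Rightarrow> 'k::field mpoly set" where
  "hom_polys n d = {p \<in> polys n. \<forall>m\<in>Poly_Mapping.keys p. mdeg m = d}"

definition poly_ring :: "nat \<Rightarrow> 'k::field mpoly ring" where
  "poly_ring n = \<lparr>carrier = polys n, mult = (*), one = 1, zero = 0, add = (+)\<rparr>"

definition mon_subst :: "(nat \<Rightarrow> 'k::field mpoly) \<Rightarrow> (nat \<Rightarrow>\<^sub>0 nat) \<Rightarrow> 'k mpoly" where
  "mon_subst G m = (\<Prod>i\<in>Poly_Mapping.keys m. G i ^ Poly_Mapping.lookup m i)"

text \<open>\<open>poly_subst G p\<close> is \<open>p(G\<^sub>0, G\<^sub>1, \<dots>)\<close>.\<close>

definition poly_subst :: "(nat \<Rightarrow> 'k::field mpoly) \<Rightarrow> 'k mpoly \<Rightarrow> 'k mpoly" where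
  "poly_subst G p =
     (\<Sum>m\<in>Poly_Mapping.keys p. Poly_Mapping.single 0 (Poly_Mapping.lookup p m) * mon_subst G m)"


section \<open>Rational self-maps of projective space\<close>

text \<open>
  A rational map from \<open>\<bbbP>\<^sup>n\<close> to itself is a class of tuples \<open>(F\<^sub>0, \<dots>, F\<^sub>n)\<close> of homogeneous polynomials
  of the same degree, not all zero, modulo proportionality over \<open>k(x\<^sub>0, \<dots>, x\<^sub>n)\<close>. A tuple is
  a function on \<open>nat\<close> whose values beyond \<open>n\<close> are arbitrary and ignored by the relation.
\<close>

type_synonym 'k tuple = "nat \<Rightarrow> 'k mpoly"
type_synonym 'k rat_map = "'k tuple set"

definition hom_tuples :: "nat \<Rightarrow> 'k::field tuple set" where
  "hom_tuples n = {F. (\<exists>d. \<forall>i\<le>n. F i \<in> hom_polys n d) \<and> (\<exists>i\<le>n. F i \<noteq> 0)}"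

definition proportional :: "nat \<Rightarrow> ('k::field tuple \<times> 'k tuple) set" where
  "proportional n = {(F, G). F \<in> hom_tuples n \<and> G \<in> hom_tuples n \<and>
                             (\<forall>i\<le>n. \<forall>j\<le>n. F i * G j = F j * G i)}"

definition rat_maps :: "nat \<Rightarrow> 'k::field rat_map set" where
  "rat_maps n = hom_tuples n // proportional n"

text \<open>
  The rational map written \<open>[f\<^sub>0 : \<dots> : f\<^sub>n]\<close> for rational functions \<open>f\<^sub>i\<close>: all tuples of homogeneous
  polynomials that are proportional to \<open>(f\<^sub>0, \<dots>, f\<^sub>n)\<close>.
\<close>

definition rat_map_of :: "nat \<Rightarrow> (nat \<Rightarrow> 'k::field mpoly fract) \<Rightarrow> 'k rat_map" where
  "rat_map_of n f = {F \<in> hom_tuples n. \<forall>i\<le>n. \<forall>j\<le>n. to_fract (F i) * f j = to_fract (F j) * f i}"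

definition coord :: "nat \<Rightarrow> 'k::field mpoly fract" where
  "coord i = to_fract (var i)"

definition rat_id :: "nat \<Rightarrow> 'k::field rat_map" where
  "rat_id n = rat_map_of n coord"

text \<open>
  Composition, \<open>\<phi>\<close> after \<open>\<psi>\<close>. A pair of representatives for which the substituted tuple vanishes
  identically contributes nothing to the union, since \<^const>\<open>proportional\<close> only relates elements of
  \<^const>\<open>hom_tuples\<close>. The result is therefore the empty set, which is no rational map, exactly when
  \<open>\<phi> \<circ> \<psi>\<close> is undefined in the sense that \<open>\<psi>\<close> maps into the base locus of every representative of
  \<open>\<phi>\<close>; otherwise it is a single class (lemma \<open>rat_comp_classes\<close> below).
\<close>

definition rat_comp :: "nat \<Rightarrow> 'k::field rat_map \<Rightarrow> 'k rat_map \<Rightarrow> 'k rat_map" where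
  "rat_comp n \<phi> \<psi> = (\<Union>F\<in>\<phi>. \<Union>G\<in>\<psi>. proportional n `` {\<lambda>i. poly_subst G (F i)})"

definition Bir_proj :: "nat \<Rightarrow> 'k::field rat_map monoid" where
  "Bir_proj n = \<lparr>carrier = {\<phi> \<in> rat_maps n. \<exists>\<psi>\<in>rat_maps n. rat_comp n \<phi> \<psi> = rat_id n \<and>
                                                        rat_comp n \<psi> \<phi> = rat_id n},
            mult = rat_comp n, one = rat_id n\<rparr>"


section \<open>Automorphisms of projective space\<close>

text \<open>
  The points of the scheme \<open>\<bbbP>\<^sup>n = Proj k[x\<^sub>0, \<dots>, x\<^sub>n]\<close>: the homogeneous prime ideals that do not
  contain all the variables. An ideal is homogeneous if it is generated by its homogeneous elements.
\<close>

definition proj_points :: "nat \<Rightarrow> 'k::field mpoly set set" where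
  "proj_points n = {P. primeideal P (poly_ring n) \<and>
                       P = Idl\<^bsub>poly_ring n\<^esub> (P \<inter> (\<Union>d. hom_polys n d)) \<and>
                       \<not> var ` {..n} \<subseteq> P}"

text \<open>
  A rational map is defined at a point \<open>P\<close> if some representative has no common zero at \<open>P\<close>
  (after clearing denominators prime to \<open>P\<close>, this is the existence of a representative by elements
  of the local ring at \<open>P\<close> one of which is a unit). The representative may depend on the point.
\<close>

definition defined_at :: "nat \<Rightarrow> 'k::field rat_map \<Rightarrow> 'k mpoly set \<Rightarrow> bool" where
  "defined_at n \<phi> P \<longleftrightarrow> (\<exists>F\<in>\<phi>. \<exists>i\<le>n. F i \<notin> P)"

definition proj_morphisms :: "nat \<Rightarrow> 'k::field rat_map set" where
  "proj_morphisms n = {\<phi> \<in> rat_maps n. \<forall>P\<in>proj_points n. defined_at n \<phi> P}"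

definition Aut_proj :: "nat \<Rightarrow> 'k::field rat_map set" where
  "Aut_proj n = {\<phi> \<in> proj_morphisms n. \<exists>\<psi>\<in>proj_morphisms n. rat_comp n \<phi> \<psi> = rat_id n \<and>
                                               rat_comp n \<psi> \<phi> = rat_id n}"


section \<open>The group generated by the standard involution and the automorphisms\<close>

definition std_involution :: "nat \<Rightarrow> 'k::field rat_map" where
  "std_involution n = rat_map_of n (\<lambda>i. 1 / coord i)"

definition G_proj :: "nat \<Rightarrow> 'k::field rat_map set" where
  "G_proj n = generate (Bir_proj n) ({std_involution n} \<union> Aut_proj n)"

definition mu_map :: "nat \<Rightarrow> 'k::field rat_map" where
  "mu_map n = rat_map_of n (coord(2 := coord 2 * (coord 1 / coord 0) ^ 2))"

definition nu_map :: "nat \<Rightarrow> 'k::field rat_map" where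
  "nu_map n = rat_map_of n (coord(2 := coord 2 * (coord 1 / coord 0), 3 := coord 3 * (coord 1 / coord 0)))"

definition xi_map :: "nat \<Rightarrow> 'k::field rat_map" where
  "xi_map n = rat_map_of n (coord(2 := coord 2 * (coord 1 / coord 0)))"

section \<open>\<open>Bir_proj n\<close> is a group and the maps above are birational\<close>

text \<open>
  In particular \<^const>\<open>generate\<close> in \<^const>\<open>G_proj\<close> is applied to a genuine group and to a subset
  of it.
\<close>


lemma mon_subst_superset:
  assumes "finite S" "Poly_Mapping.keys m \<subseteq> S"
  shows "mon_subst G m = (\<Prod>i\<in>S. G i ^ Poly_Mapping.lookup m i)"
  unfolding mon_subst_def
  by (rule prod.mono_neutral_left) (use assms in \<open>auto simp: in_keys_iff\<close>)

lemma mon_subst_0 [simp]: "mon_subst G 0 = 1"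
  by (simp add: mon_subst_def)

lemma mon_subst_add: "mon_subst G (a + b) = mon_subst G a * mon_subst G b"
proof -
  let ?S = "Poly_Mapping.keys a \<union> Poly_Mapping.keys b"
  have "Poly_Mapping.keys (a + b) \<subseteq> ?S" by (rule Poly_Mapping.keys_add)
  then show ?thesis
    by (simp add: mon_subst_superset[of ?S] lookup_add power_add prod.distrib)
qed

lemma poly_subst_superset:
  assumes "finite S" "Poly_Mapping.keys p \<subseteq> S"
  shows "poly_subst G p =
     (\<Sum>m\<in>S. Poly_Mapping.single 0 (Poly_Mapping.lookup p m) * mon_subst G m)"
  unfolding poly_subst_def
  by (rule sum.mono_neutral_left) (use assms in \<open>auto simp: in_keys_iff\<close>)

lemma poly_subst_0 [simp]: "poly_subst G 0 = 0"
  by (simp add: poly_subst_def)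

lemma poly_subst_add: "poly_subst G (p + q) = poly_subst G p + poly_subst G q"
proof -
  let ?S = "Poly_Mapping.keys p \<union> Poly_Mapping.keys q"
  have "Poly_Mapping.keys (p + q) \<subseteq> ?S" by (rule Poly_Mapping.keys_add)
  then show ?thesis
    by (simp add: poly_subst_superset[of ?S] lookup_add single_add distrib_right sum.distrib)
qed

lemma poly_subst_single:
  "poly_subst G (Poly_Mapping.single m c) = Poly_Mapping.single 0 c * mon_subst G m"
  by (simp add: poly_subst_superset[of "{m}"])

lemma poly_subst_sum: "poly_subst G (sum f A) = (\<Sum>a\<in>A. poly_subst G (f a))"
  by (induction A rule: infinite_finite_induct) (auto simp: poly_subst_add)

lemma mpoly_expand:
  "p = (\<Sum>m\<in>Poly_Mapping.keys p. Poly_Mapping.single m (Poly_Mapping.lookup p m))"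
  by (rule poly_mapping_eqI)
     (simp add: lookup_sum lookup_single when_def in_keys_iff)

lemma poly_subst_mult: "poly_subst G (p * q) = poly_subst G p * poly_subst G q"
proof -
  have s: "poly_subst G (Poly_Mapping.single a c * Poly_Mapping.single b d) =
        poly_subst G (Poly_Mapping.single a c) * poly_subst G (Poly_Mapping.single b d)" for a b c d
  proof -
    have "Poly_Mapping.single 0 (c * d) = Poly_Mapping.single (0::nat \<Rightarrow>\<^sub>0 nat) c * Poly_Mapping.single 0 d"
      by (simp add: mult_single)
    then show ?thesis
      by (simp add: mult_single poly_subst_single mon_subst_add mult_ac)
  qed
  let ?f = "\<lambda>r m. Poly_Mapping.single m (Poly_Mapping.lookup r m)"
  have "poly_subst G (p * q) = poly_subst G ((\<Sum>a\<in>Poly_Mapping.keys p. ?f p a) * (\<Sum>b\<in>Poly_Mapping.keys q. ?f q b))"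
    using mpoly_expand[of p] mpoly_expand[of q] by simp
  also have "\<dots> = poly_subst G (\<Sum>a\<in>Poly_Mapping.keys p. ?f p a) * poly_subst G (\<Sum>b\<in>Poly_Mapping.keys q. ?f q b)"
    by (simp add: sum_product poly_subst_sum s)
  finally show ?thesis
    using mpoly_expand[of p] mpoly_expand[of q] by simp
qed

lemma poly_subst_1 [simp]: "poly_subst G 1 = 1"
  using poly_subst_single[of G 0 1] by simp

lemma poly_subst_const [simp]: "poly_subst G (Poly_Mapping.single 0 c) = Poly_Mapping.single 0 c"
  by (simp add: poly_subst_single)

lemma poly_subst_power: "poly_subst G (p ^ k) = poly_subst G p ^ k"
  by (induction k) (auto simp: poly_subst_mult)

lemma poly_subst_prod: "poly_subst G (prod f A) = (\<Prod>a\<in>A. poly_subst G (f a))"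
  by (induction A rule: infinite_finite_induct) (auto simp: poly_subst_mult)

lemma poly_subst_var [simp]: "poly_subst G (var i) = G i"
  by (simp add: var_def poly_subst_single mon_subst_def)

lemma poly_subst_comp: "poly_subst H (poly_subst G p) = poly_subst (\<lambda>i. poly_subst H (G i)) p"
  by (simp add: poly_subst_def[of G] poly_subst_def[of "\<lambda>i. poly_subst H (G i)"]
      poly_subst_sum poly_subst_mult mon_subst_def poly_subst_prod poly_subst_power)

lemma poly_subst_cong:
  assumes "p \<in> polys n" "\<And>i. i \<le> n \<Longrightarrow> G i = H i"
  shows "poly_subst G p = poly_subst H p"
  unfolding poly_subst_def mon_subst_def
  by (intro sum.cong prod.cong arg_cong2[where f="(*)"] refl)
     (use assms in \<open>auto simp: polys_def subset_iff\<close>)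

lemma var_power_mon: "var i ^ k = Poly_Mapping.single (Poly_Mapping.single i k) 1"
  by (induction k) (auto simp: var_def mult_single single_add[symmetric])

lemma mon_subst_var: "mon_subst var m = Poly_Mapping.single m 1"
proof -
  have *: "(\<Prod>i\<in>A. Poly_Mapping.single (f i) (1::'a)) = Poly_Mapping.single (sum f A) 1"
    if "finite A" for A :: "nat set" and f :: "nat \<Rightarrow> nat \<Rightarrow>\<^sub>0 nat"
    using that by induction (auto simp: mult_single)
  have e: "(\<Sum>i\<in>Poly_Mapping.keys m. Poly_Mapping.single i (Poly_Mapping.lookup m i)) = m"
    by (rule poly_mapping_eqI) (simp add: lookup_sum lookup_single when_def in_keys_iff)
  show ?thesis
    unfolding mon_subst_def var_power_mon by (subst *) (simp_all add: e)
qed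

lemma poly_subst_id [simp]: "poly_subst var p = p"
  by (simp add: poly_subst_def mon_subst_var mult_single mpoly_expand[symmetric])

lemma mdeg_superset:
  assumes "finite S" "Poly_Mapping.keys m \<subseteq> S"
  shows "mdeg m = (\<Sum>i\<in>S. Poly_Mapping.lookup m i)"
  unfolding mdeg_def
  by (rule sum.mono_neutral_left) (use assms in \<open>auto simp: in_keys_iff\<close>)

lemma mdeg_add: "mdeg (a + b) = mdeg a + mdeg b"
proof -
  let ?S = "Poly_Mapping.keys a \<union> Poly_Mapping.keys b"
  have "Poly_Mapping.keys (a + b) \<subseteq> ?S" by (rule Poly_Mapping.keys_add)
  then show ?thesis
    by (simp add: mdeg_superset[of ?S] lookup_add sum.distrib)
qed

lemma mdeg_0 [simp]: "mdeg 0 = 0" by (simp add: mdeg_def)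

lemma polys_0 [simp]: "0 \<in> polys n" and polys_1 [simp]: "1 \<in> polys n"
  and polys_const [simp]: "Poly_Mapping.single 0 c \<in> polys n"
  by (auto simp: polys_def)

lemma polys_add: "p \<in> polys n \<Longrightarrow> q \<in> polys n \<Longrightarrow> p + q \<in> polys n"
  unfolding polys_def using Poly_Mapping.keys_add[of p q] by blast

lemma polys_uminus: "p \<in> polys n \<Longrightarrow> - p \<in> polys n"
  by (simp add: polys_def)

lemma polys_mult: "p \<in> polys n \<Longrightarrow> q \<in> polys n \<Longrightarrow> p * q \<in> polys n"
proof (unfold polys_def mem_Collect_eq, intro ballI)
  fix m assume p: "\<forall>m\<in>Poly_Mapping.keys p. Poly_Mapping.keys m \<subseteq> {..n}"
    and q: "\<forall>m\<in>Poly_Mapping.keys q. Poly_Mapping.keys m \<subseteq> {..n}"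
    and "m \<in> Poly_Mapping.keys (p * q)"
  then obtain a b where "m = a + b" "a \<in> Poly_Mapping.keys p" "b \<in> Poly_Mapping.keys q"
    using keys_mult[of p q] by blast
  then show "Poly_Mapping.keys m \<subseteq> {..n}"
    using p q Poly_Mapping.keys_add[of a b] by (meson Un_least subset_trans)
qed

lemma cring_poly_ring: "cring (poly_ring n :: 'k::field mpoly ring)"
proof (intro cringI abelian_groupI comm_monoidI)
  fix x :: "'k mpoly" assume "x \<in> carrier (poly_ring n)"
  then show "\<exists>y\<in>carrier (poly_ring n). y \<oplus>\<^bsub>poly_ring n\<^esub> x = \<zero>\<^bsub>poly_ring n\<^esub>"
    by (intro bexI[of _ "-x"]) (auto simp: poly_ring_def polys_uminus)
qed (auto simp: poly_ring_def polys_add polys_mult algebra_simps)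

lemma hom_polys_0 [simp]: "0 \<in> hom_polys n d"
  and hom_polys_const [simp]: "Poly_Mapping.single 0 c \<in> hom_polys n 0"
  by (auto simp: hom_polys_def polys_def)

lemma hom_polys_1 [simp]: "1 \<in> hom_polys n 0"
  using hom_polys_const[of 1 n] by simp

lemma hom_polys_var: "i \<le> n \<Longrightarrow> var i \<in> hom_polys n 1"
  by (auto simp: hom_polys_def polys_def var_def mdeg_def)

lemma hom_polys_add: "p \<in> hom_polys n d \<Longrightarrow> q \<in> hom_polys n d \<Longrightarrow> p + q \<in> hom_polys n d"
  unfolding hom_polys_def using Poly_Mapping.keys_add[of p q] by (blast intro: polys_add)

lemma hom_polys_sum: "(\<And>a. a \<in> A \<Longrightarrow> f a \<in> hom_polys n d) \<Longrightarrow> sum f A \<in> hom_polys n d"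
  by (induction A rule: infinite_finite_induct) (auto simp: hom_polys_add)

lemma hom_polys_mult: "p \<in> hom_polys n d \<Longrightarrow> q \<in> hom_polys n e \<Longrightarrow> p * q \<in> hom_polys n (d + e)"
  using keys_mult[of p q] by (auto simp: hom_polys_def polys_mult mdeg_add)

lemma hom_polys_power: "p \<in> hom_polys n d \<Longrightarrow> p ^ k \<in> hom_polys n (k * d)"
  by (induction k) (auto simp: hom_polys_mult)

lemma hom_polys_prod:
  "(\<And>a. a \<in> A \<Longrightarrow> f a \<in> hom_polys n (e a)) \<Longrightarrow> finite A \<Longrightarrow> prod f A \<in> hom_polys n (sum e A)"
  by (induction A rule: infinite_finite_induct) (auto simp: hom_polys_mult)

lemma hom_polys_subst:
  assumes "p \<in> hom_polys n d" "\<And>i. i \<le> n \<Longrightarrow> G i \<in> hom_polys m e"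
  shows "poly_subst G p \<in> hom_polys m (d * e)"
  unfolding poly_subst_def
proof (rule hom_polys_sum)
  fix a assume a: "a \<in> Poly_Mapping.keys p"
  have G: "G i \<in> hom_polys m e" if "i \<in> Poly_Mapping.keys a" for i
    using a that assms by (auto simp: hom_polys_def[of n] polys_def)
  have "mon_subst G a \<in> hom_polys m (\<Sum>i\<in>Poly_Mapping.keys a. Poly_Mapping.lookup a i * e)"
    unfolding mon_subst_def
    by (rule hom_polys_prod) (auto intro: hom_polys_power G)
  also have "(\<Sum>i\<in>Poly_Mapping.keys a. Poly_Mapping.lookup a i * e) = d * e"
    using a assms(1) by (simp add: sum_distrib_right[symmetric] mdeg_def hom_polys_def)
  finally show "Poly_Mapping.single 0 (Poly_Mapping.lookup p a) * mon_subst G a \<in> hom_polys m (d * e)"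
    using hom_polys_mult[OF hom_polys_const] by simp
qed

lemma poly_subst_scale:
  assumes "p \<in> hom_polys n d"
  shows "poly_subst (\<lambda>i. c * G i) p = c ^ d * poly_subst G p"
proof -
  have "mon_subst (\<lambda>i. c * G i) m = c ^ d * mon_subst G m" if "m \<in> Poly_Mapping.keys p" for m
    using that assms
    by (simp add: mon_subst_def power_mult_distrib prod.distrib hom_polys_def mdeg_def flip: power_sum)
  then show ?thesis
    by (simp add: poly_subst_def sum_distrib_left mult_ac)
qed

lemma hom_polysD: "p \<in> hom_polys n d \<Longrightarrow> p \<in> polys n"
  by (simp add: hom_polys_def)

lemma proportional_refl: "F \<in> hom_tuples n \<Longrightarrow> (F, F) \<in> proportional n"
  by (auto simp: proportional_def mult_ac)

lemma equiv_proportional: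
  "equiv (hom_tuples n) (proportional n :: ('k::field tuple \<times> 'k tuple) set)"
proof (rule equivI)
  show "proportional n \<subseteq> hom_tuples n \<times> hom_tuples n" by (auto simp: proportional_def)
  show "refl_on (hom_tuples n) (proportional n)"
    by (auto simp: refl_on_def proportional_def mult_ac)
  show "sym (proportional n)"
    by (auto simp: sym_def proportional_def mult.commute) 
  have "(F, H) \<in> proportional n"
    if 1: "(F, G) \<in> proportional n" and 2: "(G, H) \<in> proportional n" for F G H :: "'k tuple"
  proof -
    obtain k where k: "k \<le> n" "G k \<noteq> 0" using 1 by (auto simp: proportional_def hom_tuples_def)
    have "F i * H j = F j * H i" if "i \<le> n" "j \<le> n" for i j
    proof -
      have "(G k * G k) * (F i * H j) = (F i * G k) * (G k * H j)" by (simp add: mult_ac)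
      also have "\<dots> = (F k * G i) * (G j * H k)" using 1 2 k that by (auto simp: proportional_def)
      also have "\<dots> = (F k * G j) * (G i * H k)" by (simp add: mult_ac)
      also have "\<dots> = (F j * G k) * (G k * H i)" using 1 2 k that by (auto simp: proportional_def)
      finally have "(G k * G k) * (F i * H j) = (G k * G k) * (F j * H i)" by (simp add: mult_ac)
      with k show ?thesis by simp
    qed
    with 1 2 show ?thesis by (auto simp: proportional_def)
  qed
  then show "trans (proportional n :: ('k tuple \<times> 'k tuple) set)" by (meson transI)
qed

abbreviation cls :: "nat \<Rightarrow> 'k::field tuple \<Rightarrow> 'k rat_map" where
  "cls n F \<equiv> proportional n `` {F}"

lemma cls_eq_iff:
  "F \<in> hom_tuples n \<Longrightarrow> G \<in> hom_tuples n \<Longrightarrow> cls n F = cls n G \<longleftrightarrow> (F, G) \<in> proportional n"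
  using equiv_proportional eq_equiv_class_iff by metis

lemma rat_map_of_eq_cls:
  assumes "F \<in> hom_tuples n" "\<And>i. i \<le> n \<Longrightarrow> to_fract (F i) = c * f i" "c \<noteq> 0"
  shows "rat_map_of n f = cls n F"
proof -
  have "(\<forall>i\<le>n. \<forall>j\<le>n. to_fract (H i) * f j = to_fract (H j) * f i) \<longleftrightarrow>
        (\<forall>i\<le>n. \<forall>j\<le>n. F i * H j = F j * H i)" for H :: "'a tuple"
  proof -
    have "to_fract (H i) * f j = to_fract (H j) * f i \<longleftrightarrow> F i * H j = F j * H i"
      if "i \<le> n" "j \<le> n" for i j
    proof -
      have "F i * H j = F j * H i \<longleftrightarrow> to_fract (F i * H j) = to_fract (F j * H i)" 
        by (simp only: to_fract_eq_iff)
      also have "\<dots> \<longleftrightarrow> c * (f i * to_fract (H j)) = c * (f j * to_fract (H i))"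
        using assms(2) that by (simp add: mult_ac)
      also have "\<dots> \<longleftrightarrow> to_fract (H i) * f j = to_fract (H j) * f i"
        using \<open>c \<noteq> 0\<close> by (auto simp: mult_ac)
      finally show ?thesis by simp
    qed
    then show ?thesis by blast
  qed
  with assms(1) show ?thesis by (auto simp: rat_map_of_def proportional_def)
qed

lemma var_nonzero [simp]: "var i \<noteq> 0"
  by (simp add: var_def) (metis lookup_single_eq lookup_zero zero_neq_one)

lemma var_tuple: "var \<in> hom_tuples n"
  unfolding hom_tuples_def using hom_polys_var[of _ n] by (auto intro: exI[of _ 0])

lemma rat_id_eq: "rat_id n = cls n var"
  unfolding rat_id_def by (rule rat_map_of_eq_cls[where c=1]) (auto simp: coord_def var_tuple)

lemma cls_rat_map: "F \<in> hom_tuples n \<Longrightarrow> cls n F \<in> rat_maps n"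
  by (simp add: rat_maps_def quotientI)

lemma rat_mapE:
  assumes "\<phi> \<in> rat_maps n" obtains F where "F \<in> hom_tuples n" "\<phi> = cls n F"
  using assms by (auto simp: rat_maps_def elim!: quotientE)

lemma subst_proportional:
  assumes F: "(F, F') \<in> proportional n" and G: "(G, G') \<in> proportional n"
    and t: "(\<lambda>i. poly_subst G (F i)) \<in> hom_tuples n"
    and t': "(\<lambda>i. poly_subst G' (F' i)) \<in> hom_tuples n"
  shows "((\<lambda>i. poly_subst G (F i)), (\<lambda>i. poly_subst G' (F' i))) \<in> proportional n"
proof -
  obtain k where k: "k \<le> n" "G k \<noteq> 0" using G by (auto simp: proportional_def hom_tuples_def)
  have k': "G' k \<noteq> 0"
  proof
    assume "G' k = 0"
    then have "G' i = 0" if "i \<le> n" for i 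
    proof -
      have "G k * G' i = G i * G' k" using G k that by (simp add: proportional_def)
      then show ?thesis using k \<open>G' k = 0\<close> by simp
    qed
    then show False using G by (auto simp: proportional_def hom_tuples_def)
  qed
  obtain d where d: "\<And>i. i \<le> n \<Longrightarrow> F i \<in> hom_polys n d"
    using F by (auto simp: proportional_def hom_tuples_def)
  obtain d' where d': "\<And>i. i \<le> n \<Longrightarrow> F' i \<in> hom_polys n d'"
    using F by (auto simp: proportional_def hom_tuples_def)
  have FF: "poly_subst H (F i) * poly_subst H (F' j) = poly_subst H (F j) * poly_subst H (F' i)"
    if "i \<le> n" "j \<le> n" for H i j
    using F that by (simp add: proportional_def flip: poly_subst_mult)
  have sc: "G k ^ d' * poly_subst G' (F' i) = G' k ^ d' * poly_subst G (F' i)" if "i \<le> n" for i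
  proof -
    have "G k ^ d' * poly_subst G' (F' i) = poly_subst (\<lambda>j. G k * G' j) (F' i)"
      using poly_subst_scale d' that by metis
    also have "\<dots> = poly_subst (\<lambda>j. G' k * G j) (F' i)"
    proof (rule poly_subst_cong)
      show "F' i \<in> polys n" using d' that hom_polysD by blast
      show "G k * G' j = G' k * G j" if "j \<le> n" for j
        using G k that by (auto simp: proportional_def mult.commute)
    qed
    also have "\<dots> = G' k ^ d' * poly_subst G (F' i)"
      using poly_subst_scale d' that by metis
    finally show ?thesis .
  qed
  have "poly_subst G (F i) * poly_subst G' (F' j) = poly_subst G (F j) * poly_subst G' (F' i)"
    if ij: "i \<le> n" "j \<le> n" for i j
  proof -
    have "G k ^ d' * (poly_subst G (F i) * poly_subst G' (F' j)) =
          poly_subst G (F i) * (G k ^ d' * poly_subst G' (F' j))" by (simp add: mult_ac)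
    also have "\<dots> = G' k ^ d' * (poly_subst G (F i) * poly_subst G (F' j))"
      using sc ij by (simp add: mult_ac)
    also have "\<dots> = poly_subst G (F j) * (G' k ^ d' * poly_subst G (F' i))"
      using FF[OF ij] by (simp add: mult_ac)
    also have "\<dots> = poly_subst G (F j) * (G k ^ d' * poly_subst G' (F' i))"
      using sc ij by simp
    also have "\<dots> = G k ^ d' * (poly_subst G (F j) * poly_subst G' (F' i))" by (simp add: mult_ac)
    finally show ?thesis using k by simp
  qed
  with t t' show ?thesis by (auto simp: proportional_def)
qed

lemma proportional_outside: "F \<notin> hom_tuples n \<Longrightarrow> cls n F = {}"
  by (auto simp: proportional_def)

lemma rat_comp_classes:
  assumes "F \<in> hom_tuples n" "G \<in> hom_tuples n" "(\<lambda>i. poly_subst G (F i)) \<in> hom_tuples n"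
  shows "rat_comp n (cls n F) (cls n G) = cls n (\<lambda>i. poly_subst G (F i))" (is "?L = ?R")
proof
  show "?R \<subseteq> ?L"
    unfolding rat_comp_def using assms(1,2) by (blast intro: proportional_refl)
  show "?L \<subseteq> ?R"
    unfolding rat_comp_def
  proof (intro UN_least)
    fix F' G' assume "F' \<in> cls n F" "G' \<in> cls n G"
    then have FG: "(F, F') \<in> proportional n" "(G, G') \<in> proportional n" by auto
    show "cls n (\<lambda>i. poly_subst G' (F' i)) \<subseteq> ?R"
    proof (cases "(\<lambda>i. poly_subst G' (F' i)) \<in> hom_tuples n")
      case True
      then show ?thesis
        using subst_proportional[OF FG assms(3)] cls_eq_iff[OF assms(3)] by blast
    qed (simp add: proportional_outside)
  qed
qed

lemma rat_comp_eqE: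
  assumes "F \<in> hom_tuples n" "G \<in> hom_tuples n" "H \<in> hom_tuples n"
    "rat_comp n (cls n F) (cls n G) = cls n H"
  obtains F' G' where "F' \<in> hom_tuples n" "G' \<in> hom_tuples n" "cls n F' = cls n F"
    "cls n G' = cls n G" "((\<lambda>i. poly_subst G' (F' i)), H) \<in> proportional n"
proof -
  have "H \<in> rat_comp n (cls n F) (cls n G)" using assms(3,4) proportional_refl by auto
  then obtain F' G' where *: "(F, F') \<in> proportional n" "(G, G') \<in> proportional n"
    "((\<lambda>i. poly_subst G' (F' i)), H) \<in> proportional n"
    by (auto simp: rat_comp_def)
  then have "F' \<in> hom_tuples n" "G' \<in> hom_tuples n" by (auto simp: proportional_def)
  with * show ?thesis using that cls_eq_iff assms by metis
qed

definition dominant_tuple :: "nat \<Rightarrow> 'k::field tuple \<Rightarrow> bool" where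
  "dominant_tuple n G \<longleftrightarrow> G \<in> hom_tuples n \<and>
     (\<forall>d. \<forall>p\<in>hom_polys n d. poly_subst G p = 0 \<longrightarrow> p = 0)"

lemma proportional_var:
  assumes "(F, var) \<in> proportional n"
  obtains h where "h \<noteq> 0" "\<And>i. i \<le> n \<Longrightarrow> var 0 * F i = h * var i"
proof -
  have "var 0 * F i = F 0 * var i" if "i \<le> n" for i
    using assms that by (auto simp: proportional_def mult.commute)
  moreover have "F 0 \<noteq> 0"
    using calculation assms by (auto simp: proportional_def hom_tuples_def)
  ultimately show ?thesis using that by blast
qed

lemma right_inverse_dominant:
  assumes G: "G \<in> hom_tuples n" and H: "(\<lambda>i. poly_subst H (G i), var) \<in> proportional n"
  shows "dominant_tuple n G"
  unfolding dominant_tuple_def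
proof (intro conjI allI ballI impI)
  fix d p assume p: "p \<in> hom_polys n d" "poly_subst G p = 0"
  obtain h where h: "h \<noteq> 0" "\<And>i. i \<le> n \<Longrightarrow> var 0 * poly_subst H (G i) = h * var i"
    using proportional_var[OF H] by auto
  have "0 = var 0 ^ d * poly_subst H (poly_subst G p)" by (simp add: p)
  also have "\<dots> = poly_subst (\<lambda>i. var 0 * poly_subst H (G i)) p"
    by (simp add: poly_subst_comp poly_subst_scale[OF p(1)])
  also have "\<dots> = poly_subst (\<lambda>i. h * var i) p"
    using h p(1) by (intro poly_subst_cong) (auto dest: hom_polysD)
  also have "\<dots> = h ^ d * p" by (simp add: poly_subst_scale[OF p(1)])
  finally show "p = 0" using h by simp
qed (rule G)

lemma dominant_comp:
  assumes "F \<in> hom_tuples n" "dominant_tuple n G"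
  shows "(\<lambda>i. poly_subst G (F i)) \<in> hom_tuples n"
proof -
  obtain d k where F: "\<And>i. i \<le> n \<Longrightarrow> F i \<in> hom_polys n d" "k \<le> n" "F k \<noteq> 0"
    using assms(1) by (auto simp: hom_tuples_def)
  obtain e where G: "\<And>i. i \<le> n \<Longrightarrow> G i \<in> hom_polys n e"
    using assms(2) by (auto simp: hom_tuples_def dominant_tuple_def)
  have "poly_subst G (F k) \<noteq> 0" using assms(2) F by (auto simp: dominant_tuple_def)
  moreover have "poly_subst G (F i) \<in> hom_polys n (d * e)" if "i \<le> n" for i
    using hom_polys_subst[OF F(1)[OF that] G] .
  ultimately show ?thesis using F(2) by (auto simp: hom_tuples_def)
qed

lemma dominant_comp_dominant:
  assumes "dominant_tuple n F" "dominant_tuple n G"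
  shows "dominant_tuple n (\<lambda>i. poly_subst G (F i))"
  unfolding dominant_tuple_def
proof (intro conjI allI ballI impI)
  show "(\<lambda>i. poly_subst G (F i)) \<in> hom_tuples n"
    using assms dominant_comp by (auto simp: dominant_tuple_def)
  fix d p assume p: "p \<in> hom_polys n d" "poly_subst (\<lambda>i. poly_subst G (F i)) p = 0"
  obtain e where "\<And>i. i \<le> n \<Longrightarrow> F i \<in> hom_polys n e"
    using assms(1) by (auto simp: hom_tuples_def dominant_tuple_def)
  then have "poly_subst F p \<in> hom_polys n (d * e)" using hom_polys_subst p(1) by blast
  moreover have "poly_subst G (poly_subst F p) = 0" using p by (simp add: poly_subst_comp)
  ultimately show "p = 0" using assms p(1) unfolding dominant_tuple_def by blast
qed

lemma dominant_proportional:
  assumes "dominant_tuple n G" "(G, G') \<in> proportional n"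
  shows "dominant_tuple n G'"
  unfolding dominant_tuple_def
proof (intro conjI allI ballI impI)
  show "G' \<in> hom_tuples n" using assms by (auto simp: proportional_def)
  fix d p assume p: "p \<in> hom_polys n d" "poly_subst G' p = 0"
  obtain k where k: "k \<le> n" "G' k \<noteq> 0" using assms by (auto simp: proportional_def hom_tuples_def)
  have "G' k ^ d * poly_subst G p = poly_subst (\<lambda>i. G' k * G i) p"
    by (simp add: poly_subst_scale[OF p(1)])
  also have "\<dots> = poly_subst (\<lambda>i. G k * G' i) p"
    using assms k p(1) by (intro poly_subst_cong) (auto dest: hom_polysD simp: proportional_def mult.commute)
  also have "\<dots> = 0" by (simp add: poly_subst_scale[OF p(1)] p)
  finally have "poly_subst G p = 0" using k by simp
  then show "p = 0" using assms p by (auto simp: dominant_tuple_def)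
qed

lemma Bir_projI:
  assumes "F \<in> hom_tuples n" "G \<in> hom_tuples n"
    "(\<lambda>i. poly_subst G (F i), var) \<in> proportional n"
    "(\<lambda>i. poly_subst F (G i), var) \<in> proportional n"
  shows "cls n F \<in> carrier (Bir_proj n)"
proof -
  have "rat_comp n (cls n F) (cls n G) = rat_id n" "rat_comp n (cls n G) (cls n F) = rat_id n"
    unfolding rat_id_eq using rat_comp_classes[OF assms(1,2)] rat_comp_classes[OF assms(2,1)]
      equiv_class_eq[OF equiv_proportional assms(3)] equiv_class_eq[OF equiv_proportional assms(4)] assms(3,4)
    by (simp_all add: proportional_def)
  then show ?thesis
    using assms cls_rat_map by (auto simp: Bir_proj_def)
qed

lemma Bir_projE:
  assumes "\<phi> \<in> carrier (Bir_proj n)"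
  obtains F G where "dominant_tuple n F" "dominant_tuple n G" "\<phi> = cls n F"
    "rat_comp n \<phi> (cls n G) = rat_id n" "rat_comp n (cls n G) \<phi> = rat_id n"
proof -
  obtain \<psi> where 1: "\<phi> \<in> rat_maps n" "\<psi> \<in> rat_maps n" "rat_comp n \<phi> \<psi> = rat_id n"
     "rat_comp n \<psi> \<phi> = rat_id n" using assms by (auto simp: Bir_proj_def)
  obtain F G where FG: "F \<in> hom_tuples n" "\<phi> = cls n F" "G \<in> hom_tuples n" "\<psi> = cls n G"
    using 1 by (metis rat_mapE)
  have dom: "dominant_tuple n F" if fg: "F \<in> hom_tuples n" "G \<in> hom_tuples n"
      "rat_comp n (cls n F) (cls n G) = rat_id n" for F G :: "'a tuple"
  proof -
    obtain F' G' where *: "F' \<in> hom_tuples n" "cls n F' = cls n F"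
      "((\<lambda>i. poly_subst G' (F' i)), var) \<in> proportional n"
      using rat_comp_eqE[OF fg(1,2) var_tuple fg(3)[unfolded rat_id_eq]] by metis
    then have "dominant_tuple n F'" using right_inverse_dominant by blast
    then show ?thesis using dominant_proportional * fg(1) cls_eq_iff by metis
  qed
  show ?thesis using that[of F G] dom FG 1 by metis
qed

lemma rat_comp_dominant:
  "F \<in> hom_tuples n \<Longrightarrow> dominant_tuple n G \<Longrightarrow>
     rat_comp n (cls n F) (cls n G) = cls n (\<lambda>i. poly_subst G (F i))"
  by (rule rat_comp_classes) (auto simp: dominant_comp dominant_tuple_def)

lemma rat_comp_assoc:
  assumes "F \<in> hom_tuples n" "dominant_tuple n G" "dominant_tuple n H"
  shows "rat_comp n (rat_comp n (cls n F) (cls n G)) (cls n H) =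
         rat_comp n (cls n F) (rat_comp n (cls n G) (cls n H))"
proof -
  have "G \<in> hom_tuples n" using assms by (auto simp: dominant_tuple_def)
  then show ?thesis
    using assms by (simp add: rat_comp_dominant dominant_comp dominant_comp_dominant poly_subst_comp)
qed

lemma dominant_var: "dominant_tuple n var"
  by (auto simp: dominant_tuple_def var_tuple)

lemma rat_id_left: "dominant_tuple n F \<Longrightarrow> rat_comp n (rat_id n) (cls n F) = cls n F"
  by (simp add: rat_id_eq rat_comp_dominant var_tuple)

lemma rat_id_right: "F \<in> hom_tuples n \<Longrightarrow> rat_comp n (cls n F) (rat_id n) = cls n F"
  by (simp add: rat_id_eq rat_comp_dominant dominant_var)

theorem group_Bir_proj: "group (Bir_proj n :: 'k::field rat_map monoid)"
proof (rule groupI)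
  show "\<one>\<^bsub>Bir_proj n\<^esub> \<in> carrier (Bir_proj n :: 'k rat_map monoid)"
    using Bir_projI[of var n var] by (simp add: var_tuple proportional_refl) 
       (simp add: Bir_proj_def rat_id_eq)
next
  fix \<phi> \<psi> :: "'k rat_map" assume "\<phi> \<in> carrier (Bir_proj n)" "\<psi> \<in> carrier (Bir_proj n)"
  then obtain F F' G G' where F: "dominant_tuple n F" "dominant_tuple n F'" "\<phi> = cls n F"
      "rat_comp n \<phi> (cls n F') = rat_id n" "rat_comp n (cls n F') \<phi> = rat_id n"
    and G: "dominant_tuple n G" "dominant_tuple n G'" "\<psi> = cls n G"
      "rat_comp n \<psi> (cls n G') = rat_id n" "rat_comp n (cls n G') \<psi> = rat_id n"
    by (elim Bir_projE) metis
  have hs: "F \<in> hom_tuples n" "F' \<in> hom_tuples n" "G \<in> hom_tuples n" "G' \<in> hom_tuples n"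
    using F G by (auto simp: dominant_tuple_def)
  have a: "rat_comp n \<phi> \<psi> = cls n (\<lambda>i. poly_subst G (F i))"
    using F G hs by (simp add: rat_comp_dominant)
  have b: "rat_comp n (cls n G') (cls n F') = cls n (\<lambda>i. poly_subst F' (G' i))"
    using F G hs by (simp add: rat_comp_dominant)
  have aux: "rat_comp n (rat_comp n (cls n P) (cls n Q)) (rat_comp n (cls n Q') (cls n P')) = rat_id n"
    if pq: "dominant_tuple n P" "dominant_tuple n P'" "dominant_tuple n Q" "dominant_tuple n Q'"
      "rat_comp n (cls n P) (cls n P') = rat_id n" "rat_comp n (cls n Q) (cls n Q') = rat_id n"
    for P P' Q Q' :: "'k tuple"
  proof -
    have h: "P \<in> hom_tuples n" "P' \<in> hom_tuples n" "Q \<in> hom_tuples n" "Q' \<in> hom_tuples n"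
      using pq by (auto simp: dominant_tuple_def)
    obtain R where R: "dominant_tuple n R" "rat_comp n (cls n Q') (cls n P') = cls n R"
      using rat_comp_dominant[OF h(4) pq(2)] dominant_comp_dominant[OF pq(4,2)]
      by (metis (no_types, lifting))
    have "rat_comp n (cls n Q) (cls n R) = cls n P'"
      using rat_comp_assoc[OF h(3) pq(4,2)] pq by (simp add: rat_id_left flip: R(2))
    then show ?thesis using pq h R by (simp add: rat_comp_assoc)
  qed
  have "rat_comp n (rat_comp n \<phi> \<psi>) (rat_comp n (cls n G') (cls n F')) = rat_id n"
       "rat_comp n (rat_comp n (cls n G') (cls n F')) (rat_comp n \<phi> \<psi>) = rat_id n"
    using aux[of F F' G G'] aux[of G' G F' F] F G by auto
  moreover have "rat_comp n \<phi> \<psi> \<in> rat_maps n" "rat_comp n (cls n G') (cls n F') \<in> rat_maps n"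
    unfolding a b using F G hs by (auto intro!: cls_rat_map dominant_comp)
  ultimately show "\<phi> \<otimes>\<^bsub>Bir_proj n\<^esub> \<psi> \<in> carrier (Bir_proj n)"
    by (auto simp: Bir_proj_def)
next
  fix \<phi> \<psi> \<chi> :: "'k rat_map"
  assume "\<phi> \<in> carrier (Bir_proj n)" "\<psi> \<in> carrier (Bir_proj n)" "\<chi> \<in> carrier (Bir_proj n)"
  then show "\<phi> \<otimes>\<^bsub>Bir_proj n\<^esub> \<psi> \<otimes>\<^bsub>Bir_proj n\<^esub> \<chi> = \<phi> \<otimes>\<^bsub>Bir_proj n\<^esub> (\<psi> \<otimes>\<^bsub>Bir_proj n\<^esub> \<chi>)"
    by (elim Bir_projE) (auto simp: Bir_proj_def rat_comp_assoc dominant_tuple_def)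
next
  fix \<phi> :: "'k rat_map" assume *: "\<phi> \<in> carrier (Bir_proj n)"
  show "\<one>\<^bsub>Bir_proj n\<^esub> \<otimes>\<^bsub>Bir_proj n\<^esub> \<phi> = \<phi>"
    using * by (elim Bir_projE) (simp add: Bir_proj_def rat_id_left)
  show "\<exists>\<psi>\<in>carrier (Bir_proj n). \<psi> \<otimes>\<^bsub>Bir_proj n\<^esub> \<phi> = \<one>\<^bsub>Bir_proj n\<^esub>"
    using * by (auto simp: Bir_proj_def)
qed

lemma Aut_proj_subset: "Aut_proj n \<subseteq> carrier (Bir_proj n)"
  by (auto simp: Aut_proj_def proj_morphisms_def Bir_proj_def)

lemma std_involution_Bir: "std_involution n \<in> carrier (Bir_proj n :: 'k::field rat_map monoid)"
proof -
  define F :: "'k tuple" where "F i = (\<Prod>j\<in>{..n} - {i}. var j)" for i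
  define P :: "'k mpoly" where "P = (\<Prod>j\<le>n. var j)"
  have FP: "F i * var i = P" if "i \<le> n" for i
    using that by (simp add: F_def P_def prod.remove[of "{..n}" i] mult.commute)
  have [simp]: "F i \<noteq> 0" for i by (simp add: F_def)
  have [simp]: "P \<noteq> 0" by (simp add: P_def)
  have "F i \<in> hom_polys n n" if "i \<le> n" for i
  proof -
    have "F i \<in> hom_polys n (\<Sum>j\<in>{..n} - {i}. 1)"
      unfolding F_def by (rule hom_polys_prod) (use hom_polys_var in auto)
    then show ?thesis using that by simp
  qed
  then have h: "F \<in> hom_tuples n" unfolding hom_tuples_def by auto
  have "to_fract (F i) = to_fract P * (1 / coord i)" if "i \<le> n" for i
    using FP[OF that] by (simp add: coord_def field_simps flip: to_fract_mult)
  then have e: "std_involution n = cls n F"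
    unfolding std_involution_def using rat_map_of_eq_cls[OF h, where c = "to_fract P"] by simp
  define FF where "FF i = poly_subst F (F i)" for i
  define Q where "Q = (\<Prod>j\<le>n. F j)"
  have [simp]: "Q \<noteq> 0" by (simp add: Q_def)
  have FQ: "FF i * F i = Q" if "i \<le> n" for i
  proof -
    have "FF i = (\<Prod>j\<in>{..n} - {i}. F j)" by (simp add: FF_def F_def[of i] poly_subst_prod)
    then show ?thesis using that by (simp add: Q_def prod.remove[of "{..n}" i] mult.commute)
  qed
  have c: "FF i * var j = FF j * var i" if ij: "i \<le> n" "j \<le> n" for i j
  proof -
    have "P * (FF i * var j) = (FF i * F i) * (var i * var j)"
      using FP[OF ij(1)] by (simp add: mult_ac flip: FP[OF ij(1)])
    also have "\<dots> = (FF j * F j) * (var i * var j)" using FQ ij by simp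
    also have "\<dots> = P * (FF j * var i)"
      by (simp add: mult_ac flip: FP[OF ij(2)])
    finally show ?thesis by simp
  qed
  have "FF 0 \<noteq> 0" using FQ[of 0] by auto
  moreover have "FF i \<in> hom_polys n (n * n)" if "i \<le> n" for i
    unfolding FF_def by (rule hom_polys_subst) (use that \<open>\<And>i. i \<le> n \<Longrightarrow> F i \<in> hom_polys n n\<close> in auto)
  ultimately have "FF \<in> hom_tuples n" unfolding hom_tuples_def by auto
  then have "(FF, var) \<in> proportional n" using c by (simp add: proportional_def var_tuple)
  then show ?thesis unfolding e FF_def[abs_def] by (intro Bir_projI[OF h h])
qed

lemma shear_Bir:
  fixes e :: "nat \<Rightarrow> nat"
  assumes n: "n \<ge> 1" and e: "e 0 = 0" "e 1 = 0" "\<And>i. e i \<le> 2"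
  shows "rat_map_of n (\<lambda>i. coord i * (coord 1 / coord 0) ^ e i)
           \<in> carrier (Bir_proj n :: 'k::field rat_map monoid)"
proof -
  define F :: "'k tuple" where "F i = var i * (var 1 ^ e i * var 0 ^ (2 - e i))" for i
  define G :: "'k tuple" where "G i = var i * (var 0 ^ e i * var 1 ^ (2 - e i))" for i
  have hp: "var i * (var a ^ e i * var b ^ (2 - e i)) \<in> hom_polys n 3"
    if "i \<le> n" "a \<le> n" "b \<le> n" for i a b
  proof -
    have "var i * (var a ^ e i * var b ^ (2 - e i)) \<in> hom_polys n (1 + (e i * 1 + (2 - e i) * 1))"
      by (intro hom_polys_mult hom_polys_power hom_polys_var that)
    moreover have "1 + (e i * 1 + (2 - e i) * 1) = 3" using e(3)[of i] by simp
    ultimately show ?thesis by metis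
  qed
  have hF: "F i \<in> hom_polys n 3" "G i \<in> hom_polys n 3" if "i \<le> n" for i
    unfolding F_def G_def using hp that n by auto
  have [simp]: "F i \<noteq> 0" "G i \<noteq> 0" for i by (auto simp: F_def G_def)
  have "F 0 \<noteq> 0" "G 0 \<noteq> 0" by simp_all
  then have F: "F \<in> hom_tuples n" and G: "G \<in> hom_tuples n"
    unfolding hom_tuples_def using hF by blast+
  have cases: "e i = 0 \<or> e i = 1 \<or> e i = 2" for i using e(3)[of i] by auto
  have v0: "coord 0 \<noteq> (0 :: 'k mpoly fract)" by (simp add: coord_def)
  have "to_fract (F i) = coord 0 ^ 2 * (coord i * (coord 1 / coord 0) ^ e i)" for i
    using cases[of i] v0
    by (auto simp: F_def power2_eq_square field_simps simp flip: coord_def)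
  then have eq: "rat_map_of n (\<lambda>i. coord i * (coord 1 / coord 0) ^ e i) = cls n F"
    using rat_map_of_eq_cls[OF F, where c = "coord 0 ^ 2"] v0 by simp
  have GF: "poly_subst G (F i) = (var 0 ^ 2 * var 1 ^ 6) * var i" for i
    using cases[of i] e
    by (auto simp: F_def G_def poly_subst_mult poly_subst_power power2_eq_square eval_nat_numeral mult_ac)
  have FG: "poly_subst F (G i) = (var 1 ^ 2 * var 0 ^ 6) * var i" for i
    using cases[of i] e
    by (auto simp: F_def G_def poly_subst_mult poly_subst_power power2_eq_square eval_nat_numeral mult_ac)
  have "\<forall>i\<le>n. poly_subst G (F i) \<in> hom_polys n (3 * 3)" "\<forall>i\<le>n. poly_subst F (G i) \<in> hom_polys n (3 * 3)"
    using hom_polys_subst[of _ n 3 G n 3] hom_polys_subst[of _ n 3 F n 3] hF by blast+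
  moreover have "poly_subst G (F 0) \<noteq> 0" "poly_subst F (G 0) \<noteq> 0" by (simp_all add: GF FG)
  ultimately have "(\<lambda>i. poly_subst G (F i)) \<in> hom_tuples n" "(\<lambda>i. poly_subst F (G i)) \<in> hom_tuples n"
    unfolding hom_tuples_def by blast+
  then show ?thesis unfolding eq using F G
    by (intro Bir_projI[OF F G]) (auto simp: proportional_def var_tuple GF FG mult_ac)
qed

lemma mu_nu_xi_Bir:
  assumes "n \<ge> 3"
  shows "mu_map n \<in> carrier (Bir_proj n :: 'k::field rat_map monoid)"
    and "nu_map n \<in> carrier (Bir_proj n :: 'k::field rat_map monoid)"
    and "xi_map n \<in> carrier (Bir_proj n :: 'k::field rat_map monoid)"
proof -
  have "coord(2 := coord 2 * (coord 1 / coord 0) ^ 2) =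
      (\<lambda>i. coord i * (coord 1 / coord 0 :: 'k mpoly fract) ^ (if i = 2 then 2 else 0))"
    "coord(2 := coord 2 * (coord 1 / coord 0), 3 := coord 3 * (coord 1 / coord 0)) =
      (\<lambda>i. coord i * (coord 1 / coord 0 :: 'k mpoly fract) ^ (if i = 2 \<or> i = 3 then 1 else 0))"
    "coord(2 := coord 2 * (coord 1 / coord 0)) =
      (\<lambda>i. coord i * (coord 1 / coord 0 :: 'k mpoly fract) ^ (if i = 2 then 1 else 0))"
    by (simp_all add: fun_eq_iff)
  then show "mu_map n \<in> carrier (Bir_proj n :: 'k rat_map monoid)"
      "nu_map n \<in> carrier (Bir_proj n :: 'k rat_map monoid)"
      "xi_map n \<in> carrier (Bir_proj n :: 'k rat_map monoid)"
    unfolding mu_map_def nu_map_def xi_map_def using assms by (simp_all only:) (rule shear_Bir; simp)+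
qed

end

theory Submission
  imports Defs "Jordan_Normal_Form.Determinant"
begin

text \<open>
  Conjugating linear maps in two coordinates by the standard involution gives the maps
  \<open>x\<^sub>i \<mapsto> x\<^sub>j\<^sup>2 / x\<^sub>i\<close>, hence, with \<open>u = x\<^sub>1 / x\<^sub>0\<close>, the multiplications of one coordinate by squares of
  fractions of linear forms in \<open>x\<^sub>0, x\<^sub>1\<close>; \<open>\<mu>\<close> is one of them. Conjugating transvections \<open>x\<^sub>2 + t x\<^sub>3\<close> by these
  gives all \<open>x\<^sub>2 + f x\<^sub>3\<close> with \<open>f\<close> a sum of squares, in particular \<open>f = u\<close> if \<open>2 \<noteq> 0\<close>, and then
  the usual identities in \<open>SL\<^sub>2\<close> give \<open>\<nu>\<close>. The multiplication of all of \<open>x\<^sub>2, \<dots>, x\<^sub>n\<close> by \<open>u\<close> is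
  \<open>x\<^sub>1 \<mapsto> x\<^sub>0\<^sup>2 / x\<^sub>1\<close> followed by a transposition; for even \<open>n\<close> it becomes \<open>\<xi>\<^sub>n\<close> after dividing out
  pairs of coordinates by \<open>\<nu>\<close>.

  For odd \<open>n\<close> the Jacobian of a birational map is well defined modulo squares, because replacing \<open>F\<close> by \<open>hF\<close>
  multiplies it by \<open>h\<^sup>n\<^sup>+\<^sup>1\<close>, and by the chain rule the maps whose Jacobian is a constant times a square are
  closed under composition. The standard involution and linear maps have this property, \<open>\<xi>\<^sub>n\<close> does not. That
  automorphisms are linear follows from unique factorization: if \<open>F \<circ> G = h x\<close> with coprime \<open>F\<close> and \<open>G\<close>, a
  prime factor \<open>f\<close> of \<open>h\<close> gives a point, the image under \<open>G\<close> of the hypersurface \<open>f = 0\<close>, where \<open>F\<close> is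
  not defined.
\<close>

section \<open>Unique factorization\<close>

abbreviation const :: "'k::field \<Rightarrow> 'k mpoly" where
  "const c \<equiv> Poly_Mapping.single 0 c"

definition vpolys :: "nat set \<Rightarrow> 'k::field mpoly set" where
  "vpolys V = {p. \<forall>m\<in>Poly_Mapping.keys p. Poly_Mapping.keys m \<subseteq> V}"

lemma polys_eq_vpolys: "polys n = vpolys {..n}"
  by (simp add: polys_def vpolys_def)

lemma const_add: "const (a + b) = const a + const b"
  by (simp add: single_add)

lemma const_mult: "const (a * b) = const a * const b"
  by (simp add: mult_single)

lemma const_uminus: "const (- a) = - const a"
  by (simp add: single_uminus)

lemma const_eq_0_iff [simp]: "const a = 0 \<longleftrightarrow> a = 0"
  by (metis lookup_single_eq lookup_zero single_zero)

lemma vpolys_const [simp]: "const c \<in> vpolys V"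
  by (auto simp: vpolys_def)

lemma vpolys_0 [simp]: "0 \<in> vpolys V" and vpolys_1 [simp]: "1 \<in> vpolys V"
  by (auto simp: vpolys_def)

lemma vpolys_var: "i \<in> V \<Longrightarrow> var i \<in> vpolys V"
  by (auto simp: vpolys_def var_def)

lemma vpolys_add: "p \<in> vpolys V \<Longrightarrow> q \<in> vpolys V \<Longrightarrow> p + q \<in> vpolys V"
  unfolding vpolys_def using Poly_Mapping.keys_add[of p q] by blast

lemma vpolys_uminus: "p \<in> vpolys V \<Longrightarrow> - p \<in> vpolys V"
  by (simp add: vpolys_def)

lemma vpolys_diff: "p \<in> vpolys V \<Longrightarrow> q \<in> vpolys V \<Longrightarrow> p - q \<in> vpolys V"
  using vpolys_add[of p V "- q"] by (simp add: vpolys_uminus)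

lemma vpolys_mult:
  assumes "p \<in> vpolys V" "q \<in> vpolys V"
  shows "p * q \<in> vpolys V"
  unfolding vpolys_def
proof (intro CollectI ballI)
  fix m assume "m \<in> Poly_Mapping.keys (p * q)"
  then obtain a b where "m = a + b" "a \<in> Poly_Mapping.keys p" "b \<in> Poly_Mapping.keys q"
    using keys_mult[of p q] by blast
  then show "Poly_Mapping.keys m \<subseteq> V"
    using assms Poly_Mapping.keys_add[of a b] unfolding vpolys_def by blast
qed

lemma vpolys_power: "p \<in> vpolys V \<Longrightarrow> p ^ k \<in> vpolys V"
  by (induction k) (auto intro: vpolys_mult)

lemma vpolys_sum: "(\<And>a. a \<in> A \<Longrightarrow> f a \<in> vpolys V) \<Longrightarrow> sum f A \<in> vpolys V"
  by (induction A rule: infinite_finite_induct) (auto intro: vpolys_add)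

lemma vpolys_mono: "V \<subseteq> W \<Longrightarrow> vpolys V \<subseteq> vpolys W"
  by (auto simp: vpolys_def)

lemma vpolys_finite:
  obtains V where "finite V" "p \<in> vpolys V"
proof
  show "finite (\<Union>m\<in>Poly_Mapping.keys p. Poly_Mapping.keys m)" by simp
  show "p \<in> vpolys (\<Union>m\<in>Poly_Mapping.keys p. Poly_Mapping.keys m)"
    by (auto simp: vpolys_def)
qed

lemma vpolys_induct [consumes 1, case_names const var add mult]:
  assumes p: "p \<in> vpolys V"
    and c: "\<And>c. P (const c)"
    and v: "\<And>i. i \<in> V \<Longrightarrow> P (var i)"
    and a: "\<And>p q. p \<in> vpolys V \<Longrightarrow> q \<in> vpolys V \<Longrightarrow> P p \<Longrightarrow> P q \<Longrightarrow> P (p + q)"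
    and t: "\<And>p q. p \<in> vpolys V \<Longrightarrow> q \<in> vpolys V \<Longrightarrow> P p \<Longrightarrow> P q \<Longrightarrow> P (p * q)"
  shows "P p"
proof -
  define Q where "Q p \<longleftrightarrow> p \<in> vpolys V \<and> P p" for p
  have Qc: "Q (const c)" for c by (simp add: Q_def c)
  have Q0: "Q 0" using Qc[of 0] by simp
  have Q1: "Q 1" using Qc[of 1] by simp
  have Qs: "Q (sum f A)" if "\<And>a. a \<in> A \<Longrightarrow> Q (f a)" for f and A :: "(nat \<Rightarrow>\<^sub>0 nat) set"
    using that by (induction A rule: infinite_finite_induct) (auto simp: Q0, auto simp: Q_def a vpolys_add)
  have Qm: "Q p \<Longrightarrow> Q q \<Longrightarrow> Q (p * q)" for p q by (auto simp: Q_def t vpolys_mult)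
  have Qp: "Q (prod f A)" if "\<And>a. a \<in> A \<Longrightarrow> Q (f a)" for f and A :: "nat set"
    using that by (induction A rule: infinite_finite_induct) (auto simp: Q1 Qm)
  have Qpow: "Q p \<Longrightarrow> Q (p ^ k)" for p k by (induction k) (auto simp: Q1 Qm)
  \<comment> \<open>Rewriting \<open>p\<close> as \<open>poly_subst var p\<close> displays it as
    built from constants and variables in \<open>V\<close>, so the closure properties of
    \<open>Q\<close> suffice.\<close>
  have "Q (poly_subst var p)"
    unfolding poly_subst_def mon_subst_def
  proof (intro Qs Qm Qp Qpow Qc)
    fix m i assume "m \<in> Poly_Mapping.keys p" "i \<in> Poly_Mapping.keys m"
    then have "i \<in> V" using p by (auto simp: vpolys_def)
    then show "Q (var i)" by (simp add: Q_def v vpolys_var)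
  qed
  then show ?thesis by (simp add: Q_def)
qed

lemma mpoly_induct [case_names const var add mult]:
  assumes "\<And>c. P (const c)" "\<And>i. P (var i)"
    "\<And>p q. P p \<Longrightarrow> P q \<Longrightarrow> P (p + q)" "\<And>p q. P p \<Longrightarrow> P q \<Longrightarrow> P (p * q)"
  shows "P p"
proof -
  have "p \<in> vpolys UNIV" by (simp add: vpolys_def)
  then show ?thesis by (induction rule: vpolys_induct) (auto intro: assms)
qed

section \<open>Substitution into one-variable polynomials, the common source of variable separation,
  grading and derivatives\<close>

definition usubst :: "(nat \<Rightarrow> 'k mpoly poly) \<Rightarrow> 'k::field mpoly \<Rightarrow> 'k mpoly poly" where
  "usubst G p = (\<Sum>m\<in>Poly_Mapping.keys p. [:const (Poly_Mapping.lookup p m):] *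
     (\<Prod>i\<in>Poly_Mapping.keys m. G i ^ Poly_Mapping.lookup m i))"

lemma usubst_superset:
  assumes "finite S" "Poly_Mapping.keys p \<subseteq> S"
  shows "usubst G p = (\<Sum>m\<in>S. [:const (Poly_Mapping.lookup p m):] *
     (\<Prod>i\<in>Poly_Mapping.keys m. G i ^ Poly_Mapping.lookup m i))"
  unfolding usubst_def
  by (rule sum.mono_neutral_left) (use assms in \<open>auto simp: in_keys_iff\<close>)

lemma usubst_add: "usubst G (p + q) = usubst G p + usubst G q"
proof -
  let ?S = "Poly_Mapping.keys p \<union> Poly_Mapping.keys q"
  have "Poly_Mapping.keys (p + q) \<subseteq> ?S" by (rule Poly_Mapping.keys_add)
  then show ?thesis
    by (simp add: usubst_superset[of ?S] lookup_add const_add smult_add_left sum.distrib)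
qed

lemma usubst_0 [simp]: "usubst G 0 = 0"
  by (simp add: usubst_def)

lemma usubst_sum: "usubst G (sum f A) = (\<Sum>a\<in>A. usubst G (f a))"
  by (induction A rule: infinite_finite_induct) (auto simp: usubst_add)

lemma usubst_single: "usubst G (Poly_Mapping.single m c) =
    [:const c:] * (\<Prod>i\<in>Poly_Mapping.keys m. G i ^ Poly_Mapping.lookup m i)"
  by (simp add: usubst_superset[of "{m}"])

lemma usubst_const [simp]: "usubst G (const c) = [:const c:]"
  by (simp add: usubst_single)

lemma usubst_1 [simp]: "usubst G 1 = 1"
  using usubst_const[of G 1] by (simp del: usubst_const)

lemma usubst_var [simp]: "usubst G (var i) = G i"
  by (simp add: var_def usubst_single flip: one_pCons)

lemma usubst_mult: "usubst G (p * q) = usubst G p * usubst G q"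
proof -
  let ?g = "\<lambda>m. \<Prod>i\<in>Poly_Mapping.keys m. G i ^ Poly_Mapping.lookup m i"
  have g: "?g m = (\<Prod>i\<in>S. G i ^ Poly_Mapping.lookup m i)" if "finite S" "Poly_Mapping.keys m \<subseteq> S" for m S
    by (rule prod.mono_neutral_left) (use that in \<open>auto simp: in_keys_iff\<close>)
  have gm: "?g (a + b) = ?g a * ?g b" for a b
  proof -
    let ?S = "Poly_Mapping.keys a \<union> Poly_Mapping.keys b"
    have "Poly_Mapping.keys (a + b) \<subseteq> ?S" by (rule Poly_Mapping.keys_add)
    then have "?g (a + b) = (\<Prod>i\<in>?S. G i ^ Poly_Mapping.lookup (a + b) i)" by (intro g) auto
    also have "\<dots> = ?g a * ?g b"
      unfolding lookup_add power_add prod.distrib by (subst (1 2) g[of ?S]) auto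
    finally show ?thesis .
  qed
  have s: "usubst G (Poly_Mapping.single a c * Poly_Mapping.single b d) =
        usubst G (Poly_Mapping.single a c) * usubst G (Poly_Mapping.single b d)" for a b c d
    unfolding mult_single usubst_single gm by (simp add: mult_ac flip: const_mult)
  let ?f = "\<lambda>r m. Poly_Mapping.single m (Poly_Mapping.lookup r m)"
  have "usubst G (p * q) = usubst G ((\<Sum>a\<in>Poly_Mapping.keys p. ?f p a) * (\<Sum>b\<in>Poly_Mapping.keys q. ?f q b))"
    using mpoly_expand[of p] mpoly_expand[of q] by simp
  also have "\<dots> = usubst G (\<Sum>a\<in>Poly_Mapping.keys p. ?f p a) * usubst G (\<Sum>b\<in>Poly_Mapping.keys q. ?f q b)"
    by (simp add: sum_product usubst_sum s)
  finally show ?thesis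
    using mpoly_expand[of p] mpoly_expand[of q] by simp
qed

lemma usubst_uminus: "usubst G (- p) = - usubst G p"
  using usubst_add[of G p "- p"] by (simp add: eq_neg_iff_add_eq_0 add.commute)

lemma usubst_diff: "usubst G (p - q) = usubst G p - usubst G q"
  using usubst_add[of G p "- q"] by (simp add: usubst_uminus)

lemma usubst_power: "usubst G (p ^ k) = usubst G p ^ k"
  by (induction k) (auto simp: usubst_mult)

lemma poly_usubst: "poly (usubst G p) y = poly_subst (\<lambda>i. poly (G i) y) p"
  by (induction p rule: mpoly_induct)
     (auto simp: usubst_add usubst_mult poly_subst_add poly_subst_mult)

definition as_upoly :: "nat \<Rightarrow> 'k::field mpoly \<Rightarrow> 'k mpoly poly" where
  "as_upoly x = usubst (\<lambda>i. if i = x then [:0, 1:] else [:var i:])"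

lemma as_upoly_simps [simp]:
  "as_upoly x (const c) = [:const c:]" "as_upoly x 0 = 0" "as_upoly x 1 = 1"
  "as_upoly x (p + q) = as_upoly x p + as_upoly x q"
  "as_upoly x (p - q) = as_upoly x p - as_upoly x q"
  "as_upoly x (p * q) = as_upoly x p * as_upoly x q"
  "as_upoly x (p ^ k) = as_upoly x p ^ k"
  "as_upoly x (var i) = (if i = x then [:0, 1:] else [:var i:])"
  by (auto simp: as_upoly_def usubst_add usubst_mult usubst_diff usubst_power)

lemma poly_as_upoly [simp]: "poly (as_upoly x p) (var x) = p"
proof -
  have "(\<lambda>i. poly (if i = x then [:0, 1:] else [:var i:]) (var x)) = (var :: nat \<Rightarrow> 'a mpoly)"
    by auto
  then show ?thesis by (simp add: as_upoly_def poly_usubst)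
qed

lemma as_upoly_eq_0_iff [simp]: "as_upoly x p = 0 \<longleftrightarrow> p = 0"
  by (metis as_upoly_simps(2) poly_as_upoly)

lemma as_upoly_free:
  assumes "p \<in> vpolys V" "x \<notin> V"
  shows "as_upoly x p = [:p:]"
  using assms by (induction rule: vpolys_induct) auto

lemma coeff_as_upoly:
  assumes "p \<in> vpolys (insert x V)"
  shows "coeff (as_upoly x p) i \<in> vpolys V"
  using assms
proof (induction arbitrary: i rule: vpolys_induct)
  case (const c)
  then show ?case by (simp add: coeff_pCons split: nat.split)
next
  case (var j)
  then show ?case by (auto simp: coeff_pCons vpolys_var split: nat.split)
next
  case (add p q)
  then show ?case by (simp add: vpolys_add)
next
  case (mult p q)
  then show ?case by (auto simp: coeff_mult intro!: vpolys_sum vpolys_mult)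
qed

lemma degree_as_upoly_eq_0_iff: "degree (as_upoly x p) = 0 \<longleftrightarrow> p \<in> vpolys (- {x})"
proof
  assume "degree (as_upoly x p) = 0"
  then obtain c where c: "as_upoly x p = [:c:]" by (rule degree_eq_zeroE)
  moreover have "p \<in> vpolys (insert x (- {x}))" by (simp add: vpolys_def) auto
  ultimately have "c \<in> vpolys (- {x})" using coeff_as_upoly[of p x "- {x}" 0] by simp
  moreover have "p = c" using poly_as_upoly[of x p] by (simp add: c)
  ultimately show "p \<in> vpolys (- {x})" by simp
qed (simp add: as_upoly_free)

text \<open>Degrees in one variable add, so a factor of a nonzero \<open>p\<close> has degree zero
  in every variable outside \<open>V\<close>.\<close>

lemma vpolys_dvd:
  assumes "q dvd p" "p \<in> vpolys V" "p \<noteq> 0"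
  shows "q \<in> vpolys V"
proof -
  obtain r where r: "p = q * r" using assms by blast
  have "q \<in> vpolys (- {x})" if "x \<notin> V" for x
  proof -
    have "degree (as_upoly x p) = 0" using as_upoly_free[OF assms(2) that] by simp
    moreover have "degree (as_upoly x p) = degree (as_upoly x q) + degree (as_upoly x r)"
      using assms(3) by (simp add: r degree_mult_eq)
    ultimately show ?thesis using degree_as_upoly_eq_0_iff by fastforce
  qed
  then show ?thesis unfolding vpolys_def by blast
qed

section \<open>Grading by total degree: after replacing x_i by T x_i, the power T^d marks the part
  of degree d\<close>

definition grade :: "'k::field mpoly \<Rightarrow> 'k mpoly poly" where
  "grade = usubst (\<lambda>i. [:0, var i:])"

lemma grade_simps [simp]:
  "grade (const c) = [:const c:]" "grade 0 = 0" "grade 1 = 1"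
  "grade (p + q) = grade p + grade q" "grade (p * q) = grade p * grade q"
  "grade (var i) = [:0, var i:]"
  by (auto simp: grade_def usubst_add usubst_mult)

lemma poly_grade_1 [simp]: "poly (grade p) 1 = p"
  by (simp add: grade_def poly_usubst)

lemma grade_eq_0_iff [simp]: "grade p = 0 \<longleftrightarrow> p = 0"
  by (metis grade_simps(2) poly_grade_1 poly_0)

lemma grade_sum: "grade (sum f A) = (\<Sum>a\<in>A. grade (f a))"
  by (induction A rule: infinite_finite_induct) auto

lemma grade_single: "grade (Poly_Mapping.single m c) = monom (Poly_Mapping.single m c) (mdeg m)"
proof -
  have "grade (Poly_Mapping.single m 1) = monom (Poly_Mapping.single m (1::'a)) (mdeg m)"
  proof -
    have "grade (Poly_Mapping.single m (1::'a)) = (\<Prod>i\<in>Poly_Mapping.keys m. [:0, var i:] ^ Poly_Mapping.lookup m i)"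
      by (simp add: grade_def usubst_single flip: one_pCons)
    also have "\<dots> = (\<Prod>i\<in>Poly_Mapping.keys m. monom (var i ^ Poly_Mapping.lookup m i) (Poly_Mapping.lookup m i))"
      by (simp add: monom_power flip: monom_Suc monom_0)
    also have "\<dots> = monom (\<Prod>i\<in>Poly_Mapping.keys m. var i ^ Poly_Mapping.lookup m i) (mdeg m)"
    proof -
      have "(\<Prod>i\<in>A. monom (f i) (g i)) = monom (prod f A) (sum g A)" 
        if "finite A" for A and f :: "nat \<Rightarrow> 'a mpoly" and g
        using that by induction (auto simp: mult_monom)
      then show ?thesis by (simp add: mdeg_def)
    qed
    also have "(\<Prod>i\<in>Poly_Mapping.keys m. var i ^ Poly_Mapping.lookup m i) = Poly_Mapping.single m (1::'a)"
      using mon_subst_var[of m] by (simp add: mon_subst_def)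
    finally show ?thesis .
  qed
  moreover have "Poly_Mapping.single m c = const c * Poly_Mapping.single m 1" by (simp add: mult_single)
  ultimately show ?thesis by (simp only: grade_simps) (simp add: smult_monom mult_single)
qed

lemma coeff_grade: "coeff (grade p) d =
    (\<Sum>m\<in>Poly_Mapping.keys p. if mdeg m = d then Poly_Mapping.single m (Poly_Mapping.lookup p m) else 0)"
proof -
  have "grade p = (\<Sum>m\<in>Poly_Mapping.keys p. grade (Poly_Mapping.single m (Poly_Mapping.lookup p m)))"
    using mpoly_expand[of p] by (metis grade_sum)
  then show ?thesis by (simp add: coeff_sum grade_single)
qed

lemma coeff_grade_hom:
  assumes "p \<in> polys n"
  shows "coeff (grade p) d \<in> hom_polys n d"
  unfolding coeff_grade
  by (rule hom_polys_sum) (use assms in \<open>auto simp: hom_polys_def polys_def\<close>)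

lemma grade_hom:
  assumes "p \<in> hom_polys n d"
  shows "grade p = monom p d"
proof (rule poly_eqI)
  fix e
  have "coeff (grade p) e = (\<Sum>m\<in>Poly_Mapping.keys p. if d = e then Poly_Mapping.single m (Poly_Mapping.lookup p m) else 0)"
    unfolding coeff_grade by (rule sum.cong) (use assms in \<open>auto simp: hom_polys_def\<close>)
  then show "coeff (grade p) e = coeff (monom p d) e"
    using mpoly_expand[of p] by simp
qed

lemma hom_polys_iff_grade: "p \<in> polys n \<Longrightarrow> p \<in> hom_polys n d \<longleftrightarrow> grade p = monom p d"
  using coeff_grade_hom[of p n d] grade_hom by fastforce

definition tdeg :: "'k::field mpoly \<Rightarrow> nat" where
  "tdeg p = degree (grade p)"

lemma tdeg_mult: "p \<noteq> 0 \<Longrightarrow> q \<noteq> 0 \<Longrightarrow> tdeg (p * q) = tdeg p + tdeg q"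
  by (simp add: tdeg_def degree_mult_eq)

lemma tdeg_const [simp]: "tdeg (const c) = 0" and tdeg_var [simp]: "tdeg (var i) = 1"
  by (simp_all add: tdeg_def)

lemma tdeg_hom: "p \<in> hom_polys n d \<Longrightarrow> p \<noteq> 0 \<Longrightarrow> tdeg p = d"
  by (simp add: tdeg_def grade_hom degree_monom_eq)

text \<open>If \<open>grade p\<close> is constant in T, then its values at T = 1 and T = 0 agree;
  the first is \<open>p\<close>, the second is the constant term of \<open>p\<close>.\<close>

lemma tdeg_eq_0:
  assumes "tdeg p = 0"
  obtains c where "p = const c"
proof -
  obtain q where q: "grade p = [:q:]" using assms degree_eq_zeroE unfolding tdeg_def by metis
  have z: "\<exists>c. poly_subst (\<lambda>i. 0) r = const c" for r :: "'a mpoly"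
  proof (induction r rule: mpoly_induct)
    case (var i) show ?case by (rule exI[of _ 0]) simp
  qed (auto simp: poly_subst_add poly_subst_mult simp flip: const_add const_mult)
  have "p = q" using poly_grade_1[of p] q by simp
  moreover have "q = poly_subst (\<lambda>i. 0) p" using poly_usubst[of "\<lambda>i. [:0, var i:]" p 0] q by (simp add: grade_def)
  ultimately show ?thesis using z[of p] that by metis
qed

section \<open>Units, irreducible divisors and primality\<close>

lemma unit_mpoly_iff: "(p :: 'k::field mpoly) dvd 1 \<longleftrightarrow> p \<noteq> 0 \<and> tdeg p = 0"
proof
  assume u: "p dvd 1"
  then obtain q where "1 = p * q" by blast
  moreover have "tdeg (1 :: 'k mpoly) = 0" by (simp add: tdeg_def)
  ultimately show "p \<noteq> 0 \<and> tdeg p = 0" by (metis tdeg_mult add_is_0 mult_not_zero one_neq_zero)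
next
  assume "p \<noteq> 0 \<and> tdeg p = 0"
  then obtain c where c: "p = const c" "c \<noteq> 0" by (metis tdeg_eq_0 const_eq_0_iff)
  then have "p * const (1 / c) = 1" by (simp flip: const_mult)
  then show "p dvd 1" by (metis dvd_triv_left)
qed

lemma irreducible_divisor:
  fixes p :: "'k::field mpoly"
  assumes "p \<noteq> 0" "tdeg p > 0"
  obtains q where "irreducible q" "q dvd p"
proof -
  have "\<exists>q. irreducible q \<and> q dvd p" using assms
  proof (induction "tdeg p" arbitrary: p rule: less_induct)
    case less
    have nu: "\<not> p dvd 1" using less.prems by (simp add: unit_mpoly_iff)
    show ?case
    proof (cases "irreducible p")
      case False
      then obtain a b where ab: "p = a * b" "\<not> a dvd 1" "\<not> b dvd 1"
        using nu less.prems by (auto simp: irreducible_def)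
      then have "a \<noteq> 0" "b \<noteq> 0" using less.prems by auto
      then have "tdeg a > 0" "tdeg b > 0" using ab by (auto simp: unit_mpoly_iff)
      then have "tdeg a < tdeg p" using ab tdeg_mult[of a b] \<open>a \<noteq> 0\<close> \<open>b \<noteq> 0\<close> by simp
      then obtain q where "irreducible q" "q dvd a" using less.hyps \<open>a \<noteq> 0\<close> \<open>tdeg a > 0\<close> by blast
      then show ?thesis using ab by (auto intro: dvd_mult2)
    qed (use dvd_refl in blast)
  qed
  then show ?thesis using that by blast
qed

text \<open>Gauss's argument for a prime \<open>p\<close> free of x: if \<open>i\<close> and
  \<open>j\<close> are the first indices at which the coefficients of \<open>u\<close> and
  \<open>v\<close> are not divisible by \<open>p\<close>, then the coefficient of
  \<open>u * v\<close> at \<open>i + j\<close> is, modulo \<open>p\<close>, the product of these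
  two.\<close>

lemma prime_lift:
  assumes prime: "\<And>u v. u \<in> vpolys V \<Longrightarrow> v \<in> vpolys V \<Longrightarrow> p dvd u * v \<Longrightarrow> p dvd u \<or> p dvd v"
    and p: "p \<in> vpolys V" "x \<notin> V"
    and uv: "u \<in> vpolys (insert x V)" "v \<in> vpolys (insert x V)" "p dvd u * v"
  shows "p dvd u \<or> p dvd v"
proof (rule ccontr)
  assume neg: "\<not> (p dvd u \<or> p dvd v)"
  have ex: "\<exists>i. \<not> p dvd coeff (as_upoly x w) i" if "\<not> p dvd w" for w
  proof (rule ccontr)
    assume "\<nexists>i. \<not> p dvd coeff (as_upoly x w) i"
    then have "p dvd poly (as_upoly x w) (var x)"
      unfolding poly_altdef by (intro dvd_sum) auto
    with that show False by simp
  qed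
  define i where "i = (LEAST i. \<not> p dvd coeff (as_upoly x u) i)"
  define j where "j = (LEAST j. \<not> p dvd coeff (as_upoly x v) j)"
  have i: "\<not> p dvd coeff (as_upoly x u) i" "\<And>k. k < i \<Longrightarrow> p dvd coeff (as_upoly x u) k"
    using LeastI_ex[OF ex] not_less_Least neg unfolding i_def by auto
  have j: "\<not> p dvd coeff (as_upoly x v) j" "\<And>k. k < j \<Longrightarrow> p dvd coeff (as_upoly x v) k"
    using LeastI_ex[OF ex] not_less_Least neg unfolding j_def by auto
  obtain z where "u * v = p * z" using uv(3) by blast
  then have "as_upoly x u * as_upoly x v = [:p:] * as_upoly x z"
    using as_upoly_free[OF p] by (metis as_upoly_simps(6))
  then have "coeff (as_upoly x u * as_upoly x v) (i + j) = p * coeff (as_upoly x z) (i + j)"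
    by simp
  then have "p dvd (\<Sum>k\<le>i + j. coeff (as_upoly x u) k * coeff (as_upoly x v) (i + j - k))"
    by (simp add: coeff_mult)
  also have "(\<Sum>k\<le>i + j. coeff (as_upoly x u) k * coeff (as_upoly x v) (i + j - k)) =
      coeff (as_upoly x u) i * coeff (as_upoly x v) j +
      (\<Sum>k\<in>{..i + j} - {i}. coeff (as_upoly x u) k * coeff (as_upoly x v) (i + j - k))"
    by (subst sum.remove[of _ i]) auto
  finally have "p dvd coeff (as_upoly x u) i * coeff (as_upoly x v) j +
      (\<Sum>k\<in>{..i + j} - {i}. coeff (as_upoly x u) k * coeff (as_upoly x v) (i + j - k))" .
  moreover have "p dvd (\<Sum>k\<in>{..i + j} - {i}. coeff (as_upoly x u) k * coeff (as_upoly x v) (i + j - k))"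
  proof (rule dvd_sum)
    fix k assume "k \<in> {..i + j} - {i}"
    then have "k < i \<or> i + j - k < j" by auto
    then show "p dvd coeff (as_upoly x u) k * coeff (as_upoly x v) (i + j - k)"
      using i(2) j(2) by auto
  qed
  ultimately have "p dvd coeff (as_upoly x u) i * coeff (as_upoly x v) j"
    using dvd_add_left_iff by blast
  then show False
    using prime coeff_as_upoly[OF uv(1)] coeff_as_upoly[OF uv(2)] i j by blast
qed

lemma dvd_unit_mult:
  fixes p :: "'k::field mpoly"
  assumes "irreducible p" "p dvd a * u" "a dvd 1"
  shows "p dvd u"
proof -
  obtain b where "a * b = 1" using assms(3) by (metis dvdE)
  then have "u = b * (a * u)" by (metis mult.assoc mult.commute mult_1)
  then show ?thesis using assms(2) by (metis dvd_mult)
qed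

text \<open>In \<open>a * u = p * h\<close>, an irreducible factor \<open>q\<close> of
  \<open>a\<close> divides \<open>p\<close> or \<open>h\<close>. The first would make
  \<open>p\<close> a unit multiple of \<open>q\<close>, hence free of x; so \<open>q\<close> divides
  \<open>h\<close> and can be cancelled, which lowers \<open>tdeg a\<close>.\<close>

lemma irreducible_dvd_cancel:
  fixes p u :: "'k::field mpoly"
  assumes prime: "\<And>q u v :: 'k mpoly. irreducible q \<Longrightarrow> q \<in> vpolys V \<Longrightarrow> u \<in> vpolys (insert x V) \<Longrightarrow>
      v \<in> vpolys (insert x V) \<Longrightarrow> q dvd u * v \<Longrightarrow> q dvd u \<or> q dvd v"
    and x: "x \<notin> V"
    and p: "irreducible p" "p \<in> vpolys (insert x V)" "degree (as_upoly x p) > 0"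
    and a: "a \<in> vpolys V" "a \<noteq> 0" and u: "u \<in> vpolys (insert x V)" "p dvd a * u"
  shows "p dvd u"
  using a u
proof (induction "tdeg a" arbitrary: a rule: less_induct)
  case less
  show ?case
  proof (cases "u = 0 \<or> a dvd 1")
    case True
    then show ?thesis using dvd_unit_mult p(1) less.prems by auto
  next
    case False
    then have "tdeg a > 0" using less.prems by (auto simp: unit_mpoly_iff)
    then obtain q b where q: "irreducible q" "a = q * b"
      using irreducible_divisor less.prems by (metis dvdE)
    then have nz: "q \<noteq> 0" "b \<noteq> 0" using less.prems by auto
    have qb: "q \<in> vpolys V" "b \<in> vpolys V"
      using vpolys_dvd[of _ a V] less.prems q by auto
    obtain h where h: "a * u = p * h" using less.prems by blast
    have auB: "a * u \<in> vpolys (insert x V)"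
      using less.prems vpolys_mono[of V "insert x V"] by (auto intro: vpolys_mult)
    have "h \<in> vpolys (insert x V)"
      using vpolys_dvd[OF _ auB, of h] False less.prems(2) by (simp add: h) (metis h mult_eq_0_iff)
    moreover have "q dvd p * h" using h q by (metis dvd_mult2 dvd_triv_left)
    ultimately consider "q dvd p" | "q dvd h" using prime[OF q(1) qb(1) p(2)] by blast
    then show ?thesis
    proof cases
      case 1
      then obtain z where z: "p = q * z" by blast
      moreover have "\<not> q dvd 1" using q by (auto simp: irreducible_def)
      ultimately have "z dvd 1" using p(1) by (auto simp: irreducible_def)
      then have "z \<in> vpolys V" using vpolys_dvd[of z 1 V] by simp
      then have "p \<in> vpolys V" using z qb by (simp add: vpolys_mult)
      then show ?thesis using as_upoly_free[OF _ x] p(3) by force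
    next
      case 2
      then obtain k where "h = q * k" by blast
      then have "b * u = p * k" using h q nz by (simp add: mult_ac)
      moreover have "tdeg b < tdeg a"
        using tdeg_mult[OF nz] q nz by (auto simp: unit_mpoly_iff irreducible_def)
      ultimately show ?thesis using less.hyps[of b] qb nz less.prems by auto
    qed
  qed
qed

text \<open>Zermelo's argument: pseudo-division lowers the degrees of \<open>u\<close> and \<open>v\<close> in \<open>p dvd u * v\<close> until
  the cofactor of \<open>p\<close> has smaller degree than \<open>p\<close>, and its irreducible factors can then be cancelled.\<close>

lemma prime_insert:
  fixes p u :: "'k::field mpoly"
  assumes prime: "\<And>q u v :: 'k mpoly. irreducible q \<Longrightarrow> q \<in> vpolys V \<Longrightarrow> u \<in> vpolys (insert x V) \<Longrightarrow>
      v \<in> vpolys (insert x V) \<Longrightarrow> q dvd u * v \<Longrightarrow> q dvd u \<or> q dvd v"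
    and x: "x \<notin> V"
    and p: "irreducible p" "p \<in> vpolys (insert x V)"
    and uv: "u \<in> vpolys (insert x V)" "v \<in> vpolys (insert x V)" "p dvd u * v"
  shows "p dvd u \<or> p dvd v"
  using p uv
proof (induction "degree (as_upoly x p)" arbitrary: p u v rule: less_induct)
  case (less p u v)
  let ?B = "vpolys (insert x V)" and ?d = "\<lambda>p. degree (as_upoly x p)"
  note IH = less.hyps
  have p: "irreducible p" "p \<in> ?B" "p \<noteq> 0" using less.prems by auto
  have small: "p dvd u \<or> p dvd v"
    if "u \<in> ?B" "v \<in> ?B" "p * w = u * v" "?d u < ?d p" "?d v < ?d p" for u v w
    using that
  proof (induction "tdeg w" arbitrary: u v w rule: less_induct)
    case (less w)
    show ?case
    proof (cases "u = 0 \<or> v = 0")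
      case False
      then have nz: "u \<noteq> 0" "v \<noteq> 0" "w \<noteq> 0" using less.prems by auto
      show ?thesis
      proof (cases "w dvd 1")
        case True
        then obtain w' where w': "w * w' = 1" by (metis dvdE)
        then have "p = u * (v * w')" using less.prems(3)
          by (metis mult.assoc mult.right_neutral)
        then consider "u dvd 1" | "v * w' dvd 1" using p by (metis irreducible_def)
        then show ?thesis
        proof cases
          case 1
          then show ?thesis using dvd_unit_mult[OF p(1), of u v] less.prems(3) by (metis dvd_triv_left)
        next
          case 2
          then have "v dvd 1" by (meson dvd_trans dvd_triv_left)
          then show ?thesis using dvd_unit_mult[OF p(1), of v u] less.prems(3) by (metis dvd_triv_left mult.commute)
        qed
      next
        case False
        then obtain q w' where q: "irreducible q" "w = q * w'"
          using irreducible_divisor[of w] nz unfolding unit_mpoly_iff by (metis dvdE gr0I)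
        then have nz': "q \<noteq> 0" "w' \<noteq> 0" using nz by auto
        \<comment> \<open>Since \<open>u\<close> and \<open>v\<close> have smaller degree in x than
          \<open>p\<close>, so does the cofactor \<open>w\<close>, and with it each factor
          \<open>q\<close> of \<open>w\<close>. The outer induction hypothesis therefore makes
          \<open>q\<close> prime.\<close>
        have "?d p + ?d w = ?d u + ?d v"
          using nz p by (simp flip: as_upoly_simps degree_mult_eq add: less.prems(3))
        then have "?d w < ?d p" using less.prems by simp
        moreover have "?d w = ?d q + ?d w'" using nz' q by (simp add: degree_mult_eq)
        ultimately have dq: "?d q < ?d p" by simp
        have "u * v \<in> ?B" using less.prems by (auto intro: vpolys_mult)
        moreover have quv: "q dvd u * v" using less.prems(3) q by (metis dvd_mult dvd_triv_left)
        ultimately have "q \<in> ?B" using vpolys_dvd[of q "u * v"] nz by auto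
        then consider "q dvd u" | "q dvd v" using IH[OF dq q(1) _ less.prems(1,2) quv] by blast
        moreover have tw: "tdeg w' < tdeg w"
          using tdeg_mult[OF nz'] q nz' by (auto simp: unit_mpoly_iff irreducible_def)
        ultimately show ?thesis
        proof cases
          case 1
          then obtain u' where u': "u = q * u'" by blast
          have "p * w' = u' * v" using less.prems(3) q u' nz'
            by (simp add: mult_ac)
          moreover have "?d u' < ?d p" using less.prems(4) u' nz by (simp add: degree_mult_eq)
          moreover have "u' \<in> ?B" using vpolys_dvd[of u' u] u' less.prems nz by auto
          ultimately have "p dvd u' \<or> p dvd v" using less.hyps[OF tw] less.prems by blast
          then show ?thesis using u' by auto
        next
          case 2
          then obtain v' where v': "v = q * v'" by blast
          have "p * w' = u * v'" using less.prems(3) q v' nz'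
            by (simp add: mult_ac)
          moreover have "?d v' < ?d p" using less.prems(5) v' nz by (simp add: degree_mult_eq)
          moreover have "v' \<in> ?B" using vpolys_dvd[of v' v] v' less.prems nz by auto
          ultimately have "p dvd u \<or> p dvd v'" using less.hyps[OF tw] less.prems by blast
          then show ?thesis using v' by auto
        qed
      qed
    qed auto
  qed
  show ?case
  proof (cases "?d p = 0")
    case True
    then have "p \<in> vpolys (- {x})" by (simp add: degree_as_upoly_eq_0_iff)
    then have "p \<in> vpolys V" using p(2) unfolding vpolys_def by blast
    then show ?thesis using prime less.prems by blast
  next
    case False
    \<comment> \<open>Pseudo-division: multiplying \<open>u\<close> by the leading coefficient
      \<open>a\<close> of \<open>p\<close> lets the leading terms cancel without division, at the
      price of a factor \<open>a\<close> free of x.\<close>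
    have reduce: "\<exists>u'\<in>?B. \<exists>a\<in>vpolys V. \<exists>c. a \<noteq> 0 \<and> u' = a * u - c * p \<and> (?d u' < ?d u)"
      if u: "u \<in> ?B" "?d p \<le> ?d u" for u
    proof -
      define a where "a = lead_coeff (as_upoly x p)"
      define b where "b = lead_coeff (as_upoly x u)"
      define k where "k = ?d u - ?d p"
      have ab: "a \<in> vpolys V" "b \<in> vpolys V" using coeff_as_upoly p(2) u(1) by (auto simp: a_def b_def)
      have nz: "a \<noteq> 0" using p by (simp add: a_def)
      have u0: "?d u > 0" using u False by simp
      then have "b \<noteq> 0" by (auto simp: b_def)
      define u' where "u' = a * u - (b * var x ^ k) * p"
      have e: "as_upoly x u' = [:a:] * as_upoly x u - ([:b:] * monom 1 k) * as_upoly x p"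
        using as_upoly_free[OF ab(1) x] as_upoly_free[OF ab(2) x]
        by (simp add: u'_def monom_altdef)
      have e': "as_upoly x u' = Polynomial.smult a (as_upoly x u) - monom b k * as_upoly x p"
        unfolding e by (simp add: smult_monom)
      have "?d u' < ?d u"
      proof (rule degree_lessI)
        show "as_upoly x u' \<noteq> 0 \<or> 0 < ?d u" using u0 by simp
        show "\<forall>i\<ge>?d u. coeff (as_upoly x u') i = 0"
        proof (intro allI impI)
          fix i assume i: "?d u \<le> i"
          show "coeff (as_upoly x u') i = 0"
          proof (cases "i = ?d u")
            case True
            have "?d u - k = ?d p" "k \<le> ?d u" using u by (auto simp: k_def)
            then show ?thesis using True
              by (simp add: e' coeff_monom_mult a_def b_def)
          next
            case False
            then have "i > ?d u" "i - k > ?d p" using i u by (auto simp: k_def)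
            then show ?thesis by (simp add: e' coeff_monom_mult coeff_eq_0)
          qed
        qed
      qed
      moreover have "u' \<in> ?B"
        unfolding u'_def using ab u p vpolys_mono[of V "insert x V"]
        by (intro vpolys_diff vpolys_mult vpolys_power vpolys_var) auto
      ultimately show ?thesis using ab nz u'_def by blast
    qed
    \<comment> \<open>This removes the factors \<open>a\<close> that pseudo-division
      introduces.\<close>
    have cancel: "p dvd w" if "a \<in> vpolys V" "a \<noteq> 0" "w \<in> ?B" "p dvd a * w" for a w
      using irreducible_dvd_cancel[OF prime x p(1,2) _ that(1,2,3,4)] False by blast
    from less.prems(3-5) show ?thesis
    proof (induction "?d u + ?d v" arbitrary: u v rule: less_induct)
      case (less u v)
      consider "?d p \<le> ?d u" | "?d p \<le> ?d v" | "?d u < ?d p" "?d v < ?d p" by linarith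
      then show ?case
      proof cases
        case 1
        then obtain u' a c where u': "u' \<in> ?B" "a \<in> vpolys V" "a \<noteq> 0" "u' = a * u - c * p" "?d u' < ?d u"
          using reduce less.prems(1) by blast
        have "u' * v = a * (u * v) - p * (c * v)" by (simp add: u'(4) algebra_simps)
        then have "p dvd u' * v" using less.prems(3) by (metis dvd_diff dvd_mult dvd_triv_left)
        then have "p dvd u' \<or> p dvd v" using less.hyps[of u' v] u' less.prems by simp
        moreover have "p dvd a * u" if "p dvd u'"
        proof -
          have "a * u = u' + c * p" by (simp add: u'(4))
          then show ?thesis using that by (metis dvd_add dvd_triv_right)
        qed
        ultimately show ?thesis using cancel u' less.prems by blast
      next
        case 2
        then obtain v' a c where v': "v' \<in> ?B" "a \<in> vpolys V" "a \<noteq> 0" "v' = a * v - c * p" "?d v' < ?d v"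
          using reduce less.prems(2) by blast
        have "u * v' = a * (u * v) - p * (c * u)" by (simp add: v'(4) algebra_simps)
        then have "p dvd u * v'" using less.prems(3) by (metis dvd_diff dvd_mult dvd_triv_left)
        then have "p dvd u \<or> p dvd v'" using less.hyps[of u v'] v' less.prems by simp
        moreover have "p dvd a * v" if "p dvd v'"
        proof -
          have "a * v = v' + c * p" by (simp add: v'(4))
          then show ?thesis using that by (metis dvd_add dvd_triv_right)
        qed
        ultimately show ?thesis using cancel v' less.prems by blast
      next
        case 3
        then show ?thesis using small less.prems by (metis dvdE)
      qed
    qed
  qed
qed

theorem irreducible_imp_prime_mpoly:
  fixes p :: "'k::field mpoly"
  assumes "irreducible p"
  shows "prime_elem p"
proof (rule prime_elemI)
  fix u v assume d: "p dvd u * v"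
  \<comment> \<open>The induction over the set of variables treats all irreducible \<open>q\<close>
    at once: the step to \<open>insert x V\<close> uses the primality of every irreducible in
    \<open>vpolys V\<close>, lifted by \<open>prime_lift\<close>.\<close>
  have main: "irreducible q \<Longrightarrow> q \<in> vpolys V \<Longrightarrow> u \<in> vpolys V \<Longrightarrow> v \<in> vpolys V \<Longrightarrow> q dvd u * v \<Longrightarrow> q dvd u \<or> q dvd v"
    if "finite V" for V and q u v :: "'k mpoly"
    using that
  proof (induction V arbitrary: q u v rule: finite_induct)
    case empty
    have "vpolys {} \<subseteq> (range const :: 'k mpoly set)"
    proof
      fix r :: "'k mpoly" assume "r \<in> vpolys {}"
      then show "r \<in> range const"
        by (induction rule: vpolys_induct) (auto simp flip: const_add const_mult)
    qed
    then obtain c where "q = const c" using empty by blast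
    then have "q dvd 1" if "q \<noteq> 0" using that by (simp add: unit_mpoly_iff)
    then show ?case using empty by (auto simp: irreducible_def)
  next
    case (insert x V)
    show ?case
    proof (rule prime_insert[OF _ insert.hyps(2) insert.prems])
      fix q u v :: "'k mpoly"
      assume "irreducible q" "q \<in> vpolys V" "u \<in> vpolys (insert x V)" "v \<in> vpolys (insert x V)" "q dvd u * v"
      then show "q dvd u \<or> q dvd v"
        using prime_lift[of V q x u v] insert.IH insert.hyps by blast
    qed
  qed
  obtain V1 V2 V3 where "finite V1" "p \<in> vpolys V1" "finite V2" "u \<in> vpolys V2" "finite V3" "v \<in> vpolys V3"
    using vpolys_finite by metis
  then have "finite (V1 \<union> V2 \<union> V3)" "p \<in> vpolys (V1 \<union> V2 \<union> V3)" "u \<in> vpolys (V1 \<union> V2 \<union> V3)"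
      "v \<in> vpolys (V1 \<union> V2 \<union> V3)"
    unfolding vpolys_def by blast+
  from main[OF this(1) assms this(2-4) d] show "p dvd u \<or> p dvd v" .
qed (use assms in \<open>auto simp: irreducible_def\<close>)

section \<open>Automorphisms are linear\<close>

lemma hom_polys_factor:
  assumes pq: "p * q \<in> hom_polys n d" "p * q \<noteq> 0"
  shows "p \<in> hom_polys n (tdeg p)"
proof -
  let ?m = "Polynomial.order 0 (grade p)" 
  have nz: "p \<noteq> 0" "q \<noteq> 0" using pq by auto
  have g: "grade p * grade q = monom (p * q) d" using grade_hom[OF pq(1)] by simp
  \<comment> \<open>The order at 0 is the lowest degree that occurs, \<open>degree\<close> the
    highest. Both add up to \<open>d\<close> over the two factors, so they coincide for each
    factor.\<close>
  have "degree (grade p) + degree (grade q) = d"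
    using nz pq by (simp add: degree_monom_eq g flip: degree_mult_eq)
  moreover have "Polynomial.order 0 (grade p) + Polynomial.order 0 (grade q) = d"
    using nz pq by (simp add: g order_0_monom flip: order_mult)
  moreover have "Polynomial.order 0 (grade p) \<le> degree (grade p)" "Polynomial.order 0 (grade q) \<le> degree (grade q)"
    using nz by (simp_all add: order_degree)
  ultimately have m: "?m = degree (grade p)" by linarith
  obtain r where r: "grade p = [:0, 1:] ^ ?m * r" using order_1[of 0 "grade p"] by (auto elim: dvdE)
  then have "r \<noteq> 0" using nz by auto
  then have "degree (grade p) = ?m + degree r"
    by (subst r) (simp add: degree_mult_eq degree_power_eq)
  then obtain c where "r = [:c:]" using m degree_eq_zeroE by auto
  then have "grade p = monom c (tdeg p)"
    using r m by (simp add: tdeg_def monom_altdef)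
  moreover from this have "c = p" by (metis poly_grade_1 poly_monom mult.right_neutral power_one)
  moreover have "p \<in> polys n" using vpolys_dvd[of p "p * q"] pq by (auto simp: polys_eq_vpolys dest: hom_polysD)
  ultimately show ?thesis by (simp add: hom_polys_iff_grade)
qed

lemma irreducible_var: "irreducible (var i :: 'k::field mpoly)"
  unfolding irreducible_def
proof (intro conjI allI impI)
  fix a b :: "'k mpoly" assume ab: "var i = a * b"
  then have nz: "a \<noteq> 0" "b \<noteq> 0" by auto
  have "tdeg a + tdeg b = 1" using tdeg_mult[OF nz] by (simp flip: ab)
  then show "a dvd 1 \<or> b dvd 1" using nz by (auto simp: unit_mpoly_iff)
qed (auto simp: unit_mpoly_iff)

definition coprime_tuple :: "nat \<Rightarrow> 'k::field tuple \<Rightarrow> bool" where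
  "coprime_tuple n F \<longleftrightarrow> F \<in> hom_tuples n \<and> (\<forall>f. irreducible f \<longrightarrow> (\<exists>i\<le>n. \<not> f dvd F i))"

text \<open>A representative of least degree works: dividing out a common irreducible factor would
  give one of smaller degree.\<close>

lemma coprime_representative:
  assumes "\<phi> \<in> rat_maps n"
  obtains F where "coprime_tuple n F" "\<phi> = cls n F"
proof -
  define Q where "Q d \<longleftrightarrow> (\<exists>F\<in>\<phi>. \<forall>i\<le>n. F i \<in> hom_polys n d)" for d
  obtain F0 where F0: "F0 \<in> hom_tuples n" "\<phi> = cls n F0" using assms by (rule rat_mapE)
  have "F0 \<in> \<phi>" using F0 proportional_refl by auto
  then have "\<exists>d. Q d" using F0(1) by (auto simp: Q_def hom_tuples_def)
  then have "Q (LEAST d. Q d)" by (rule LeastI_ex)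
  then obtain F where F: "F \<in> \<phi>" "\<And>i. i \<le> n \<Longrightarrow> F i \<in> hom_polys n (LEAST d. Q d)" by (auto simp: Q_def)
  have FF0: "(F0, F) \<in> proportional n" using F(1) F0 by auto
  then have h: "F \<in> hom_tuples n" by (auto simp: proportional_def)
  have cl: "\<phi> = cls n F" using FF0 F0 cls_eq_iff h by metis
  have "\<exists>i\<le>n. \<not> f dvd F i" if f: "irreducible f" for f
  proof (rule ccontr)
    assume "\<not> ?thesis"
    then have "\<forall>i. \<exists>g. i \<le> n \<longrightarrow> F i = f * g" by blast
    then obtain H where H: "\<And>i. i \<le> n \<Longrightarrow> F i = f * H i" by metis
    obtain k where k: "k \<le> n" "F k \<noteq> 0" using h by (auto simp: hom_tuples_def)
    have nz: "f \<noteq> 0" "H k \<noteq> 0" using H[OF k(1)] k by auto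
    have f0: "tdeg f > 0" using f nz by (auto simp: unit_mpoly_iff irreducible_def)
    have sum: "tdeg f + tdeg (H i) = (LEAST d. Q d)" if "i \<le> n" "H i \<noteq> 0" for i
      using tdeg_mult[OF nz(1) that(2)] tdeg_hom[OF F(2)[OF that(1)]] H[OF that(1)] nz that by simp
    have "H i \<in> hom_polys n ((LEAST d. Q d) - tdeg f)" if "i \<le> n" for i
    proof (cases "H i = 0")
      case False
      then show ?thesis using hom_polys_factor[of "H i" f] F(2)[OF that] H[OF that] nz sum[OF that]
        by (metis add_diff_cancel_left' mult.commute mult_eq_0_iff)
    qed simp
    moreover from this have Ht: "H \<in> hom_tuples n" using nz k unfolding hom_tuples_def by auto
    moreover have "(F, H) \<in> proportional n" using h Ht by (auto simp: proportional_def H mult_ac)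
    ultimately have "Q ((LEAST d. Q d) - tdeg f)" using cl by (auto simp: Q_def)
    then have "(LEAST d. Q d) \<le> (LEAST d. Q d) - tdeg f" by (rule Least_le)
    then show False using sum[OF k(1) nz(2)] f0 by simp
  qed
  then show ?thesis using that[of F] cl h by (simp add: coprime_tuple_def)
qed

text \<open>In \<open>b * F' i = a * F i\<close>, an irreducible factor of \<open>b\<close> fails to
  divide some \<open>F i\<close>, hence divides \<open>a\<close> by primality and can be cancelled.
  Repeating this makes \<open>b\<close> a unit.\<close>

lemma coprime_tuple_multiple:
  assumes F: "coprime_tuple n F" and F': "(F, F') \<in> proportional n"
  obtains g where "\<And>i. i \<le> n \<Longrightarrow> F' i = g * F i"
proof -
  have *: "\<exists>g. \<forall>i\<le>n. F' i = g * F i" if "b \<noteq> 0" "\<forall>i\<le>n. b * F' i = a * F i" for a b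
    using that
  proof (induction "tdeg b" arbitrary: a b rule: less_induct)
    case less
    show ?case
    proof (cases "b dvd 1")
      case True
      then obtain c where c: "b * c = 1" by (metis dvdE)
      have "F' i = (a * c) * F i" if "i \<le> n" for i
      proof -
        have "F' i = c * (b * F' i)" using c by (metis mult.assoc mult.commute mult_1)
        then show ?thesis using less.prems that by (simp add: mult_ac)
      qed
      then show ?thesis by blast
    next
      case False
      then obtain f b' where f: "irreducible f" "b = f * b'"
        using irreducible_divisor[of b] less.prems unfolding unit_mpoly_iff by (metis dvdE gr0I)
      then have nz: "f \<noteq> 0" "b' \<noteq> 0" using less.prems by auto
      obtain i where i: "i \<le> n" "\<not> f dvd F i" using F f by (auto simp: coprime_tuple_def)
      have "f dvd a * F i" using less.prems i f by (metis dvd_mult2 dvd_triv_left)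
      then have "f dvd a" using irreducible_imp_prime_mpoly[OF f(1)] i by (auto simp: prime_elem_def)
      then obtain a' where "a = f * a'" by blast
      then have "\<forall>i\<le>n. b' * F' i = a' * F i" using less.prems f nz by (simp add: mult.assoc)
      moreover have "tdeg b' < tdeg b"
        using tdeg_mult[OF nz] f nz by (auto simp: unit_mpoly_iff irreducible_def)
      ultimately show ?thesis using less.hyps nz by blast
    qed
  qed
  obtain k where k: "k \<le> n" "F k \<noteq> 0" using F by (auto simp: coprime_tuple_def hom_tuples_def)
  have "\<forall>i\<le>n. F k * F' i = F' k * F i" using F' k by (auto simp: proportional_def mult_ac)
  then show ?thesis using * k that by blast
qed

section \<open>Homogeneous prime ideals as points\<close>

lemma ideal_poly_ringI:
  fixes I :: "'k::field mpoly set"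
  assumes "I \<subseteq> polys n" "0 \<in> I" "\<And>p q. p \<in> I \<Longrightarrow> q \<in> I \<Longrightarrow> p + q \<in> I"
    "\<And>p q. p \<in> I \<Longrightarrow> q \<in> polys n \<Longrightarrow> q * p \<in> I"
  shows "ideal I (poly_ring n)"
proof (rule idealI)
  interpret R: cring "poly_ring n :: 'k mpoly ring" by (rule cring_poly_ring)
  show "ring (poly_ring n :: 'k mpoly ring)" by (rule R.ring_axioms)
  have inv: "inv\<^bsub>add_monoid (poly_ring n)\<^esub> p = - p" if "p \<in> I" for p
  proof (rule group.inv_equality)
    show "group (add_monoid (poly_ring n :: 'k mpoly ring))" by (rule R.add.is_group)
  qed (use that assms(1) in \<open>auto simp: poly_ring_def polys_uminus\<close>)
  have neg: "- p \<in> I" if "p \<in> I" for p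
    using assms(4)[OF that, of "- 1"] polys_uminus[of 1 n] by simp
  show "subgroup I (add_monoid (poly_ring n))"
    by (rule subgroup.intro) (use assms neg inv in \<open>auto simp: poly_ring_def\<close>)
qed (use assms in \<open>auto simp: poly_ring_def mult.commute\<close>)

text \<open>The image under \<open>G\<close> of the generic point of the hypersurface \<open>f = 0\<close>.\<close>

lemma image_point:
  fixes f :: "'k::field mpoly"
  assumes f: "irreducible f" "f \<in> hom_polys n a" and G: "\<And>i. i \<le> n \<Longrightarrow> G i \<in> hom_polys n e" "e > 0"
    and ex: "\<exists>i\<le>n. \<not> f dvd G i"
  shows "{p \<in> polys n. f dvd poly_subst G p} \<in> proj_points n" (is "?P \<in> _")
proof -
  interpret R: cring "poly_ring n :: 'k mpoly ring" by (rule cring_poly_ring)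
  have prime: "prime_elem f" using f by (intro irreducible_imp_prime_mpoly)
  have idl: "ideal ?P (poly_ring n)"
    by (rule ideal_poly_ringI) (auto simp: poly_subst_add poly_subst_mult polys_add polys_mult)
  have "\<not> f dvd 1" using f by (auto simp: irreducible_def)
  then have "1 \<notin> ?P" by simp
  moreover have "1 \<in> carrier (poly_ring n)" by (simp add: poly_ring_def)
  ultimately have "carrier (poly_ring n) \<noteq> ?P" by blast
  then have pr: "primeideal ?P (poly_ring n)"
    using idl by (intro primeidealI)
      (use R.is_cring prime in \<open>auto simp: poly_ring_def poly_subst_mult prime_elem_def\<close>)
  \<comment> \<open>Substituting \<open>G\<close> sends the part of degree \<open>d\<close> to
    degree \<open>d * e\<close>, and \<open>e > 0\<close> keeps these degrees apart. As
    \<open>f\<close> is homogeneous, it divides each homogeneous part of a multiple of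
    \<open>f\<close>.\<close>
  have comp: "f dvd poly_subst G (coeff (grade p) d)" if p: "p \<in> ?P" for p d
  proof -
    obtain z where z: "poly_subst G p = f * z" using p by blast
    have pn: "p \<in> polys n" using p by simp
    have "p = (\<Sum>d\<le>degree (grade p). coeff (grade p) d)"
      using poly_grade_1[of p] by (simp add: poly_altdef)
    then have "grade (poly_subst G p) = grade (poly_subst G (\<Sum>d\<le>degree (grade p). coeff (grade p) d))"
      by simp
    also have "\<dots> = (\<Sum>d\<le>degree (grade p). monom (poly_subst G (coeff (grade p) d)) (d * e))"
      unfolding poly_subst_sum grade_sum
      by (intro sum.cong refl grade_hom[of _ n] hom_polys_subst[OF coeff_grade_hom[OF pn]] G(1))
    finally have "coeff (grade (poly_subst G p)) (d * e) =
        (\<Sum>c\<le>degree (grade p). if c = d then poly_subst G (coeff (grade p) c) else 0)"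
      using G(2) by (simp add: coeff_sum)
    also have "\<dots> = poly_subst G (coeff (grade p) d)"
      by (auto simp: coeff_eq_0)
    finally have "poly_subst G (coeff (grade p) d) = coeff (monom f a * grade z) (d * e)"
      using z f by (simp add: grade_hom)
    then show ?thesis by (simp add: coeff_monom_mult)
  qed
  have "?P = Idl\<^bsub>poly_ring n\<^esub> (?P \<inter> (\<Union>d. hom_polys n d))"
  proof
    show "Idl\<^bsub>poly_ring n\<^esub> (?P \<inter> (\<Union>d. hom_polys n d)) \<subseteq> ?P"
      by (rule R.genideal_minimal[OF idl]) blast
    have "p \<in> I" if p: "p \<in> ?P" and I: "ideal I (poly_ring n)" "?P \<inter> (\<Union>d. hom_polys n d) \<subseteq> I" for p I
    proof -
      have pn: "p \<in> polys n" using p by simp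
      have I0: "0 \<in> I" "\<And>x y. x \<in> I \<Longrightarrow> y \<in> I \<Longrightarrow> x + y \<in> I"
        using additive_subgroup.zero_closed[OF ideal.axioms(1)[OF I(1)]]
          additive_subgroup.a_closed[OF ideal.axioms(1)[OF I(1)]] by (auto simp: poly_ring_def)
      have "coeff (grade p) d \<in> I" for d
        using comp[OF p] coeff_grade_hom[OF pn] I(2) hom_polysD by blast
      then have "(\<Sum>d\<le>m. coeff (grade p) d) \<in> I" for m
        by (induction m) (auto simp: I0)
      moreover have "p = (\<Sum>d\<le>degree (grade p). coeff (grade p) d)"
        using poly_grade_1[of p] by (simp add: poly_altdef)
      ultimately show ?thesis by metis
    qed
    then show "?P \<subseteq> Idl\<^bsub>poly_ring n\<^esub> (?P \<inter> (\<Union>d. hom_polys n d))"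
      unfolding genideal_def by blast
  qed
  moreover have "\<not> var ` {..n} \<subseteq> ?P" using ex by auto
  ultimately show ?thesis using pr by (simp add: proj_points_def)
qed

section \<open>Automorphisms have degree one\<close>

lemma Bir_proj_dominant:
  assumes "cls n F \<in> carrier (Bir_proj n)" "F \<in> hom_tuples n"
  shows "dominant_tuple n F"
proof -
  obtain F' where F': "dominant_tuple n F'" "cls n F = cls n F'"
    using assms(1) by (rule Bir_projE) blast
  have "F' \<in> hom_tuples n" using F'(1) by (simp add: dominant_tuple_def)
  then have "(F', F) \<in> proportional n" using F'(2) assms(2) cls_eq_iff by blast
  then show ?thesis using dominant_proportional F'(1) by blast
qed

lemma Aut_proj_linear:
  fixes \<phi> :: "'k::field rat_map"
  assumes n: "n \<ge> 1" and \<phi>: "\<phi> \<in> Aut_proj n"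
  obtains F where "dominant_tuple n F" "\<phi> = cls n F" "\<And>i. i \<le> n \<Longrightarrow> F i \<in> hom_polys n 1"
proof -
  obtain \<psi> where \<psi>: "\<psi> \<in> proj_morphisms n" "rat_comp n \<phi> \<psi> = rat_id n" "rat_comp n \<psi> \<phi> = rat_id n"
    using \<phi> by (auto simp: Aut_proj_def)
  have \<phi>m: "\<phi> \<in> proj_morphisms n" using \<phi> by (simp add: Aut_proj_def)
  have rm: "\<phi> \<in> rat_maps n" "\<psi> \<in> rat_maps n" using \<phi>m \<psi> by (auto simp: proj_morphisms_def)
  have B: "\<phi> \<in> carrier (Bir_proj n)" "\<psi> \<in> carrier (Bir_proj n)"
    using rm \<psi> by (auto simp: Bir_proj_def)
  obtain F where F: "coprime_tuple n F" "\<phi> = cls n F" using coprime_representative[OF rm(1)] .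
  obtain G where G: "coprime_tuple n G" "\<psi> = cls n G" using coprime_representative[OF rm(2)] .
  have ht: "F \<in> hom_tuples n" "G \<in> hom_tuples n" using F G by (auto simp: coprime_tuple_def)
  have dF: "dominant_tuple n F" and dG: "dominant_tuple n G" using Bir_proj_dominant B F G ht by auto
  obtain d where d: "\<And>i. i \<le> n \<Longrightarrow> F i \<in> hom_polys n d" using ht by (auto simp: hom_tuples_def)
  obtain e where e: "\<And>i. i \<le> n \<Longrightarrow> G i \<in> hom_polys n e" using ht by (auto simp: hom_tuples_def)
  define K where "K i = poly_subst G (F i)" for i
  have K: "K i \<in> hom_polys n (d * e)" if "i \<le> n" for i
    unfolding K_def using hom_polys_subst d[OF that] e by blast
  have Kt: "K \<in> hom_tuples n" unfolding K_def[abs_def] using dominant_comp ht dG by blast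
  have "cls n K = cls n var"
    using \<psi>(2) rat_comp_dominant[OF ht(1) dG] by (simp add: F G K_def[abs_def] rat_id_eq)
  then have Kv: "K i * var j = K j * var i" if "i \<le> n" "j \<le> n" for i j
    using cls_eq_iff[OF Kt var_tuple] that by (auto simp: proportional_def)
  \<comment> \<open>As \<open>var 0\<close> is prime and does not divide \<open>var 1\<close>, it
    divides \<open>K 0\<close>; the quotient \<open>h\<close> satisfies
    \<open>K i = var i * h\<close> for all \<open>i \<le> n\<close>.\<close>
  have "var 0 dvd K 0 * var 1" using Kv[of 0 1] n by (metis dvd_triv_right le0)
  moreover have "\<not> (var 0 :: 'k mpoly) dvd var 1"
  proof
    assume "(var 0 :: 'k mpoly) dvd var 1"
    moreover have "(var 1 :: 'k mpoly) \<in> vpolys {1}" by (simp add: vpolys_var)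
    ultimately have "(var 0 :: 'k mpoly) \<in> vpolys {1}" using vpolys_dvd var_nonzero by blast
    then show False by (simp add: vpolys_def var_def)
  qed
  ultimately have "var 0 dvd K 0"
    using irreducible_imp_prime_mpoly[OF irreducible_var] by (auto simp: prime_elem_def)
  then obtain h where h: "K 0 = var 0 * h" by blast
  have Kh: "K i = var i * h" if "i \<le> n" for i
    using Kv[of i 0] that h by (simp add: mult_ac)
  have nz: "h \<noteq> 0" using Kt by (auto simp: hom_tuples_def Kh)
  have hh: "h \<in> hom_polys n (tdeg h)"
    using hom_polys_factor[of h "var 0" n "d * e"] K[of 0] nz by (simp add: h mult.commute)
  have de: "d * e = 1 + tdeg h"
    using tdeg_hom[OF K[of 0]] tdeg_mult[of "var 0 :: 'k mpoly" h] nz by (simp add: h)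
  have "tdeg h = 0"
  proof (rule ccontr)
    assume "tdeg h \<noteq> 0"
    then obtain f where f: "irreducible f" "f dvd h" using irreducible_divisor nz by blast
    obtain h' where h': "h = f * h'" using f(2) by blast
    then have fh: "f \<in> hom_polys n (tdeg f)" using hom_polys_factor[of f h'] hh nz by simp
    \<comment> \<open>For \<open>e = 0\<close> the product \<open>d * e\<close> would vanish, but it
      equals \<open>1 + tdeg h\<close>.\<close>
    have "e > 0" using de by (cases e) auto
    then have "{p \<in> polys n. f dvd poly_subst G p} \<in> proj_points n"
      using image_point[OF f(1) fh e] G(1) f(1) by (auto simp: coprime_tuple_def)
    then obtain F' i where F': "F' \<in> \<phi>" "i \<le> n" "F' i \<notin> {p \<in> polys n. f dvd poly_subst G p}"
      using \<phi>m unfolding proj_morphisms_def defined_at_def by blast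
    have FF': "(F, F') \<in> proportional n" using F' F by auto
    \<comment> \<open>Every representative of \<open>\<phi>\<close> is a multiple of
      \<open>F\<close>, so its pullback under \<open>G\<close> is divisible by \<open>h\<close> and
      hence by \<open>f\<close>: none is defined at the point.\<close>
    then obtain g where "\<And>i. i \<le> n \<Longrightarrow> F' i = g * F i" using coprime_tuple_multiple F(1) by blast
    then have "poly_subst G (F' i) = poly_subst G g * (var i * h)"
      using F'(2) Kh by (simp add: poly_subst_mult K_def)
    then have "f dvd poly_subst G (F' i)" using f(2) by simp
    moreover have "F' i \<in> polys n"
      using FF' F'(2) by (auto simp: proportional_def hom_tuples_def intro: hom_polysD)
    ultimately show False using F' by blast
  qed
  then have "d = 1" using de by simp
  then show ?thesis using that[of F] dF F(2) d by simp
qed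

section \<open>The Jacobian modulo squares\<close>

definition pd :: "nat \<Rightarrow> 'k::field mpoly \<Rightarrow> 'k mpoly" where
  "pd j p = coeff (usubst (\<lambda>i. [:var i, if i = j then 1 else 0:]) p) 1"

lemma coeff_usubst_shift: "coeff (usubst (\<lambda>i. [:var i, if i = j then 1 else 0:]) p) 0 = p"
  using poly_usubst[of "\<lambda>i. [:var i, if i = j then 1 else 0:]" p 0] by (simp add: poly_0_coeff_0)

lemma pd_simps [simp]:
  "pd j (const c) = 0" "pd j 0 = 0" "pd j 1 = 0" "pd j (p + q) = pd j p + pd j q"
  "pd j (var i) = (if i = j then 1 else 0)"
  by (simp_all add: pd_def usubst_add)

lemma pd_mult [simp]: "pd j (p * q) = p * pd j q + pd j p * q"
  by (simp add: pd_def usubst_mult coeff_mult coeff_usubst_shift)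

lemma poly_subst_of_nat: "poly_subst G (of_nat k) = of_nat k"
  by (induction k) (auto simp: poly_subst_add)

lemma pd_sum: "pd j (sum f A) = (\<Sum>a\<in>A. pd j (f a))"
  by (induction A rule: infinite_finite_induct) auto

lemma pd_free: "p \<in> vpolys V \<Longrightarrow> j \<notin> V \<Longrightarrow> pd j p = 0"
  by (induction rule: vpolys_induct) auto

lemma pd_subst:
  assumes "p \<in> polys n"
  shows "pd j (poly_subst G p) = (\<Sum>l\<le>n. poly_subst G (pd l p) * pd j (G l))"
  using assms unfolding polys_eq_vpolys
proof (induction rule: vpolys_induct)
  case (var i)
  then show ?case by (simp add: if_distrib[of "poly_subst G"] if_distrib[of "\<lambda>x. x * _"] cong: if_cong)
next
  case (mult p q)
  then show ?case
    by (simp add: poly_subst_mult poly_subst_add sum.distrib sum_distrib_left algebra_simps)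
qed (simp_all add: poly_subst_add distrib_right sum.distrib)

text \<open>The operator \<open>E\<close> is a derivation that kills constants and fixes the
  variables, so it multiplies each monomial by its degree.\<close>

lemma euler_hom_polys:
  assumes "p \<in> hom_polys n d"
  shows "(\<Sum>l\<le>n. var l * pd l p) = of_nat d * p"
proof -
  define E :: "'a mpoly \<Rightarrow> 'a mpoly" where "E p = (\<Sum>l\<le>n. var l * pd l p)" for p
  have Em: "E (p * q) = p * E q + E p * q" for p q
    by (simp add: E_def sum_distrib_left sum_distrib_right sum.distrib algebra_simps)
  have Ec: "E (const c) = 0" for c by (simp add: E_def)
  have Es: "E (sum f A) = (\<Sum>a\<in>A. E (f a))" for f :: "(nat \<Rightarrow>\<^sub>0 nat) \<Rightarrow> 'a mpoly" and A
    unfolding E_def pd_sum sum_distrib_left by (rule sum.swap)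
  have Ev: "E (var i) = var i" if "i \<le> n" for i
    using that by (simp add: E_def if_distrib[of "\<lambda>x. _ * x"] cong: if_cong)
  have Ep: "E (var i ^ k) = of_nat k * var i ^ k" if "i \<le> n" for i k
    by (induction k) (use Ec[of 1] in \<open>simp_all add: Em Ev[OF that] algebra_simps\<close>)
  have Epr: "E (\<Prod>i\<in>A. var i ^ f i) = of_nat (sum f A) * (\<Prod>i\<in>A. var i ^ f i)"
    if "finite A" "A \<subseteq> {..n}" for A f
    using that
    by induction (use Ec[of 1] in \<open>simp_all add: Em Ep algebra_simps\<close>)
  have "E p = E (poly_subst var p)" by simp
  also have "\<dots> = (\<Sum>m\<in>Poly_Mapping.keys p. E (const (Poly_Mapping.lookup p m) * mon_subst var m))"
    by (simp add: poly_subst_def Es)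
  also have "\<dots> = (\<Sum>m\<in>Poly_Mapping.keys p. of_nat d * (const (Poly_Mapping.lookup p m) * mon_subst var m))"
  proof (rule sum.cong)
    fix m assume m: "m \<in> Poly_Mapping.keys p"
    then have "Poly_Mapping.keys m \<subseteq> {..n}" "d = mdeg m" using assms by (auto simp: hom_polys_def polys_def)
    then show "E (const (Poly_Mapping.lookup p m) * mon_subst var m) =
        of_nat d * (const (Poly_Mapping.lookup p m) * mon_subst var m)"
      unfolding Em Ec mon_subst_def by (simp add: Epr mdeg_def)
  qed simp
  also have "\<dots> = of_nat d * poly_subst var p" by (simp add: poly_subst_def sum_distrib_left)
  finally show ?thesis by (simp add: E_def)
qed

lemma hom_polys_1_expand:
  assumes "p \<in> hom_polys n 1"
  shows "p = (\<Sum>l\<le>n. const (Poly_Mapping.lookup p (Poly_Mapping.single l 1)) * var l)"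
proof -
  have k: "Poly_Mapping.keys p \<subseteq> (\<lambda>l. Poly_Mapping.single l 1) ` {..n}"
  proof
    fix m assume m: "m \<in> Poly_Mapping.keys p"
    then have "mdeg m = 1" "Poly_Mapping.keys m \<subseteq> {..n}" using assms by (auto simp: hom_polys_def polys_def)
    then obtain l where l: "l \<in> Poly_Mapping.keys m" "Poly_Mapping.lookup m l = 1"
        "\<forall>i\<in>Poly_Mapping.keys m. l \<noteq> i \<longrightarrow> Poly_Mapping.lookup m i = 0"
      unfolding mdeg_def by (subst (asm) sum_eq_1_iff) auto
    then have "m = Poly_Mapping.single l 1"
      by (intro poly_mapping_eqI) (auto simp: lookup_single when_def in_keys_iff)
    then show "m \<in> (\<lambda>l. Poly_Mapping.single l 1) ` {..n}" using l \<open>Poly_Mapping.keys m \<subseteq> {..n}\<close> by blast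
  qed
  have inj: "inj_on (\<lambda>l::nat. Poly_Mapping.single l (1::nat)) {..n}"
    by (rule inj_onI) (metis keys_single one_neq_zero singleton_inject)
  have "p = (\<Sum>m\<in>Poly_Mapping.keys p. Poly_Mapping.single m (Poly_Mapping.lookup p m))"
    by (rule mpoly_expand)
  also have "\<dots> = (\<Sum>m\<in>(\<lambda>l. Poly_Mapping.single l 1) ` {..n}. Poly_Mapping.single m (Poly_Mapping.lookup p m))"
    by (rule sum.mono_neutral_left) (use k in \<open>auto simp: in_keys_iff\<close>)
  also have "\<dots> = (\<Sum>l\<le>n. const (Poly_Mapping.lookup p (Poly_Mapping.single l 1)) * var l)"
    unfolding sum.reindex[OF inj] by (simp add: o_def var_def mult_single del: One_nat_def)
  finally show ?thesis .
qed

section \<open>Triangular determinants, the Jacobian and the chain rule\<close>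

lemma det_lower:
  fixes f :: "nat \<times> nat \<Rightarrow> 'a::comm_ring_1"
  assumes "\<And>i j. i < j \<Longrightarrow> j < N \<Longrightarrow> f (i, j) = 0"
  shows "det (mat N N f) = (\<Prod>i<N. f (i, i))"
proof -
  have "det (mat N N f) = prod_list (diag_mat (mat N N f))"
    by (rule det_lower_triangular[where n = N]) (use assms in auto)
  also have "diag_mat (mat N N f) = map (\<lambda>i. f (i, i)) [0..<N]"
    by (auto simp: diag_mat_def)
  finally show ?thesis using prod.distinct_set_conv_list[of "[0..<N]" "\<lambda>i. f (i, i)"] by (simp add: atLeast0LessThan)
qed

lemma det_upper:
  fixes f :: "nat \<times> nat \<Rightarrow> 'a::comm_ring_1"
  assumes "\<And>i j. j < i \<Longrightarrow> i < N \<Longrightarrow> f (i, j) = 0"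
  shows "det (mat N N f) = (\<Prod>i<N. f (i, i))"
proof -
  have "transpose_mat (mat N N f) = mat N N (\<lambda>(i, j). f (j, i))" by auto
  then have "det (mat N N f) = det (mat N N (\<lambda>(i, j). f (j, i)))"
    by (metis det_transpose mat_carrier)
  then show ?thesis using assms by (simp add: det_lower)
qed

lemma mat_mult_matI:
  assumes "\<And>i j. i < N \<Longrightarrow> j < N \<Longrightarrow> (\<Sum>k<N. f (i, k) * g (k, j)) = h (i, j)"
  shows "mat N N f * mat N N g = mat N N h"
  by (rule eq_matI) (use assms in \<open>auto simp: scalar_prod_def atLeast0LessThan\<close>)

text \<open>With \<open>\<Omega> = \<Sum>i. (-1)\<^sup>i x\<^sub>i dx\<^sub>0 \<dots> dx\<^sub>n\<close> (\<open>dx\<^sub>i\<close> omitted), the pullback \<open>F\<^sup>*\<Omega>\<close> is \<open>(jdet n F / x\<^sub>0) \<Omega>\<close>. Unlike the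
  determinant of all \<open>n + 1\<close> partial derivatives, \<open>jdet\<close> does not vanish when the characteristic divides
  the degree of \<open>F\<close>.\<close>

definition jac_mat :: "nat \<Rightarrow> 'k::field tuple \<Rightarrow> 'k mpoly mat" where
  "jac_mat n F = mat (Suc n) (Suc n) (\<lambda>(i, j). if j = 0 then F i else pd j (F i))"

definition jdet :: "nat \<Rightarrow> 'k::field tuple \<Rightarrow> 'k mpoly" where
  "jdet n F = det (jac_mat n F)"

lemma sum_row_0_diag:
  fixes a :: "nat \<Rightarrow> 'a::comm_ring_1"
  assumes "j < N"
  shows "(\<Sum>k<N. a k * (if k = j then h else if k = 0 then c else 0)) = (if j = 0 then a 0 * h else a 0 * c + a j * h)"
proof -
  have "(\<Sum>k<N. a k * (if k = j then h else if k = 0 then c else 0)) =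
      (\<Sum>k<N. (if k = j then a k * h else 0) + (if k = 0 then (if j = 0 then 0 else a 0 * c) else 0))"
    by (rule sum.cong) auto
  then show ?thesis using assms by (auto simp: sum.distrib)
qed

lemma sum_col_0_diag:
  fixes a :: "nat \<Rightarrow> 'a::comm_ring_1"
  assumes "i < N"
  shows "(\<Sum>k<N. (if k = i then h else if k = 0 then c else 0) * a k) = (if i = 0 then h * a 0 else c * a 0 + h * a i)"
  using sum_row_0_diag[OF assms, of a h c] by (simp add: mult.commute)

text \<open>By the product rule each derivative column of the new matrix is \<open>h\<close> times
  the old one plus a multiple of column 0. This is right multiplication by an upper triangular
  matrix with \<open>Suc n\<close> diagonal entries \<open>h\<close>.\<close>

lemma jdet_scale: "jdet n (\<lambda>i. h * F i) = h ^ Suc n * jdet n F"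
proof -
  define Z where "Z = mat (Suc n) (Suc n) (\<lambda>(i, j). if i = j then h else if i = 0 then pd j h else 0)"
  have "jac_mat n F * Z = jac_mat n (\<lambda>i. h * F i)"
    unfolding jac_mat_def Z_def
    by (rule mat_mult_matI) (simp add: sum_row_0_diag mult.commute del: sum.lessThan_Suc)
  moreover have "det Z = h ^ Suc n" unfolding Z_def by (subst det_upper) auto
  moreover have "jac_mat n F \<in> carrier_mat (Suc n) (Suc n)" "Z \<in> carrier_mat (Suc n) (Suc n)"
    by (auto simp: jac_mat_def Z_def)
  ultimately show ?thesis unfolding jdet_def using det_mult[of "jac_mat n F" "Suc n" Z] by (simp add: mult.commute)
qed

lemma comm_ring_hom_poly_subst: "comm_ring_hom (poly_subst G)"
  by unfold_locales (simp_all add: poly_subst_add poly_subst_mult)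

lemma comm_ring_hom_const: "comm_ring_hom const"
  by unfold_locales (simp_all add: const_add const_mult)

text \<open>If \<open>A F\<close> is the Jacobian matrix, then \<open>(A F)(G) R (A G) = A (F \<circ> G) Z\<close> with triangular matrices \<open>R\<close> and \<open>Z\<close>.
  Euler's identity eliminates the partial derivative along \<open>x\<^sub>0\<close>, which is not a column of \<open>A F\<close>.\<close>

lemma jdet_subst:
  assumes F: "\<And>i. i \<le> n \<Longrightarrow> F i \<in> hom_polys n d" and G0: "G 0 \<noteq> 0"
  shows "G 0 * jdet n (\<lambda>i. poly_subst G (F i)) = poly_subst G (jdet n F) * jdet n G"
proof -
  let ?N = "Suc n"
  let ?H = "\<lambda>i. poly_subst G (F i)"
  define J where "J F = (\<lambda>(i, j). if j = 0 then F i else pd j (F i))" for F :: "'a tuple"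
  define M where "M = (\<lambda>(i, j). if j = 0 then ?H i else poly_subst G (pd j (F i)))"
  define R where "R = (\<lambda>(l, k). if k = l then (if l = 0 then 1 else G 0) else if k = 0 then - G l else 0)"
  define Y where "Y = (\<lambda>(l, j). if l = 0 then J G (0, j)
     else if j = 0 then 0 else G 0 * pd j (G l) - G l * pd j (G 0))"
  \<comment> \<open>The term \<open>?H i * pd j (G 0)\<close> comes from row 0 of \<open>Y\<close>,
    and Euler's identity contributes \<open>- of_nat d\<close> times the same term; hence the
    coefficient \<open>1 - of_nat d\<close>.\<close>
  define Z where "Z = (\<lambda>(i, j). if i = j then G 0 else if i = 0 then (1 - of_nat d) * pd j (G 0) else 0)"
  define W where "W = (\<lambda>(i, j). if j = 0 then ?H i * G 0 else ?H i * ((1 - of_nat d) * pd j (G 0)) + pd j (?H i) * G 0)"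
  have jac: "jac_mat n F = mat ?N ?N (J F)" for F :: "'a tuple"
    by (simp add: jac_mat_def J_def)
  have RY: "mat ?N ?N R * jac_mat n G = mat ?N ?N Y"
    unfolding jac
  proof (rule mat_mult_matI)
    fix l j assume lj: "l < ?N" "j < ?N"
    have "(\<Sum>k<?N. R (l, k) * J G (k, j)) =
      (if l = 0 then (if l = 0 then 1 else G 0) * J G (0, j) else - G l * J G (0, j) + (if l = 0 then 1 else G 0) * J G (l, j))"
      unfolding R_def prod.case using sum_col_0_diag[OF lj(1), of _ _ "\<lambda>k. J G (k, j)"] .
    then show "(\<Sum>k<?N. R (l, k) * J G (k, j)) = Y (l, j)"
      by (simp add: Y_def del: sum.lessThan_Suc) (simp add: J_def algebra_simps)
  qed
  have HZ: "jac_mat n ?H * mat ?N ?N Z = mat ?N ?N W"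
    unfolding jac
  proof (rule mat_mult_matI)
    fix i j assume ij: "i < ?N" "j < ?N"
    have "(\<Sum>k<?N. J ?H (i, k) * Z (k, j)) =
      (if j = 0 then J ?H (i, 0) * G 0 else J ?H (i, 0) * ((1 - of_nat d) * pd j (G 0)) + J ?H (i, j) * G 0)"
      unfolding Z_def prod.case using sum_row_0_diag[OF ij(2), of "\<lambda>k. J ?H (i, k)"] .
    then show "(\<Sum>k<?N. J ?H (i, k) * Z (k, j)) = W (i, j)"
      by (simp add: W_def J_def del: sum.lessThan_Suc)
  qed
  have MY: "mat ?N ?N M * mat ?N ?N Y = mat ?N ?N W"
  proof (rule mat_mult_matI)
    fix i j assume ij: "i < ?N" "j < ?N"
    then have Fi: "F i \<in> hom_polys n d" using F by simp
    let ?p = "\<lambda>l. poly_subst G (pd l (F i))"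
    have l: "(\<Sum>k<?N. M (i, k) * Y (k, j)) = ?H i * J G (0, j) + (\<Sum>k<n. ?p (Suc k) * Y (Suc k, j))"
      by (subst sum.lessThan_Suc_shift) (simp add: M_def Y_def)
    have split: "(\<Sum>l\<le>n. f l) = f 0 + (\<Sum>k<n. f (Suc k))" for f :: "nat \<Rightarrow> 'a mpoly"
      by (simp add: sum.atMost_shift)
    have e1: "pd j (?H i) = ?p 0 * pd j (G 0) + (\<Sum>k<n. ?p (Suc k) * pd j (G (Suc k)))"
      using pd_subst[OF hom_polysD[OF Fi], of j G] by (simp add: split)
    have "poly_subst G (\<Sum>l\<le>n. var l * pd l (F i)) = of_nat d * ?H i"
      unfolding euler_hom_polys[OF Fi] poly_subst_mult by (simp add: poly_subst_of_nat)
    then have e2: "G 0 * ?p 0 + (\<Sum>k<n. G (Suc k) * ?p (Suc k)) = of_nat d * ?H i"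
      by (simp add: poly_subst_sum poly_subst_mult poly_subst_add split)
    show "(\<Sum>k<?N. M (i, k) * Y (k, j)) = W (i, j)"
    proof (cases "j = 0")
      case True
      then show ?thesis unfolding l by (simp add: Y_def W_def J_def)
    next
      case False
      have "(\<Sum>k<n. ?p (Suc k) * Y (Suc k, j)) =
          G 0 * (\<Sum>k<n. ?p (Suc k) * pd j (G (Suc k))) - pd j (G 0) * (\<Sum>k<n. G (Suc k) * ?p (Suc k))"
        using False by (simp add: Y_def sum_distrib_left sum_subtractf algebra_simps)
      also have "\<dots> = G 0 * (pd j (?H i) - ?p 0 * pd j (G 0))
          - pd j (G 0) * (of_nat d * ?H i - G 0 * ?p 0)"
        by (simp add: e1 flip: e2)
      finally show ?thesis unfolding l using False by (simp add: W_def J_def algebra_simps)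
    qed
  qed
  have "mat ?N ?N M = map_mat (poly_subst G) (jac_mat n F)"
    by (rule eq_matI) (auto simp: M_def jac_mat_def)
  then have dM: "det (mat ?N ?N M) = poly_subst G (jdet n F)"
    by (simp add: jdet_def comm_ring_hom.hom_det[OF comm_ring_hom_poly_subst])
  have dR: "det (mat ?N ?N R) = G 0 ^ n"
    by (subst det_lower) (auto simp: R_def prod.lessThan_Suc_shift simp del: prod.lessThan_Suc)
  have dZ: "det (mat ?N ?N Z) = G 0 ^ ?N" by (subst det_upper) (auto simp: Z_def)
  have car: "jac_mat n H \<in> carrier_mat ?N ?N" for H :: "'a tuple"
    by (simp add: jac_mat_def)
  have "det (mat ?N ?N M) * det (mat ?N ?N Y) = det (jac_mat n ?H) * det (mat ?N ?N Z)"
    unfolding det_mult[OF mat_carrier mat_carrier, symmetric] det_mult[OF car mat_carrier, symmetric] MY HZ ..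
  moreover have "det (mat ?N ?N Y) = det (mat ?N ?N R) * jdet n G"
    unfolding jdet_def det_mult[OF mat_carrier car, symmetric] RY ..
  \<comment> \<open>The determinants of \<open>R\<close> and \<open>Z\<close> are the powers
    \<open>n\<close> and \<open>Suc n\<close> of \<open>G 0\<close>, so a single factor
    \<open>G 0\<close> remains.\<close>
  ultimately have "G 0 ^ n * (G 0 * jdet n ?H) = G 0 ^ n * (poly_subst G (jdet n F) * jdet n G)"
    by (auto simp: dM dR dZ jdet_def mult_ac)
  then show ?thesis using G0 by simp
qed

text \<open>In the fraction field this says that jdet / x_0, the factor in the pullback formula, is
  a constant times a square. The denominator \<open>b\<close> is homogeneous so that substituting a
  dominant tuple keeps it nonzero.\<close>

definition sq_jac :: "nat \<Rightarrow> 'k::field tuple \<Rightarrow> bool" where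
  "sq_jac n F \<longleftrightarrow> (\<exists>a b c e. b \<in> hom_polys n e \<and> b \<noteq> 0 \<and> jdet n F * var 0 * b ^ 2 = const c * a ^ 2)"

lemma sq_jacI:
  assumes "jdet n F * var 0 = const c * a ^ 2"
  shows "sq_jac n F"
  unfolding sq_jac_def by (rule exI[of _ a], rule exI[of _ 1], rule exI[of _ c], rule exI[of _ 0]) (simp add: assms)

lemma hom_tuples_D:
  assumes "F \<in> hom_tuples n" 
  obtains d k where "\<And>i. i \<le> n \<Longrightarrow> F i \<in> hom_polys n d" "k \<le> n" "F k \<noteq> 0"
  using assms by (auto simp: hom_tuples_def)

lemma jdet_cong:
  assumes "\<And>i. i \<le> n \<Longrightarrow> F i = G i"
  shows "jdet n F = jdet n G"
proof -
  have "jac_mat n F = jac_mat n G"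
    unfolding jac_mat_def by (rule eq_matI) (auto simp: assms less_Suc_eq_le)
  then show ?thesis by (simp add: jdet_def)
qed

text \<open>For odd \<open>n\<close> the exponent \<open>Suc n\<close> in \<open>jdet_scale\<close>
  is even, so passing between proportional tuples changes \<open>jdet\<close> only by
  squares.\<close>

lemma sq_jac_proportional:
  assumes n: "odd n" and F: "sq_jac n F" "(F, F') \<in> proportional n"
  shows "sq_jac n F'"
proof -
  obtain a b c e where b: "b \<in> hom_polys n e" "b \<noteq> 0" "jdet n F * var 0 * b ^ 2 = const c * a ^ 2"
    using F(1) by (auto simp: sq_jac_def)
  have h: "F \<in> hom_tuples n" "F' \<in> hom_tuples n" using F by (auto simp: proportional_def)
  obtain d k where k: "\<And>i. i \<le> n \<Longrightarrow> F i \<in> hom_polys n d" "k \<le> n" "F k \<noteq> 0" using h(1) by (rule hom_tuples_D) blast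
  obtain q where q: "Suc n = 2 * q" using n by (metis oddE add_Suc_right Suc_eq_plus1 mult_2 add_Suc)
  have "F k * F' i = F' k * F i" if "i \<le> n" for i
    using F(2) k that by (auto simp: proportional_def mult.commute)
  then have "jdet n (\<lambda>i. F k * F' i) = jdet n (\<lambda>i. F' k * F i)" by (intro jdet_cong)
  then have j: "F k ^ (2 * q) * jdet n F' = F' k ^ (2 * q) * jdet n F" unfolding jdet_scale q .
  have "jdet n F' * var 0 * (F k ^ q * b) ^ 2 = (F k ^ (2 * q) * jdet n F') * var 0 * b ^ 2"
    by (simp add: power_mult_distrib mult_ac flip: power_mult)
  also have "\<dots> = F' k ^ (2 * q) * (jdet n F * var 0 * b ^ 2)" unfolding j by (simp only: mult.assoc)
  also have "\<dots> = const c * (F' k ^ q * a) ^ 2"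
    unfolding b(3) by (simp add: power_mult_distrib mult_ac flip: power_mult)
  finally have "jdet n F' * var 0 * (F k ^ q * b) ^ 2 = const c * (F' k ^ q * a) ^ 2" .
  moreover have "F k ^ q * b \<in> hom_polys n (q * d + e)" using k b by (intro hom_polys_mult hom_polys_power) auto
  moreover have "F k ^ q * b \<noteq> 0" using k b by simp
  ultimately show ?thesis unfolding sq_jac_def by blast
qed

lemma dominant_subst_nonzero:
  "dominant_tuple n G \<Longrightarrow> p \<in> hom_polys n d \<Longrightarrow> p \<noteq> 0 \<Longrightarrow> poly_subst G p \<noteq> 0"
  by (auto simp: dominant_tuple_def)

text \<open>Substituting \<open>G\<close> into the identity for \<open>F\<close> turns
  \<open>var 0\<close> into \<open>G 0\<close>. Together with the \<open>G 0\<close> of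
  \<open>jdet_subst\<close> it forms a square, which joins the denominator.\<close>

lemma sq_jac_comp:
  assumes F: "F \<in> hom_tuples n" "sq_jac n F" and G: "dominant_tuple n G" "sq_jac n G"
  shows "sq_jac n (\<lambda>i. poly_subst G (F i))"
proof -
  let ?s = "poly_subst G"
  obtain a b c e where b: "b \<in> hom_polys n e" "b \<noteq> 0" "jdet n F * var 0 * b ^ 2 = const c * a ^ 2"
    using F(2) by (auto simp: sq_jac_def)
  obtain a' b' c' e' where b': "b' \<in> hom_polys n e'" "b' \<noteq> 0" "jdet n G * var 0 * b' ^ 2 = const c' * a' ^ 2"
    using G(2) by (auto simp: sq_jac_def)
  obtain d k where k: "\<And>i. i \<le> n \<Longrightarrow> F i \<in> hom_polys n d" using F(1) by (rule hom_tuples_D) blast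
  have Gt: "G \<in> hom_tuples n" using G by (simp add: dominant_tuple_def)
  obtain d' k' where k': "\<And>i. i \<le> n \<Longrightarrow> G i \<in> hom_polys n d'" using Gt by (rule hom_tuples_D) blast
  have G0: "G 0 \<noteq> 0" using dominant_subst_nonzero[OF G(1) hom_polys_var[of 0 n]] by simp
  have "?s (jdet n F * var 0 * b ^ 2) = ?s (const c * a ^ 2)" by (simp add: b)
  then have 1: "?s (jdet n F) * G 0 * ?s b ^ 2 = const c * ?s a ^ 2"
    by (simp add: poly_subst_mult poly_subst_power)
  have 2: "G 0 * jdet n (\<lambda>i. ?s (F i)) = ?s (jdet n F) * jdet n G"
    by (rule jdet_subst[of n F d G, OF k G0])
  have "jdet n (\<lambda>i. ?s (F i)) * var 0 * (G 0 * ?s b * b') ^ 2 =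
      (G 0 * jdet n (\<lambda>i. ?s (F i))) * (G 0 * ?s b ^ 2) * (var 0 * b' ^ 2)"
    by (simp add: power_mult_distrib power2_eq_square mult_ac)
  also have "\<dots> = (?s (jdet n F) * G 0 * ?s b ^ 2) * (jdet n G * var 0 * b' ^ 2)"
    unfolding 2 by (simp only: mult_ac)
  also have "\<dots> = const (c * c') * (?s a * a') ^ 2"
    unfolding 1 b'(3) const_mult by (simp add: power_mult_distrib mult_ac)
  finally have "jdet n (\<lambda>i. ?s (F i)) * var 0 * (G 0 * ?s b * b') ^ 2 = const (c * c') * (?s a * a') ^ 2" .
  moreover have "G 0 * ?s b * b' \<in> hom_polys n (d' + e * d' + e')"
    using k' b b' by (intro hom_polys_mult hom_polys_subst) auto
  moreover have "G 0 * ?s b * b' \<noteq> 0"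
    using G0 b' dominant_subst_nonzero[OF G(1) b(1,2)] by simp
  ultimately show ?thesis unfolding sq_jac_def by blast
qed

text \<open>The Jacobian matrix is the coefficient matrix \<open>C\<close> times \<open>B\<close>,
  the Jacobian matrix of the identity, whose determinant is x_0.\<close>

lemma sq_jac_linear:
  assumes "\<And>i. i \<le> n \<Longrightarrow> F i \<in> hom_polys n 1"
  shows "sq_jac n F"
proof -
  define C where "C = (\<lambda>(i, l). Poly_Mapping.lookup (F i) (Poly_Mapping.single l 1))"
  define B :: "nat \<times> nat \<Rightarrow> 'a mpoly" where "B = (\<lambda>(l, j). if j = 0 then var l else if l = j then 1 else 0)"
  let ?N = "Suc n"
  have F: "F i = (\<Sum>l<?N. const (C (i, l)) * var l)" if "i \<le> n" for i
    using hom_polys_1_expand[OF assms[OF that]] by (simp add: C_def lessThan_Suc_atMost)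
  have pd: "pd j (F i) = const (C (i, j))" if "i \<le> n" "j \<le> n" for i j
    using that unfolding F[OF that(1)] pd_sum
    by (simp add: if_distrib[of "\<lambda>x. _ * x"] cong: if_cong del: sum.lessThan_Suc)
  have "mat ?N ?N (\<lambda>x. const (C x)) * mat ?N ?N B = jac_mat n F"
    unfolding jac_mat_def
  proof (rule mat_mult_matI)
    fix i j assume ij: "i < ?N" "j < ?N"
    show "(\<Sum>k<?N. const (C (i, k)) * B (k, j)) = (\<lambda>(i, j). if j = 0 then F i else pd j (F i)) (i, j)"
      using ij F[of i] pd[of i j]
      by (simp add: B_def less_Suc_eq_le if_distrib[of "\<lambda>x. _ * x"] cong: if_cong del: sum.lessThan_Suc)
  qed
  moreover have "det (mat ?N ?N B) = var 0"
    by (subst det_lower) (auto simp: B_def prod.lessThan_Suc_shift simp del: prod.lessThan_Suc)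
  moreover have "mat ?N ?N (\<lambda>x. const (C x)) = map_mat const (mat ?N ?N C)"
    by (rule eq_matI) auto
  ultimately have "jdet n F = const (det (mat ?N ?N C)) * var 0"
    unfolding jdet_def by (metis det_mult[OF mat_carrier mat_carrier] comm_ring_hom.hom_det[OF comm_ring_hom_const])
  then show ?thesis by (intro sq_jacI[where a = "var 0"]) (simp add: power2_eq_square mult_ac)
qed

section \<open>The Jacobians of the standard involution and of \<open>xi_tuple\<close>\<close>

definition sigma_tuple :: "nat \<Rightarrow> 'k::field tuple" where
  "sigma_tuple n i = (\<Prod>j\<in>{..n} - {i}. var j)"

lemma sigma_tuple_mult_var: "i \<le> n \<Longrightarrow> sigma_tuple n i * var i = (\<Prod>j\<le>n. var j)"
  by (simp add: sigma_tuple_def prod.remove[of "{..n}" i] mult.commute)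

lemma sigma_tuple_hom: 
  assumes "i \<le> n"
  shows "sigma_tuple n i \<in> hom_polys n n"
proof -
  have "sigma_tuple n i \<in> hom_polys n (\<Sum>j\<in>{..n} - {i}. 1)"
    unfolding sigma_tuple_def by (rule hom_polys_prod) (use hom_polys_var in auto)
  then show ?thesis using assms by simp
qed

lemma sigma_tuple_nonzero [simp]: "sigma_tuple n i \<noteq> 0"
  by (simp add: sigma_tuple_def)

lemma sigma_tuple_in: "sigma_tuple n \<in> hom_tuples n"
  unfolding hom_tuples_def using sigma_tuple_hom by auto

lemma std_involution_eq: "std_involution n = cls n (sigma_tuple n :: 'k::field tuple)"
  unfolding std_involution_def
proof (rule rat_map_of_eq_cls[OF sigma_tuple_in])
  show "to_fract (sigma_tuple n i) = to_fract (\<Prod>j\<le>n. var j) * (1 / coord i :: 'k mpoly fract)"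
    if "i \<le> n" for i
    using sigma_tuple_mult_var[OF that, where ?'a = 'k]
    by (simp add: coord_def field_simps flip: to_fract_mult)
qed simp

text \<open>Multiplying the derivative columns by x_j turns the Jacobian matrix into a constant
  matrix with rows scaled by \<open>?F i\<close>. Determinants give jdet * P = c * P^n * x_0, and n
  - 1 is even.\<close>

lemma sq_jac_sigma:
  assumes n: "odd n"
  shows "sq_jac n (sigma_tuple n :: 'k::field tuple)"
proof -
  let ?N = "Suc n" and ?F = "sigma_tuple n :: 'k tuple"
  define P :: "'k mpoly" where "P = (\<Prod>j\<le>n. var j)"
  have [simp]: "P \<noteq> 0" by (simp add: P_def)
  define X :: "nat \<times> nat \<Rightarrow> 'k mpoly" where "X = (\<lambda>(i, j). if i = j then (if j = 0 then 1 else var j) else 0)"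
  define D :: "nat \<times> nat \<Rightarrow> 'k mpoly" where "D = (\<lambda>(i, j). if i = j then ?F i else 0)"
  define C :: "nat \<times> nat \<Rightarrow> 'k" where "C = (\<lambda>(i, j). if j = 0 \<or> i \<noteq> j then 1 else 0)"
  have pd: "pd j (?F i) * var j = (if i = j then 0 else ?F i)" if "i \<le> n" "j \<le> n" for i j
  proof -
    have free: "(\<Prod>l\<in>A. var l) \<in> vpolys A" if "finite A" for A
      using that by (auto simp: vpolys_def[of "{}"] intro!: finite_induct[of A "\<lambda>A. (\<Prod>l\<in>A. var l) \<in> vpolys A"])
        (metis insertI1 subset_insertI vpolys_mono subsetD vpolys_mult vpolys_var)
    show ?thesis
    proof (cases "i = j")
      case True
      then show ?thesis using pd_free[OF free[of "{..n} - {i}"], of j] by (simp add: sigma_tuple_def)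
    next
      case False
      have "?F i = var j * (\<Prod>l\<in>{..n} - {i} - {j}. var l)"
        unfolding sigma_tuple_def by (rule prod.remove) (use False that in auto)
      moreover have "pd j (\<Prod>l\<in>{..n} - {i} - {j}. var l) = (0 :: 'k mpoly)"
        using pd_free[OF free[of "{..n} - {i} - {j}"], of j] by simp
      ultimately show ?thesis using False by (simp add: mult_ac)
    qed
  qed
  have 1: "jac_mat n ?F * mat ?N ?N X = mat ?N ?N (\<lambda>(i, j). ?F i * const (C (i, j)))"
    unfolding jac_mat_def
  proof (rule mat_mult_matI)
    fix i j assume ij: "i < ?N" "j < ?N"
    show "(\<Sum>k<?N. (\<lambda>(i, j). if j = 0 then ?F i else pd j (?F i)) (i, k) * X (k, j)) =
        (\<lambda>(i, j). ?F i * const (C (i, j))) (i, j)"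
      using ij pd[of i j]
      by (simp add: X_def C_def less_Suc_eq_le if_distrib[of "\<lambda>x. _ * x"] cong: if_cong del: sum.lessThan_Suc)
  qed
  have 2: "mat ?N ?N D * mat ?N ?N (\<lambda>x. const (C x)) = mat ?N ?N (\<lambda>(i, j). ?F i * const (C (i, j)))"
    by (rule mat_mult_matI)
      (simp add: D_def less_Suc_eq_le if_distrib[of "\<lambda>x. x * _"] cong: if_cong del: sum.lessThan_Suc)
  have C: "mat ?N ?N (\<lambda>x. const (C x)) = map_mat const (mat ?N ?N C)"
    by (rule eq_matI) auto
  define c where "c = det (mat ?N ?N C)"
  have dX: "det (mat ?N ?N X) * var 0 = P"
  proof -
    have "det (mat ?N ?N X) = (\<Prod>k<n. var (Suc k))"
      by (subst det_lower) (auto simp: X_def prod.lessThan_Suc_shift simp del: prod.lessThan_Suc)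
    moreover have "P = var 0 * (\<Prod>k<n. var (Suc k))"
      unfolding P_def by (simp add: prod.atMost_shift)
    ultimately show ?thesis by (simp add: mult.commute)
  qed
  have dD: "det (mat ?N ?N D) = P ^ n"
  proof -
    have "det (mat ?N ?N D) = (\<Prod>k\<le>n. ?F k)"
      by (subst det_lower) (auto simp: D_def lessThan_Suc_atMost simp del: prod.lessThan_Suc)
    moreover have "(\<Prod>k\<le>n. ?F k) * P = (\<Prod>k\<le>n. P)"
      unfolding P_def prod.distrib[symmetric] by (rule prod.cong) (auto simp: sigma_tuple_mult_var)
    ultimately have "det (mat ?N ?N D) * P = P ^ n * P" by simp
    then show ?thesis by simp
  qed
  have "jdet n ?F * det (mat ?N ?N X) = det (mat ?N ?N D) * const c"
    unfolding jdet_def c_def comm_ring_hom.hom_det[OF comm_ring_hom_const, symmetric] C[symmetric]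
    using det_mult[of "jac_mat n ?F" ?N "mat ?N ?N X"] det_mult[of "mat ?N ?N D" ?N "mat ?N ?N (\<lambda>x. const (C x))"]
    by (simp add: 1 2) (simp add: jac_mat_def)
  then have "jdet n ?F * (det (mat ?N ?N X) * var 0) = P ^ n * const c * var 0"
    by (simp add: dD flip: mult.assoc)
  moreover obtain q where q: "n = Suc (2 * q)" using n by (metis oddE Suc_eq_plus1)
  ultimately have "P * jdet n ?F = P * (P ^ (2 * q) * const c * var 0)"
    unfolding dX by (simp add: mult_ac)
  then have "jdet n ?F = P ^ (2 * q) * const c * var 0" by simp
  then show ?thesis
    unfolding power_even_eq
    by (intro sq_jacI[where a = "P ^ q * var 0" and c = c]) (simp add: power2_eq_square mult_ac)
qed

definition xi_tuple :: "'k::field tuple" where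
  "xi_tuple i = (if i = 2 then var 1 * var 2 else var 0 * var i)"

text \<open>The Jacobian contains x_1 to the first power, so its product with a square has odd
  degree in x_1, whereas a nonzero constant times a square has even degree.\<close>

lemma not_sq_jac_xi:
  assumes n: "odd n" "n \<ge> 2"
  shows "\<not> sq_jac n (xi_tuple :: 'k::field tuple)"
proof
  let ?N = "Suc n" and ?d = "\<lambda>p. degree (as_upoly 1 p)"
  assume "sq_jac n (xi_tuple :: 'k tuple)"
  then obtain a b :: "'k mpoly" and c where b: "b \<noteq> 0" "jdet n xi_tuple * var 0 * b ^ 2 = const c * a ^ 2"
    unfolding sq_jac_def by blast
  have pd: "pd j (xi_tuple i) = (if i = 2 then (if j = 2 then var 1 else if j = 1 then var 2 else 0)
     else if i = j then (if j = 0 then 2 * var 0 else var 0) else if j = 0 then var i else 0)" for i j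
    by (auto simp: xi_tuple_def)
  have "jdet n xi_tuple = (\<Prod>i<?N. if i = 0 then var 0 ^ 2 else if i = 2 then var 1 else (var 0 :: 'k mpoly))"
    \<comment> \<open>Outside column 0 the only nonzero off-diagonal entry is in row 2 and column 1,
      below the diagonal.\<close>
    unfolding jdet_def jac_mat_def
    by (subst det_lower) (auto simp: pd xi_tuple_def power2_eq_square simp del: prod.lessThan_Suc intro!: prod.cong)
  also have "\<dots> = var 0 ^ 2 * (\<Prod>i<n. if i = 1 then var 1 else (var 0 :: 'k mpoly))"
    by (subst prod.lessThan_Suc_shift) (auto simp: numeral_2_eq_2 intro!: prod.cong)
  also have "(\<Prod>i<n. if i = 1 then var 1 else (var 0 :: 'k mpoly)) = var 1 * (\<Prod>i\<in>{..<n} - {1}. var 0)"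
    by (subst prod.remove[of _ 1]) (use n in auto)
  finally have j: "jdet n xi_tuple = var 0 ^ 2 * (var 1 * var 0 ^ (n - 1) :: 'k mpoly)"
    using n by simp
  have nz: "jdet n xi_tuple * var 0 * b ^ 2 \<noteq> 0" using b(1) by (simp add: j)
  have "const c * a ^ 2 \<noteq> 0" using nz unfolding b(2) .
  then have "c \<noteq> 0" "a \<noteq> 0" by auto
  then have "?d (const c * a ^ 2) = 2 * ?d a"
    by (simp add: degree_mult_eq degree_power_eq)
  moreover have "?d (jdet n xi_tuple * var 0 * b ^ 2) = 1 + 2 * ?d b"
    using b(1) by (simp add: j degree_mult_eq degree_power_eq)
  ultimately show False using b(2) by (metis even_add even_mult_iff even_numeral odd_one)
qed

lemma xi_map_eq:
  assumes n: "n \<ge> 2"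
  shows "(xi_tuple :: 'k::field tuple) \<in> hom_tuples n" "xi_map n = cls n (xi_tuple :: 'k tuple)"
proof -
  have h: "(xi_tuple :: 'k tuple) i \<in> hom_polys n (1 + 1)" if "i \<le> n" for i
    using n hom_polys_mult[OF hom_polys_var[of 1 n, where ?'a = 'k] hom_polys_var[of 2 n]]
      hom_polys_mult[OF hom_polys_var[of 0 n, where ?'a = 'k] hom_polys_var[OF that]] by (simp add: xi_tuple_def)
  have "(xi_tuple :: 'k tuple) 0 \<noteq> 0" by (simp add: xi_tuple_def)
  then show t: "(xi_tuple :: 'k tuple) \<in> hom_tuples n" unfolding hom_tuples_def using h by blast
  show "xi_map n = cls n (xi_tuple :: 'k tuple)"
    unfolding xi_map_def
    by (rule rat_map_of_eq_cls[OF t, where c = "coord 0"])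
      (auto simp: xi_tuple_def coord_def field_simps)
qed

section \<open>The obstruction for odd \<open>n\<close>\<close>

lemma rat_comp_eq_idD:
  assumes "\<phi> \<in> carrier (Bir_proj n)" "\<psi> \<in> carrier (Bir_proj n)" "rat_comp n \<psi> \<phi> = rat_id n"
  shows "inv\<^bsub>Bir_proj n\<^esub> \<phi> = \<psi>"
  by (rule group.inv_equality[OF group_Bir_proj]) (use assms in \<open>simp_all add: Bir_proj_def\<close>)

lemma sigma_dominant: "dominant_tuple n (sigma_tuple n)"
  using Bir_proj_dominant[OF _ sigma_tuple_in] std_involution_Bir std_involution_eq by metis

lemma std_involution_square: "rat_comp n (std_involution n) (std_involution n) = (rat_id n :: 'k::field rat_map)"
proof -
  let ?F = "sigma_tuple n :: 'k tuple"
  have t: "(\<lambda>i. poly_subst ?F (?F i)) \<in> hom_tuples n"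
    using dominant_comp[OF sigma_tuple_in sigma_dominant] .
  have e: "poly_subst ?F (?F i) * ?F i = (\<Prod>j\<le>n. ?F j)" if "i \<le> n" for i
    using arg_cong[OF sigma_tuple_mult_var[OF that], of "poly_subst ?F"]
    by (simp add: poly_subst_mult poly_subst_prod)
  have "poly_subst ?F (?F i) * var j = poly_subst ?F (?F j) * var i" if ij: "i \<le> n" "j \<le> n" for i j
  proof -
    have "(?F i * ?F j) * (poly_subst ?F (?F i) * var j) = (poly_subst ?F (?F i) * ?F i) * (?F j * var j)"
      by (simp add: mult_ac)
    also have "\<dots> = (poly_subst ?F (?F j) * ?F j) * (?F i * var i)"
      by (simp add: e ij sigma_tuple_mult_var)
    also have "\<dots> = (?F i * ?F j) * (poly_subst ?F (?F j) * var i)"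
      by (simp add: mult_ac)
    finally show ?thesis by simp
  qed
  then have "(\<lambda>i. poly_subst ?F (?F i), var) \<in> proportional n"
    using t var_tuple by (auto simp: proportional_def)
  then show ?thesis
    unfolding std_involution_eq rat_id_eq rat_comp_dominant[OF sigma_tuple_in sigma_dominant]
    using cls_eq_iff[OF t var_tuple] by simp
qed

lemma G_proj_sq_jac:
  assumes n: "odd n" and \<phi>: "\<phi> \<in> G_proj n"
  shows "\<exists>F. dominant_tuple n F \<and> sq_jac n F \<and> \<phi> = cls n (F :: 'k::field tuple)"
proof -
  have gen: "\<exists>F. dominant_tuple n F \<and> sq_jac n F \<and> \<chi> = cls n F"
    if "\<chi> \<in> {std_involution n} \<union> Aut_proj n" for \<chi> :: "'k rat_map"
    using that
  proof (elim UnE)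
    assume "\<chi> \<in> {std_involution n}"
    then show ?thesis using sigma_dominant sq_jac_sigma[OF n] std_involution_eq by blast
  next
    assume a: "\<chi> \<in> Aut_proj n"
    have n1: "n \<ge> 1" using n by (cases n) auto
    obtain F where "dominant_tuple n F" "\<chi> = cls n F" "\<And>i. i \<le> n \<Longrightarrow> F i \<in> hom_polys n 1"
      by (rule Aut_proj_linear[OF n1 a]) blast
    then show ?thesis using sq_jac_linear by blast
  qed
  show ?thesis
    using \<phi> unfolding G_proj_def
  proof (induction rule: generate.induct)
    case one
    have "sq_jac n (var :: 'k tuple)" by (intro sq_jac_linear hom_polys_var)
    then show ?case using dominant_var rat_id_eq by (auto simp: Bir_proj_def)
  next
    case (incl h)
    then show ?case by (rule gen)
  next
    case (inv h)
    \<comment> \<open>The set of generators is closed under inversion: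
      \<open>std_involution n\<close> is its own inverse, and \<open>Aut_proj n\<close> is symmetric
      in a map and its inverse.\<close>
    then have "inv\<^bsub>Bir_proj n\<^esub> h \<in> {std_involution n} \<union> Aut_proj n"
    proof (elim UnE)
      assume "h \<in> {std_involution n}"
      then show ?thesis
        using rat_comp_eq_idD[OF std_involution_Bir std_involution_Bir std_involution_square] by auto
    next
      assume h: "h \<in> Aut_proj n"
      then obtain \<psi> where \<psi>: "\<psi> \<in> proj_morphisms n" "rat_comp n h \<psi> = rat_id n" "rat_comp n \<psi> h = rat_id n"
        by (auto simp: Aut_proj_def)
      then have "\<psi> \<in> Aut_proj n" using h by (auto simp: Aut_proj_def)
      moreover from this have "inv\<^bsub>Bir_proj n\<^esub> h = \<psi>"
        using rat_comp_eq_idD[OF _ _ \<psi>(3)] h Aut_proj_subset by blast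
      ultimately show ?thesis by simp
    qed
    then show ?case by (rule gen)
  next
    case (eng h1 h2)
    then obtain F1 F2 where F: "dominant_tuple n F1" "sq_jac n F1" "h1 = cls n F1"
      "dominant_tuple n F2" "sq_jac n F2" "h2 = cls n F2" by blast
    have t: "F1 \<in> hom_tuples n" using F by (simp add: dominant_tuple_def)
    have "h1 \<otimes>\<^bsub>Bir_proj n\<^esub> h2 = cls n (\<lambda>i. poly_subst F2 (F1 i))"
      using rat_comp_dominant[OF t F(4)] F by (simp add: Bir_proj_def)
    then show ?case using sq_jac_comp[OF t F(2,4,5)] dominant_comp_dominant F by blast
  qed
qed

lemma xi_map_notin_G_proj:
  assumes n: "odd n" "n \<ge> 2"
  shows "(xi_map n :: 'k::field rat_map) \<notin> G_proj n"
proof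
  assume "(xi_map n :: 'k rat_map) \<in> G_proj n"
  then obtain F :: "'k tuple" where F: "dominant_tuple n F" "sq_jac n F" "cls n xi_tuple = cls n F"
    using G_proj_sq_jac[OF n(1)] xi_map_eq(2)[OF n(2)] by metis
  have "F \<in> hom_tuples n" using F by (simp add: dominant_tuple_def)
  then have "(F, xi_tuple) \<in> proportional n" using F(3) xi_map_eq(1)[OF n(2)] cls_eq_iff by metis
  then show False using sq_jac_proportional[OF n(1) F(2)] not_sq_jac_xi[OF n] by blast
qed

section \<open>Elements of the group\<close>

definition in_G :: "nat \<Rightarrow> 'k::field tuple \<Rightarrow> bool" where
  "in_G n F \<longleftrightarrow> F \<in> hom_tuples n \<and> cls n F \<in> G_proj n"

lemma poly_subst_uminus: "poly_subst G (- p) = - poly_subst G p"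
  using poly_subst_add[of G p "- p"] by (simp add: eq_neg_iff_add_eq_0 add.commute)

lemma poly_subst_diff: "poly_subst G (p - q) = poly_subst G p - poly_subst G q"
  using poly_subst_add[of G p "- q"] by (simp add: poly_subst_uminus)

lemma var_eq_iff [simp]: "var i = (var j :: 'k::field mpoly) \<longleftrightarrow> i = j"
proof
  assume "var i = (var j :: 'k mpoly)"
  then have "poly_subst (\<lambda>l. if l = i then 1 else 0) (var i) = poly_subst (\<lambda>l. if l = i then 1 else 0) (var j :: 'k mpoly)"
    by simp
  then show "i = j" by (simp split: if_splits)
qed simp

lemma hom_polys_diff: "p \<in> hom_polys n d \<Longrightarrow> q \<in> hom_polys n d \<Longrightarrow> p - q \<in> hom_polys n d"
  using hom_polys_add[of p n d "- q"] by (simp add: hom_polys_def polys_def)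

lemma G_proj_subset: "G_proj n \<subseteq> carrier (Bir_proj n)"
  unfolding G_proj_def
  by (rule group.generate_incl[OF group_Bir_proj]) (use std_involution_Bir Aut_proj_subset in auto)

lemma in_G_dominant: "in_G n F \<Longrightarrow> dominant_tuple n F"
  using Bir_proj_dominant G_proj_subset by (auto simp: in_G_def)

lemma in_G_sigma: "in_G n (sigma_tuple n)"
  unfolding in_G_def G_proj_def
  using sigma_tuple_in std_involution_eq by (metis UnI1 generate.incl singletonI)

lemma hom_tuples_cancel:
  assumes K: "K \<in> hom_tuples n" and r: "\<And>i. i \<le> n \<Longrightarrow> K i = r * H i"
  shows "H \<in> hom_tuples n"
proof -
  obtain d k where d: "\<And>i. i \<le> n \<Longrightarrow> K i \<in> hom_polys n d" "k \<le> n" "K k \<noteq> 0"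
    using K by (rule hom_tuples_D) blast
  have nz: "r \<noteq> 0" "H k \<noteq> 0" using r[of k] d by auto
  have "H i \<in> hom_polys n (d - tdeg r)" if i: "i \<le> n" for i
  proof (cases "H i = 0")
    case False
    have "H i * r \<in> hom_polys n d" "H i * r \<noteq> 0" using d(1)[OF i] r[OF i] False nz by (simp_all add: mult.commute)
    then have "H i \<in> hom_polys n (tdeg (H i))" "d = tdeg (H i) + tdeg r"
      using hom_polys_factor[of "H i" r n d] tdeg_mult[OF False nz(1)] tdeg_hom[of "H i * r" n d] by auto
    then show ?thesis by simp
  qed simp
  then show ?thesis using nz d(2) unfolding hom_tuples_def by blast
qed

lemma in_G_cancel:
  assumes K: "in_G n K" and r: "\<And>i. i \<le> n \<Longrightarrow> K i = r * H i"
  shows "in_G n H"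
proof -
  have h: "K \<in> hom_tuples n" "H \<in> hom_tuples n" using K hom_tuples_cancel r by (auto simp: in_G_def)
  then have "(K, H) \<in> proportional n" by (auto simp: proportional_def r mult_ac)
  then have "cls n K = cls n H" using h cls_eq_iff by blast
  then show ?thesis using K h by (simp add: in_G_def)
qed

text \<open>The factor \<open>r\<close> absorbs what the substitution leaves in common, so
  membership of \<open>H\<close> reduces to polynomial identities.\<close>

lemma in_G_comp:
  assumes F: "in_G n F" and G: "in_G n G" and r: "\<And>i. i \<le> n \<Longrightarrow> poly_subst G (F i) = r * H i"
  shows "in_G n H"
proof (rule in_G_cancel)
  have t: "F \<in> hom_tuples n" using F by (simp add: in_G_def)
  have "cls n F \<otimes>\<^bsub>Bir_proj n\<^esub> cls n G = cls n (\<lambda>i. poly_subst G (F i))"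
    using rat_comp_dominant[OF t in_G_dominant[OF G]] by (simp add: Bir_proj_def)
  moreover have "cls n F \<otimes>\<^bsub>Bir_proj n\<^esub> cls n G \<in> G_proj n"
    using F G unfolding in_G_def G_proj_def by (blast intro: generate.eng)
  ultimately show "in_G n (\<lambda>i. poly_subst G (F i))"
    using dominant_comp[OF t in_G_dominant[OF G]] by (simp add: in_G_def)
qed (rule r)

text \<open>The hypothesis says that \<open>H\<close> is proportional to the inverses of the entries
  of \<open>A\<close>, that is, to the standard involution after \<open>A\<close>.\<close>

lemma in_G_sigma_left:
  assumes A: "in_G n A" and H: "H \<in> hom_tuples n" and q: "\<And>l. l \<le> n \<Longrightarrow> A l * H l = q" "q \<noteq> 0"
  shows "in_G n H"
proof -
  let ?S = "\<lambda>i. poly_subst A (sigma_tuple n i)"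
  define Q where "Q = (\<Prod>l\<le>n. A l)"
  have S: "in_G n ?S" by (rule in_G_comp[OF in_G_sigma A, where r = 1]) simp
  have SA: "?S l * A l = Q" if "l \<le> n" for l
    using arg_cong[OF sigma_tuple_mult_var[OF that], of "poly_subst A"]
    by (simp add: poly_subst_mult poly_subst_prod Q_def)
  have qS: "q * ?S l = Q * H l" if "l \<le> n" for l
  proof -
    have "q * ?S l = (?S l * A l) * H l" unfolding q(1)[OF that, symmetric] by (simp add: mult_ac)
    then show ?thesis by (simp add: SA[OF that])
  qed
  have "?S i * H j = ?S j * H i" if "i \<le> n" "j \<le> n" for i j
  proof -
    have "q * (?S i * H j) = (q * ?S i) * H j" by (simp only: mult.assoc)
    also have "\<dots> = (q * ?S j) * H i" unfolding qS[OF that(1)] qS[OF that(2)] by (simp only: mult_ac)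
    finally show ?thesis using mult_left_cancel[OF q(2)] by (simp only: mult.assoc)
  qed
  then have "(?S, H) \<in> proportional n" using S H by (auto simp: proportional_def in_G_def)
  then have "cls n ?S = cls n H" using S H cls_eq_iff by (auto simp: in_G_def)
  then show ?thesis using S H by (simp add: in_G_def)
qed

section \<open>Linear automorphisms\<close>

lemma ideal_subst_linear:
  assumes P: "ideal P (poly_ring n)" and F: "\<And>i. i \<le> n \<Longrightarrow> F i \<in> P"
    and p: "p \<in> hom_polys n 1"
  shows "poly_subst F p \<in> P"
proof -
  have P0: "0 \<in> P" "\<And>x y. x \<in> P \<Longrightarrow> y \<in> P \<Longrightarrow> x + y \<in> P"
    using additive_subgroup.zero_closed[OF ideal.axioms(1)[OF P]]
      additive_subgroup.a_closed[OF ideal.axioms(1)[OF P]] by (auto simp: poly_ring_def)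
  have C: "const c * F l \<in> P" if "l \<le> n" for c l
    using ideal.I_l_closed[OF P F[OF that], of "const c"] by (simp add: poly_ring_def)
  have "(\<Sum>l\<in>A. const (c l) * F l) \<in> P" if "finite A" "A \<subseteq> {..n}" for A c
    using that by (induction A rule: finite_induct) (auto simp: P0 C)
  moreover have "poly_subst F p = (\<Sum>l\<le>n. const (Poly_Mapping.lookup p (Poly_Mapping.single l 1)) * F l)"
    using arg_cong[OF hom_polys_1_expand[OF p], of "poly_subst F"]
    by (simp add: poly_subst_sum poly_subst_mult)
  ultimately show ?thesis by simp
qed

text \<open>If all \<open>F i\<close> lay in a point \<open>P\<close>, so would the linear
  combinations \<open>poly_subst F (G i) = var i\<close>, and a point does not contain all
  variables.\<close>

lemma linear_morphism:
  assumes F: "\<And>i. i \<le> n \<Longrightarrow> F i \<in> hom_polys n 1" and G: "\<And>i. i \<le> n \<Longrightarrow> G i \<in> hom_polys n 1"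
    and FG: "\<And>i. i \<le> n \<Longrightarrow> poly_subst F (G i) = var i"
  shows "F \<in> hom_tuples n" "cls n F \<in> proj_morphisms n"
proof -
  have "\<exists>i\<le>n. F i \<noteq> 0"
  proof (rule ccontr)
    assume "\<not> ?thesis"
    then have "poly_subst F (G 0) = poly_subst (\<lambda>i. 0 * var i) (G 0)"
      using G[of 0] by (intro poly_subst_cong[of _ n]) (auto dest: hom_polysD)
    also have "\<dots> = 0" using poly_subst_scale[OF G[of 0], of 0 var] by simp
    finally show False using FG[of 0] by simp
  qed
  then show t: "F \<in> hom_tuples n" using F by (auto simp: hom_tuples_def)
  have "defined_at n (cls n F) P" if P: "P \<in> proj_points n" for P
  proof (rule ccontr)
    assume "\<not> ?thesis"
    then have "F i \<in> P" if "i \<le> n" for i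
      using that proportional_refl[OF t] by (auto simp: defined_at_def)
    moreover have "ideal P (poly_ring n)" using P by (auto simp: proj_points_def primeideal_def)
    ultimately have "var ` {..n} \<subseteq> P" using ideal_subst_linear G FG by (metis atMost_iff image_subsetI)
    then show False using P by (simp add: proj_points_def)
  qed
  then show "cls n F \<in> proj_morphisms n" using t cls_rat_map by (simp add: proj_morphisms_def)
qed

lemma in_G_linear:
  assumes F: "\<And>i. i \<le> n \<Longrightarrow> F i \<in> hom_polys n 1" and G: "\<And>i. i \<le> n \<Longrightarrow> G i \<in> hom_polys n 1"
    and FG: "\<And>i. i \<le> n \<Longrightarrow> poly_subst F (G i) = var i" and GF: "\<And>i. i \<le> n \<Longrightarrow> poly_subst G (F i) = var i"
  shows "in_G n F"
proof -
  note t = linear_morphism(1)[of n, OF F G FG] linear_morphism(1)[of n, OF G F GF]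
  have h: "(\<lambda>i. poly_subst F (G i)) \<in> hom_tuples n" "(\<lambda>i. poly_subst G (F i)) \<in> hom_tuples n"
    using FG GF var_tuple[of n] unfolding hom_tuples_def by auto
  have "((\<lambda>i. poly_subst F (G i)), var) \<in> proportional n" "((\<lambda>i. poly_subst G (F i)), var) \<in> proportional n"
    using FG GF var_tuple[of n] h by (auto simp: proportional_def mult_ac)
  then have "rat_comp n (cls n G) (cls n F) = rat_id n" "rat_comp n (cls n F) (cls n G) = rat_id n"
    using rat_comp_classes[OF t(2,1) h(1)] rat_comp_classes[OF t h(2)] h var_tuple cls_eq_iff rat_id_eq by metis+
  then have "cls n F \<in> Aut_proj n"
    using linear_morphism(2)[of n, OF F G FG] linear_morphism(2)[of n, OF G F GF] by (auto simp: Aut_proj_def)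
  then show ?thesis using t unfolding in_G_def G_proj_def by (blast intro: generate.incl)
qed

definition lin2 :: "nat \<Rightarrow> nat \<Rightarrow> 'k \<Rightarrow> 'k \<Rightarrow> 'k \<Rightarrow> 'k \<Rightarrow> 'k::field tuple" where
  "lin2 i j a b c d l = (if l = i then const a * var i + const b * var j
     else if l = j then const c * var i + const d * var j else var l)"

lemma hom_polys_const_mult: "p \<in> hom_polys n d \<Longrightarrow> const c * p \<in> hom_polys n d"
  using hom_polys_mult[OF hom_polys_const] by fastforce

lemma in_G_lin2:
  assumes ij: "i \<le> n" "j \<le> n" "i \<noteq> j" and D: "a * d - b * c \<noteq> 0"
  shows "in_G n (lin2 i j a b c d :: 'k::field tuple)"
proof -
  let ?D = "a * d - b * c"
  have h: "lin2 i j a b c d l \<in> hom_polys n 1" if "l \<le> n" for l and a b c d :: 'k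
    unfolding lin2_def using that ij by (auto intro!: hom_polys_add hom_polys_const_mult hom_polys_var[simplified])
  have inv: "poly_subst (lin2 i j a b c d) (lin2 i j (d / e) (- b / e) (- c / e) (a / e) l) = var l"
    if e: "e = a * d - b * c" "e \<noteq> 0" for a b c d e :: 'k and l
  proof -
    have 1: "d / e * a - b / e * c = 1" "d / e * b = b / e * d" "a / e * d - c / e * b = 1" "c / e * a = a / e * c"
      using e by (simp_all add: field_simps)
    have "const (d / e) * (const a * var i + const b * var j) + const (- b / e) * (const c * var i + const d * var j)
      = const (d / e * a - b / e * c) * var i + const (d / e * b - b / e * d) * (var j :: 'k mpoly)"
      "const (- c / e) * (const a * var i + const b * var j) + const (a / e) * (const c * var i + const d * var j)
      = const (a / e * c - c / e * a) * var i + const (a / e * d - c / e * b) * (var j :: 'k mpoly)"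
      unfolding diff_conv_add_uminus const_add const_mult const_uminus
      by (simp_all add: algebra_simps const_uminus flip: const_mult)
    then have "const (d / e) * (const a * var i + const b * var j) + const (- b / e) * (const c * var i + const d * var j)
      = (var i :: 'k mpoly)"
      "const (- c / e) * (const a * var i + const b * var j) + const (a / e) * (const c * var i + const d * var j)
      = (var j :: 'k mpoly)"
      unfolding 1 by simp_all
    then show ?thesis using ij(3) by (simp add: lin2_def poly_subst_add poly_subst_mult)
  qed
  \<comment> \<open>This is \<open>inv\<close> applied to the inverse matrix, whose determinant is
    \<open>1 / E\<close> and whose inverse is the original matrix.\<close>
  have "poly_subst (lin2 i j (d / ?D) (- b / ?D) (- c / ?D) (a / ?D)) (lin2 i j a b c d l) = var l" for l
  proof -
    define E where "E = ?D"
    have "E \<noteq> 0" using D by (simp add: E_def)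
    have "d / E * (a / E) - (- b / E) * (- c / E) = (a * d - b * c) / (E * E)"
      by (simp add: diff_divide_distrib mult.commute)
    also have "\<dots> = 1 / E" using \<open>E \<noteq> 0\<close> by (simp flip: E_def)
    finally have "1 / E = d / E * (a / E) - (- b / E) * (- c / E)" by simp
    from inv[OF this, of l] \<open>E \<noteq> 0\<close> show ?thesis by (simp flip: E_def)
  qed
  then show ?thesis using in_G_linear[of n "lin2 i j a b c d" "lin2 i j (d / ?D) (- b / ?D) (- c / ?D) (a / ?D)"] h inv[OF refl D]
    by blast
qed

section \<open>Reflections x_c \<mapsto> f^2 / x_c, with the denominator \<open>var c\<close>
  cleared\<close>

definition refl_tuple :: "nat \<Rightarrow> 'k mpoly \<Rightarrow> 'k::field tuple" where
  "refl_tuple c f l = (if l = c then f ^ 2 else var l * var c)"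

text \<open>The involution \<open>x\<^sub>i \<mapsto> x\<^sub>j\<^sup>2 / x\<^sub>i\<close> is linearly equivalent to the conjugate by the standard
  involution of the linear map \<open>(x\<^sub>i, x\<^sub>j) \<mapsto> (x\<^sub>j, x\<^sub>i - x\<^sub>j)\<close>.\<close>

lemma in_G_refl_var:
  assumes ij: "i \<le> n" "j \<le> n" "i \<noteq> j"
  shows "in_G n (refl_tuple i (var j :: 'k::field mpoly))"
proof -
  let ?s = "sigma_tuple n :: 'k tuple"
  define A where "A l = poly_subst ?s (lin2 i j 0 1 1 (- 1) l)" for l
  \<comment> \<open>These are the inverses of the entries of \<open>A\<close>, multiplied by the
    product of all variables and by \<open>var j - var i\<close>.\<close>
  define N :: "'k tuple" where "N l = (if l = j then var i else var j - var i) * (if l = i then var j else var l)" for l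
  have v1: "const (- 1 :: 'k) = - 1" by (simp add: single_uminus)
  have A: "in_G n A"
    by (rule in_G_comp[OF in_G_lin2[OF ij, of 0 "- 1" 1 1] in_G_sigma, where r = 1]) (simp_all add: A_def)
  have Ai: "A l = (if l = i then ?s j else if l = j then ?s i - ?s j else ?s l)" for l
    using ij(3) by (simp add: A_def lin2_def poly_subst_add poly_subst_mult v1 poly_subst_uminus poly_subst_diff)
  have "N l \<in> hom_polys n (1 + 1)" if "l \<le> n" for l
    unfolding N_def using ij that by (intro hom_polys_mult) (auto intro: hom_polys_diff hom_polys_var[simplified])
  moreover have "N j \<noteq> 0" by (simp add: N_def)
  ultimately have N: "N \<in> hom_tuples n" unfolding hom_tuples_def using ij by blast
  have "in_G n N"
  proof (rule in_G_sigma_left[OF A N])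
    fix l assume l: "l \<le> n"
    show "A l * N l = (\<Prod>j\<le>n. var j) * (var j - var i)"
    proof -
      have s: "?s l * var l = (\<Prod>j\<le>n. var j)" if "l \<le> n" for l
        using that by (rule sigma_tuple_mult_var)
      have "(?s i - ?s j) * (var i * var j) = (?s i * var i) * var j - (?s j * var j) * var i"
        by (simp add: algebra_simps)
      moreover have "?s k * ((var j - var i) * var k) = (?s k * var k) * (var j - var i)" for k
        by (simp add: mult_ac)
      ultimately show ?thesis using s[OF l] s[OF ij(1)] s[OF ij(2)] ij(3)
        by (simp add: Ai N_def right_diff_distrib)
    qed
  qed (use ij(3) in simp)
  \<comment> \<open>Substituting x_j - x_i for x_i makes the common factor x_i. Adding entry j to
    entry i then leaves x_j^2 there, and the old entry i, x_i x_j, moves to position j.\<close>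
  then have "in_G n (\<lambda>l. if l = j then (var j - var i) * var j else var i * (if l = i then var j else var l) :: 'k mpoly)" (is "in_G n ?N'")
    by (rule in_G_comp[OF _ in_G_lin2[OF ij, of "- 1" 1 1 0], where r = 1])
      (use ij(3) in \<open>auto simp: N_def lin2_def poly_subst_mult poly_subst_diff v1\<close>)
  from in_G_comp[OF in_G_lin2[OF ij, of 1 0 1 1] this, where r = 1 and H = "refl_tuple i (var j)"]
  show ?thesis using ij(3)
    by (auto simp: refl_tuple_def lin2_def poly_subst_mult poly_subst_add power2_eq_square algebra_simps)
qed


text \<open>The reflection with \<open>f = var b\<close> is conjugated by the transvection x_b
  \<mapsto> x_b + s x_a.\<close>

lemma in_G_refl:
  assumes "{a, b, c} \<subseteq> {..n}" "distinct [a, b, c]"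
  shows "in_G n (refl_tuple c (var b + const s * var a :: 'k::field mpoly))"
proof -
  have ba: "b \<le> n" "a \<le> n" "b \<noteq> a" and cb: "c \<le> n" "b \<le> n" "c \<noteq> b" using assms by auto
  have "in_G n (\<lambda>l. (if l = b then var b + const s * var a else if l = c then (var b + const s * var a) ^ 2 else var l) * (if l = c then 1 else var c) :: 'k mpoly)"
    (is "in_G n ?H")
    by (rule in_G_comp[OF in_G_refl_var[OF cb] in_G_lin2[OF ba, of 1 1 s 0], where r = 1])
      (use assms in \<open>auto simp: refl_tuple_def lin2_def poly_subst_mult poly_subst_power\<close>)
  note H = this
  show ?thesis
    by (rule in_G_comp[OF in_G_lin2[OF ba, of 1 1 "- s" 0] H, where r = 1])
      (use assms in \<open>auto simp: refl_tuple_def lin2_def poly_subst_mult poly_subst_add poly_subst_diff const_uminus algebra_simps\<close>)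
qed

text \<open>The matrix \<open>(\<alpha>, \<beta>; \<gamma>, \<delta>) / q\<close> acting on \<open>(x\<^sub>c, x\<^sub>d)\<close>; its entries will be forms in two other coordinates.\<close>

definition blk :: "nat \<Rightarrow> nat \<Rightarrow> 'k mpoly \<Rightarrow> 'k mpoly \<Rightarrow> 'k mpoly \<Rightarrow> 'k mpoly \<Rightarrow> 'k mpoly \<Rightarrow> 'k::field tuple" where
  "blk c d q \<alpha> \<beta> \<gamma> \<delta> l = (if l = c then \<alpha> * var c + \<beta> * var d
     else if l = d then \<gamma> * var c + \<delta> * var d else q * var l)"

text \<open>\<open>scales a b e p\<close> holds for the forms \<open>p\<close> of degree \<open>e\<close> in \<open>x\<^sub>a\<close> and \<open>x\<^sub>b\<close>.\<close>

definition scales :: "nat \<Rightarrow> nat \<Rightarrow> nat \<Rightarrow> 'k::field mpoly \<Rightarrow> bool" where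
  "scales a b e p \<longleftrightarrow> (\<forall>G q. G a = q * var a \<longrightarrow> G b = q * var b \<longrightarrow> poly_subst G p = q ^ e * p)"

section \<open>Calculus of two-by-two blocks\<close>

lemma scales_0 [simp]: "scales a b e 0" and scales_1 [simp]: "scales a b 0 1"
  and scales_const [simp]: "scales a b 0 (const s)"
  and scales_var [simp]: "scales a b 1 (var a)" "scales a b 1 (var b)"
  by (simp_all add: scales_def)

lemmas [simp] = scales_var [unfolded One_nat_def]

lemma scales_add: "scales a b e p \<Longrightarrow> scales a b e q \<Longrightarrow> scales a b e (p + q)"
  by (simp add: scales_def poly_subst_add distrib_left)

lemma scales_mult: "scales a b e p \<Longrightarrow> scales a b f q \<Longrightarrow> scales a b (e + f) (p * q)"
  by (simp add: scales_def poly_subst_mult power_add mult_ac)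

lemma scales_uminus: "scales a b e p \<Longrightarrow> scales a b e (- p)"
  by (simp add: scales_def poly_subst_uminus)

text \<open>The second block multiplies x_a and x_b by \<open>q'\<close>, so the entries of the
  first only pick up the common factor \<open>q' ^ e\<close>. What remains is the ordinary matrix
  product.\<close>

lemma in_G_blk_comp:
  assumes F: "in_G n (blk c d q \<alpha> \<beta> \<gamma> \<delta>)" and G: "in_G n (blk c d q' \<alpha>' \<beta>' \<gamma>' \<delta>')"
    and abcd: "distinct [a, b, c, d]"
    and e: "scales a b e q" "scales a b e \<alpha>" "scales a b e \<beta>" "scales a b e \<gamma>" "scales a b e \<delta>"
  shows "in_G n (blk c d (q * q') (\<alpha> * \<alpha>' + \<beta> * \<gamma>') (\<alpha> * \<beta>' + \<beta> * \<delta>') (\<gamma> * \<alpha>' + \<delta> * \<gamma>') (\<gamma> * \<beta>' + \<delta> * \<delta>'))"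
proof (rule in_G_comp[OF F G, where r = "q' ^ e"])
  let ?G = "blk c d q' \<alpha>' \<beta>' \<gamma>' \<delta>'"
  fix l
  have "?G a = q' * var a" "?G b = q' * var b" using abcd by (auto simp: blk_def)
  then have "poly_subst ?G p = q' ^ e * p" if "scales a b e p" for p
    using that by (simp add: scales_def)
  note [simp] = this[OF e(1)] this[OF e(2)] this[OF e(3)] this[OF e(4)] this[OF e(5)]
  have "?G c = \<alpha>' * var c + \<beta>' * var d" "?G d = \<gamma>' * var c + \<delta>' * var d" using abcd by (auto simp: blk_def)
  then show "poly_subst ?G (blk c d q \<alpha> \<beta> \<gamma> \<delta> l) = q' ^ e *
      blk c d (q * q') (\<alpha> * \<alpha>' + \<beta> * \<gamma>') (\<alpha> * \<beta>' + \<beta> * \<delta>') (\<gamma> * \<alpha>' + \<delta> * \<gamma>') (\<gamma> * \<beta>' + \<delta> * \<delta>') l"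
    unfolding blk_def[of c d q \<alpha> \<beta> \<gamma> \<delta>] blk_def[of c d "q * q'"]
    by (auto simp: poly_subst_add poly_subst_mult algebra_simps) (simp_all add: blk_def)
qed

lemma in_G_blk_cancel:
  assumes "in_G n (blk c d q' \<alpha>' \<beta>' \<gamma>' \<delta>')"
    "q' = h * q" "\<alpha>' = h * \<alpha>" "\<beta>' = h * \<beta>" "\<gamma>' = h * \<gamma>" "\<delta>' = h * \<delta>"
  shows "in_G n (blk c d q \<alpha> \<beta> \<gamma> \<delta>)"
  by (rule in_G_cancel[OF assms(1), where r = h]) (auto simp: blk_def assms(2-) algebra_simps)

lemma in_G_blk_const:
  assumes "c \<le> n" "d \<le> n" "c \<noteq> d" "p * s - q * r \<noteq> 0"
  shows "in_G n (blk c d 1 (const p) (const q) (const r) (const s))"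
proof -
  have "lin2 c d p q r s = blk c d 1 (const p) (const q) (const r) (const s)"
    by (auto simp: lin2_def blk_def)
  then show ?thesis using in_G_lin2[OF assms] by metis
qed

lemma in_G_blk_swap:
  assumes "c \<le> n" "d \<le> n" "c \<noteq> d"
  shows "in_G n (blk c d 1 0 1 1 0)"
  using in_G_blk_const[OF assms, of 0 0 1 1] by simp

text \<open>Composition of two reflections \<open>x\<^sub>c \<mapsto> f\<^sup>2 / x\<^sub>c\<close> and \<open>x\<^sub>c \<mapsto> g\<^sup>2 / x\<^sub>c\<close>.\<close>

lemma in_G_blk_squares:
  assumes f: "in_G n (refl_tuple c f)" "scales a b 1 f" and g: "in_G n (refl_tuple c g)"
    and abcd: "distinct [a, b, c, d]"
  shows "in_G n (blk c d (g ^ 2) (f ^ 2) 0 0 (g ^ 2))"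
proof (rule in_G_comp[OF f(1) g, where r = "var c"])
  fix l
  have "refl_tuple c g a = var c * var a" "refl_tuple c g b = var c * var b"
    using abcd by (auto simp: refl_tuple_def)
  then have "poly_subst (refl_tuple c g) f = var c * f"
    using f(2) by (auto simp: scales_def)
  moreover have "refl_tuple c g c = g ^ 2" by (simp add: refl_tuple_def)
  moreover have "refl_tuple c g l = var l * var c" if "l \<noteq> c" using that by (simp add: refl_tuple_def)
  ultimately show "poly_subst (refl_tuple c g) (refl_tuple c f l) = var c * blk c d (g ^ 2) (f ^ 2) 0 0 (g ^ 2) l"
    unfolding refl_tuple_def[of c f] blk_def
    by (auto simp: poly_subst_power poly_subst_mult power2_eq_square mult_ac)
qed

section \<open>Unipotent and scalar blocks with entries in x_a and x_b\<close>

context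
  fixes n a b c d :: nat
  assumes abcd: "{a, b, c, d} \<subseteq> {..n}" "distinct [a, b, c, d]"
begin

text \<open>Conjugating the constant transvection with entry t by diag(v^2, 1), where v = (x_b + s
  x_a) / x_a, multiplies that entry by v^2.\<close>

lemma in_G_blk_unipotent_square:
  "in_G n (blk c d ((var a)\<^sup>2) ((var a)\<^sup>2) (const t * (var b + const s * var a)\<^sup>2) 0 ((var a)\<^sup>2) :: 'k::field tuple)"
proof -
  let ?f = "var b + const s * var a :: 'k mpoly"
  have cd: "c \<le> n" "d \<le> n" "c \<noteq> d" and ca: "c \<le> n" "a \<le> n" "c \<noteq> a" using abcd by auto
  have s1: "scales a b 1 ?f"
    using scales_mult[OF scales_const scales_var(1)] by (intro scales_add) simp_all
  have s2: "scales a b 2 (p ^ 2)" if "scales a b 1 p" for p :: "'k mpoly"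
    using scales_mult[OF that that] by (simp add: power2_eq_square numeral_2_eq_2)
  have rf: "in_G n (refl_tuple c ?f)" using in_G_refl[of a b c n] abcd by auto
  have ra: "in_G n (refl_tuple c (var a :: 'k mpoly))" by (rule in_G_refl_var[OF ca])
  have E: "in_G n (blk c d 1 1 (const t) 0 1 :: 'k tuple)"
    using in_G_blk_const[OF cd, of 1 1 t 0] by simp
  have nz: "?f \<noteq> 0"
  proof
    assume "?f = 0"
    then have "poly_subst (\<lambda>l. if l = b then 1 else 0) ?f = (0 :: 'k mpoly)" by simp
    then show False using abcd by (simp add: poly_subst_add poly_subst_mult)
  qed
  have 1: "in_G n (blk c d (?f\<^sup>2) ((var a)\<^sup>2) (const t * ?f\<^sup>2) 0 (?f\<^sup>2))"
    using in_G_blk_comp[OF E in_G_blk_squares[OF ra scales_var(1) rf abcd(2)] abcd(2), of 0] by simp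
  show ?thesis
    by (rule in_G_blk_cancel[OF in_G_blk_comp[OF in_G_blk_squares[OF rf s1 ra abcd(2)] 1 abcd(2), of 2], where h = "?f\<^sup>2"])
      (use s2[OF s1] s2[OF scales_var(1)] in \<open>simp_all add: mult_ac\<close>)
qed

text \<open>From squares to linear forms by \<open>4xy = (y + x)\<^sup>2 - (y - x)\<^sup>2\<close>.\<close>

lemma in_G_blk_unipotent:
  assumes char: "CHAR('k::field) \<noteq> 2"
  shows "in_G n (blk c d (var a) (var a) (const t * var b) 0 (var a) :: 'k tuple)"
proof -
  let ?X = "var a :: 'k mpoly" and ?Y = "var b :: 'k mpoly"
  have two: "(2 :: 'k) \<noteq> 0"
  proof
    assume "(2 :: 'k) = 0"
    then have "CHAR('k) dvd 2" using of_nat_eq_0_iff_char_dvd[of 2, where 'a = 'k] by simp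
    then have "CHAR('k) \<le> 2" by (simp add: dvd_imp_le)
    moreover have "CHAR('k) \<noteq> 0" using \<open>CHAR('k) dvd 2\<close> by (metis dvd_0_left zero_neq_numeral)
    moreover have "CHAR('k) \<noteq> 1" using CHAR_not_1'[where 'a = 'k] by simp
    ultimately show False using char by linarith
  qed
  \<comment> \<open>The unipotent blocks for \<open>u\<close>, \<open>1\<close> and
    \<open>- u\<close>, \<open>- 1\<close> multiply to one with entry \<open>4 * u\<close> times x_b
    / x_a; hence the division by 4.\<close>
  define u where "u = t / 4"
  have "(4 :: 'k) = 2 * 2" by simp
  then have "(4 :: 'k) \<noteq> 0" using two by (metis mult_eq_0_iff)
  then have "t = u + u + u + u" by (simp add: u_def field_simps)
  then have t: "const t = const u + const u + const u + (const u :: 'k mpoly)"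
    unfolding const_add[symmetric] by (rule arg_cong)
  have sc: "scales a b 2 (?X\<^sup>2)" "scales a b 2 (const u * (?Y + const 1 * ?X)\<^sup>2)"
    using scales_mult[OF scales_var(1) scales_var(1), of a b]
      scales_mult[OF scales_const[of a b u] scales_mult[OF scales_add scales_add], OF scales_var(2,1) scales_var(2,1)]
    by (simp_all add: power2_eq_square numeral_2_eq_2)
  show ?thesis
    by (rule in_G_blk_cancel[OF in_G_blk_comp[OF in_G_blk_unipotent_square[of u 1] in_G_blk_unipotent_square[of "- u" "- 1"] abcd(2), of 2], where h = "?X ^ 3"])
      (use sc in \<open>simp_all add: t const_uminus power2_eq_square power3_eq_cube algebra_simps\<close>)
qed

end

text \<open>With \<open>u = x\<^sub>b / x\<^sub>a\<close>, the product of the unipotent matrices \<open>E\<^sub>1\<^sub>2(u) E\<^sub>2\<^sub>1(-1/u) E\<^sub>1\<^sub>2(u)\<close> is monomial, which gives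
  \<open>diag(u, 1/u)\<close>; multiplied by \<open>diag(1, u\<^sup>2)\<close> it becomes the scalar \<open>u\<close>.\<close>

lemma in_G_blk_scalar:
  assumes char: "CHAR('k::field) \<noteq> 2" and abcd: "{a, b, c, d} \<subseteq> {..n}" "distinct [a, b, c, d]"
  shows "in_G n (blk c d (var a) (var b) 0 0 (var b) :: 'k tuple)"
proof -
  let ?X = "var a :: 'k mpoly" and ?Y = "var b :: 'k mpoly"
  note comp = in_G_blk_comp[OF _ _ abcd(2)]
  have bacd: "{b, a, c, d} \<subseteq> {..n}" "distinct [b, a, c, d]" using abcd by auto
  have cd: "c \<le> n" "d \<le> n" "c \<noteq> d" and ca: "c \<le> n" "a \<le> n" "c \<noteq> a" and cb: "c \<le> n" "b \<le> n" "c \<noteq> b"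
    using abcd by auto
  have v1: "const (- 1 :: 'k) = - 1" by (simp add: const_uminus)
  have s2: "scales a b 2 (p * q)" if "scales a b 1 p" "scales a b 1 q" for p q :: "'k mpoly"
    using scales_mult[OF that] by (simp add: numeral_2_eq_2)
  have swap: "in_G n (blk c d 1 0 1 1 0 :: 'k tuple)" by (rule in_G_blk_swap[OF cd])
  have U: "in_G n (blk c d ?X ?X ?Y 0 ?X)"
    using in_G_blk_unipotent[OF abcd char, of 1] by simp
  \<comment> \<open>Exchanging \<open>a\<close> and \<open>b\<close> gives the entry -1/u;
    conjugation by \<open>swap\<close> then makes the block lower triangular.\<close>
  have V: "in_G n (blk c d ?Y ?Y (- ?X) 0 ?Y)"
    using in_G_blk_unipotent[OF bacd char, of "- 1"] by (simp add: v1)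
  have V1: "in_G n (blk c d ?Y 0 ?Y ?Y (- ?X))"
    using comp[OF swap V, of 0] by simp
  have V2: "in_G n (blk c d ?Y ?Y 0 (- ?X) ?Y)"
    using comp[OF V1 swap, of 1] by (simp add: scales_uminus)
  have W1: "in_G n (blk c d (?X * ?Y) 0 (?Y * ?Y) (- (?X * ?X)) (?X * ?Y))"
    by (rule in_G_blk_cancel[OF comp[OF U V2, of 1], where h = 1]) (simp_all add: mult_ac)
  have W: "in_G n (blk c d (?X * ?Y) 0 (?Y * ?Y) (- (?X * ?X)) 0)"
    by (rule in_G_blk_cancel[OF comp[OF W1 U, of 2], where h = ?X]) (simp_all add: mult_ac s2 scales_uminus)
  \<comment> \<open>This constant matrix turns the antidiagonal block \<open>W\<close> into diag(u,
    1/u), removing the sign.\<close>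
  have J: "in_G n (blk c d 1 0 (- 1) 1 0 :: 'k tuple)"
    using in_G_blk_const[OF cd, of 0 0 "- 1 :: 'k" 1] by (simp add: v1)
  have D: "in_G n (blk c d (?X * ?Y) (?Y * ?Y) 0 0 (?X * ?X))"
    using comp[OF W J, of 2] by (simp add: s2 scales_uminus)
  \<comment> \<open>This is diag(u^2, 1); conjugation by \<open>swap\<close> gives diag(1,
    u^2).\<close>
  have Q: "in_G n (blk c d (?X * ?X) (?Y * ?Y) 0 0 (?X * ?X))"
    using in_G_blk_squares[OF in_G_refl_var[OF cb] scales_var(2) in_G_refl_var[OF ca] abcd(2)]
    by (simp add: power2_eq_square)
  have Q1: "in_G n (blk c d (?X * ?X) 0 (?X * ?X) (?Y * ?Y) 0)"
    using comp[OF swap Q, of 0] by simp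
  have Q2: "in_G n (blk c d (?X * ?X) (?X * ?X) 0 0 (?Y * ?Y))"
    using comp[OF Q1 swap, of 2] by (simp add: s2)
  show ?thesis
    by (rule in_G_blk_cancel[OF comp[OF D Q2, of 2], where h = "?X * ?X * ?Y"]) (simp_all add: s2 mult_ac)
qed

section \<open>Multiplying several coordinates by x_1 / x_0, with the denominator
  \<open>var 0\<close> cleared\<close>

definition mult_tuple :: "nat set \<Rightarrow> 'k::field tuple" where
  "mult_tuple S l = (if l \<in> S then var 1 else var 0) * var l"

lemma in_G_mult_tuple_all:
  assumes "n \<ge> 1"
  shows "in_G n (mult_tuple {2..n} :: 'k::field tuple)"
proof (rule in_G_comp[OF in_G_lin2[of 0 n 1 0 0 1 1] in_G_refl_var[of 1 n 0], where r = 1])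
  fix l assume "l \<le> n"
  then consider "l = 0" | "l = 1" | "l \<in> {2..n}" by fastforce
  then show "poly_subst (refl_tuple 1 (var 0)) (lin2 0 1 0 1 1 0 l) = 1 * (mult_tuple {2..n} l :: 'k mpoly)"
    by cases (auto simp: lin2_def mult_tuple_def refl_tuple_def power2_eq_square)
qed (use assms in auto)

text \<open>\<open>in_G_blk_scalar\<close> is used with x_1 and x_0 exchanged, so that coordinates
  \<open>c\<close> and \<open>d\<close> are divided by x_1 / x_0.\<close>

lemma in_G_mult_tuple_remove:
  assumes char: "CHAR('k::field) \<noteq> 2" and S: "in_G n (mult_tuple S :: 'k tuple)"
    and cd: "c \<in> S" "d \<in> S" "c \<noteq> d" "S \<subseteq> {2..n}"
  shows "in_G n (mult_tuple (S - {c, d}) :: 'k tuple)"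
proof (rule in_G_comp[OF in_G_blk_scalar[OF char, of 1 0 c d n] S, where r = "var 0 * var 1"])
  show "{1, 0, c, d} \<subseteq> {..n}" "distinct [1, 0, c, d]" using cd by auto
  fix l
  have "0 \<notin> S" "1 \<notin> S" using cd(4) by auto
  then show "poly_subst (mult_tuple S) (blk c d (var 1) (var 0) 0 0 (var 0) l) =
      var 0 * var 1 * (mult_tuple (S - {c, d}) l :: 'k mpoly)"
    using cd by (auto simp: mult_tuple_def blk_def poly_subst_mult mult_ac)
qed

lemma in_G_mult_tuple_pairs:
  assumes char: "CHAR('k::field) \<noteq> 2" and n: "n = m + 2 * j" "m \<ge> 1"
  shows "in_G n (mult_tuple {2..m} :: 'k tuple)"
  using n
proof (induction j arbitrary: m)
  case 0
  then show ?case using in_G_mult_tuple_all[of n] by simp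
next
  case (Suc j)
  then have "in_G n (mult_tuple {2..m + 2} :: 'k tuple)" by simp
  \<comment> \<open>The two largest indices are dropped; \<open>m \<ge> 1\<close> places both in the
    range starting at 2.\<close>
  then have "in_G n (mult_tuple ({2..m + 2} - {m + 1, m + 2}) :: 'k tuple)"
    by (rule in_G_mult_tuple_remove[OF char]) (use Suc.prems in auto)
  moreover have "{2..m + 2} - {m + 1, m + 2} = {2..m}" by auto
  ultimately show ?case by simp
qed

theorem proposition4p8:
  fixes n :: nat
  assumes "CHAR('k::field) \<noteq> 2" and "n \<ge> 3"
  shows "(mu_map n :: 'k rat_map) \<in> G_proj n \<and>
         (nu_map n :: 'k rat_map) \<in> G_proj n \<and>
         ((xi_map n :: 'k rat_map) \<in> G_proj n \<longleftrightarrow> even n)"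
proof (intro conjI)
  have 0: "coord 0 \<noteq> (0 :: 'k mpoly fract)" by (simp add: coord_def)
  \<comment> \<open>Passes from polynomial tuples to the notation by rational functions;
    \<open>s\<close> is the common denominator.\<close>
  have in_GD: "rat_map_of n f \<in> G_proj n"
    if F: "in_G n F" and f: "\<And>i. i \<le> n \<Longrightarrow> to_fract (F i) = s * f i" "s \<noteq> 0" for F :: "'k tuple" and f s
    using rat_map_of_eq_cls[of F n s f] F f by (simp add: in_G_def)
  \<comment> \<open>Two reflections of x_2, with f = x_1 and g = x_0, scale it by (x_1 /
    x_0)^2.\<close>
  have "in_G n (blk 2 3 ((var 0)\<^sup>2) ((var 1)\<^sup>2) 0 0 ((var 0)\<^sup>2) :: 'k tuple)"
    by (rule in_G_blk_squares[OF in_G_refl_var scales_var(2) in_G_refl_var, where a = 0])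
      (use assms(2) in auto)
  then show "(mu_map n :: 'k rat_map) \<in> G_proj n"
    unfolding mu_map_def
    by (rule in_GD[where s = "(coord 0)\<^sup>2"])
      (use 0 in \<open>auto simp: blk_def coord_def field_simps power2_eq_square\<close>)
  have "in_G n (blk 2 3 (var 0) (var 1) 0 0 (var 1) :: 'k tuple)"
    by (rule in_G_blk_scalar[OF assms(1)]) (use assms(2) in auto)
  then show "(nu_map n :: 'k rat_map) \<in> G_proj n"
    unfolding nu_map_def
    by (rule in_GD[where s = "coord 0"])
      (use 0 in \<open>auto simp: blk_def coord_def field_simps\<close>)
  show "(xi_map n :: 'k rat_map) \<in> G_proj n \<longleftrightarrow> even n"
  proof
    assume "(xi_map n :: 'k rat_map) \<in> G_proj n"
    then show "even n" using xi_map_notin_G_proj[of n] assms(2) by auto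
  next
    assume "even n"
    then obtain j where j: "n = 2 * j" by (rule evenE)
    \<comment> \<open>Removing \<open>j - 1\<close> pairs leaves just coordinate 2; the truncated
      subtraction is exact because \<open>j\<close> is positive.\<close>
    then have "n = 2 + 2 * (j - 1)" using assms(2) by simp
    then have "in_G n (mult_tuple {2..2} :: 'k tuple)" by (rule in_G_mult_tuple_pairs[OF assms(1)]) simp
    then show "(xi_map n :: 'k rat_map) \<in> G_proj n"
      unfolding xi_map_def
      by (rule in_GD[where s = "coord 0"])
        (use 0 in \<open>auto simp: mult_tuple_def coord_def field_simps\<close>)
  qed
qed

end
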